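(* Let $\mu,\nu\in P_2(\mathbb{R})$, and let $m = e^{-V}\mathcal{L}^1$ be a probability measure on $\mathbb{R}$ such that $V \in C^{\infty}(\mathbb{R})$ is $\kappa$-convex for some $\kappa>0$. Then \[ \frac{1}{2}W_2^2(\mu, \nu)\leq \frac{1}{\kappa}(\mathrm{Ent}_{m}(\mu)+\mathrm{Ent}_{m}(\nu)) + \Phi(m,\mu,\nu), \] where \begin{align*} \Phi(m,\mu,\nu) &:=-\alpha_{m,\nu}\mathrm{bar}(\mu) - \alpha_{m,\mu}\mathrm{bar}(\nu) + \alpha_{m,\mu}\alpha_{m,\nu} + (\alpha_{m,\mu}+\alpha_{m,\nu})(\mathrm{bar}(m)-\xi_m) \\ &\quad+ \left(\xi_m - \mathrm{bar}(m) + \frac{\mathrm{bar}(\mu) + \mathrm{bar}(\nu)}{2}\right)^2 - \left(\mathrm{bar}(m) - \frac{\mathrm{bar}(\mu) + \mathrm{bar}(\nu)}{2}\right)^2. \end{align*} In particular, when $m=\gamma_1$, setting \[ \Phi(\mu,\nu):=\Phi(\gamma_1,\mu,\nu)=-\alpha_{\gamma_1,\nu}\mathrm{bar}(\mu) - \alpha_{\gamma_1,\mu}\mathrm{bar}(\nu) + \alpha_{\gamma_1,\mu}\alpha_{\gamma_1,\nu}, \] we have \[ \frac{1}{2}W_2^2(\mu, \nu)\leq \mathrm{Ent}_{\gamma_1}(\mu)+\mathrm{Ent}_{\gamma_1}(\nu) + \min\{\Phi(\mu,\nu),-\mathrm{bar}(\mu)\mathrm{bar}(\nu)\}. \]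
   Context: $\mathcal{L}^1$ is the Lebesgue measure on $\mathbb{R}$; $\gamma_1$ is the standard Gaussian measure on $\mathbb{R}$. $P_2(\mathbb{R})$ is the set of Borel probability measures on $\mathbb{R}$ with finite second moment. $W_2$ is the $L^2$-Wasserstein distance, $W_2^2(\mu,\nu)=\inf_{\pi}\int|x-y|^2\,d\pi(x,y)$ over all couplings $\pi$ of $\mu$ and $\nu$ (no factor $1/2$). $\mathrm{bar}(\mu)=\int x\,d\mu(x)$. The relative entropy is $\mathrm{Ent}_m(\mu)=\int\rho\log\rho\,dm$ if $\mu=\rho m$, and $\infty$ if $\mu$ is not absolutely continuous with respect to $m$. A smooth $V$ is $\kappa$-convex iff $V''\ge\kappa$. $\xi_m$ denotes the unique point at which the density of $m$ attains its maximum (the minimizer of $V$). For a probability measure $\mu$ on $\mathbb{R}$, $\alpha_{m,\mu}:=T(\xi_m)$, where $T$ is the optimal transport map from $m$ to $\mu$, i.e. the monotone map $T=G^{-1}\circ F$ with $F(x)=m((-\infty,x])$, $G(x)=\mu((-\infty,x])$ and $G^{-1}(s)=\inf\{y\in\mathbb{R}: G(y)>s\}$ for $s\in(0,1)$. *)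

theory Defs
  imports "HOL-Probability.Probability"
begin

definition P2 :: "real measure set" where
  "P2 = {\<mu>. real_distribution \<mu> \<and> integrable \<mu> (\<lambda>x. x\<^sup>2)}"

definition couplings :: "real measure \<Rightarrow> real measure \<Rightarrow> (real \<times> real) measure set" where
  "couplings \<mu> \<nu> = {\<pi>. sets \<pi> = sets (borel \<Otimes>\<^sub>M borel) \<and>
     distr \<pi> borel fst = \<mu> \<and> distr \<pi> borel snd = \<nu>}"

definition W2_sq :: "real measure \<Rightarrow> real measure \<Rightarrow> ennreal" where
  "W2_sq \<mu> \<nu> = (INF \<pi>\<in>couplings \<mu> \<nu>. \<integral>\<^sup>+p. ennreal ((fst p - snd p)\<^sup>2) \<partial>\<pi>)"

definition bar :: "real measure \<Rightarrow> real" where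
  "bar \<mu> = (\<integral>x. x \<partial>\<mu>)"

text \<open>Lebesgue integral with values in the extended reals, as the difference of the
  integrals of the positive and negative parts.  The Bochner integral cannot be used for the
  entropy, because it returns 0 where the entropy is infinite.\<close>

definition ext_integral :: "real measure \<Rightarrow> (real \<Rightarrow> real) \<Rightarrow> ereal" where
  "ext_integral M f =
     enn2ereal (\<integral>\<^sup>+x. ennreal (f x) \<partial>M) - enn2ereal (\<integral>\<^sup>+x. ennreal (- f x) \<partial>M)"

text \<open>For a finite measure \<open>m\<close> the negative part of \<open>\<rho> log \<rho>\<close> is bounded by \<open>1/e\<close>, hence
  integrable, so the difference above is never \<open>\<infinity> - \<infinity>\<close>.  The convention \<open>0 log 0 = 0\<close>
  holds because the product with 0 is 0.\<close>

definition Ent :: "real measure \<Rightarrow> real measure \<Rightarrow> ereal" where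
  "Ent m \<mu> =
     (if absolutely_continuous m \<mu>
      then ext_integral m (\<lambda>x. enn2real (RN_deriv m \<mu> x) * ln (enn2real (RN_deriv m \<mu> x)))
      else \<infinity>)"

definition smooth_real :: "(real \<Rightarrow> real) \<Rightarrow> bool" where
  "smooth_real V \<longleftrightarrow> (\<forall>n x. ((deriv ^^ n) V) field_differentiable (at x))"

definition kappa_convex :: "real \<Rightarrow> (real \<Rightarrow> real) \<Rightarrow> bool" where
  "kappa_convex \<kappa> V \<longleftrightarrow> (\<forall>x. \<kappa> \<le> deriv (deriv V) x)"

definition exp_measure :: "(real \<Rightarrow> real) \<Rightarrow> real measure" where
  "exp_measure V = density lborel (\<lambda>x. ennreal (exp (- V x)))"

text \<open>A density is only determined almost everywhere; its pointwise maximum refers to the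
  continuous version, which is unique.\<close>

definition mode_point :: "real measure \<Rightarrow> real" where
  "mode_point m = (THE \<xi>. \<exists>f. continuous_on UNIV f \<and> (\<forall>x. 0 \<le> f x) \<and>
     m = density lborel (\<lambda>x. ennreal (f x)) \<and> (\<forall>y. f y \<le> f \<xi>))"

definition quantile :: "real measure \<Rightarrow> real \<Rightarrow> real" where
  "quantile \<mu> s = Inf {y. cdf \<mu> y > s}"

definition transport_map :: "real measure \<Rightarrow> real measure \<Rightarrow> real \<Rightarrow> real" where
  "transport_map m \<mu> = quantile \<mu> \<circ> cdf m"

definition alpha :: "real measure \<Rightarrow> real measure \<Rightarrow> real" where
  "alpha m \<mu> = transport_map m \<mu> (mode_point m)"

definition Phi :: "real measure \<Rightarrow> real measure \<Rightarrow> real measure \<Rightarrow> real" where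
  "Phi m \<mu> \<nu> =
     - alpha m \<nu> * bar \<mu> - alpha m \<mu> * bar \<nu> + alpha m \<mu> * alpha m \<nu>
     + (alpha m \<mu> + alpha m \<nu>) * (bar m - mode_point m)
     + (mode_point m - bar m + (bar \<mu> + bar \<nu>) / 2)\<^sup>2
     - (bar m - (bar \<mu> + bar \<nu>) / 2)\<^sup>2"

definition gamma1 :: "real measure" where
  "gamma1 = std_normal_distribution"

definition Phi_gauss :: "real measure \<Rightarrow> real measure \<Rightarrow> real" where
  "Phi_gauss \<mu> \<nu> = Phi gamma1 \<mu> \<nu>"

end

theory Submission
  imports Defs "HOL-Real_Asymp.Real_Asymp"
begin

text \<open>Let \<open>T\<close>, \<open>S\<close>, \<open>X\<close> be the quantile functions of \<open>\<mu>\<close>, \<open>\<nu>\<close>, \<open>m\<close> on \<open>(0, 1)\<close>, and put \<open>p = cdf m \<xi>\<close>,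
  \<open>a = T p\<close>, \<open>b = S p\<close>, \<open>r = sqrt ((T - a) (S - b))\<close>. If \<open>q\<close> is the density of \<open>\<mu>\<close>, then \<open>ln T' = - ln (q \<circ> T)\<close>,
  so the differential entropies of \<open>\<mu>\<close> and \<open>\<nu>\<close> add up to \<open>- \<integral> ln (T' S')\<close>. On either side of \<open>p\<close> one has
  \<open>T' S' \<le> r'\<^sup>2\<close>, and \<open>ln r' \<le> r' w - 1 - ln w\<close> with \<open>w = exp (- V (X))\<close>; as \<open>w' = - V' (X)\<close>, integration by
  parts gives \<open>\<integral> ln (T' S') \<le> 2 \<integral> (r \<bar>V' (X)\<bar> - 1 + V (X))\<close>. Convexity of \<open>V\<close>,
  \<open>\<bar>V' (X)\<bar> \<ge> \<kappa> \<bar>X - \<xi>\<bar>\<close> and \<open>\<integral> (x - \<xi>) V' (x) dm = 1\<close> turn this into the bound with \<open>\<Phi>\<close>.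
  For the bound with \<open>- bar \<mu> * bar \<nu>\<close> the split is made at \<open>a = bar \<mu>\<close> instead, with a reference density that is
  a different multiple of the Gaussian density on each side of 0.\<close>

subsection \<open>Entropy of a pair of quantile functions\<close>

text \<open>The obstacle is that the quantile functions are only known to be increasing:
  \<open>T\<close> jumps across an inner gap in the support of \<mu>, and \<open>q\<close> may
  vanish. So \<open>T'\<close> and \<open>r'\<close> are never formed. Every inequality about
  \<open>ln T'\<close> is stated for averages over intervals, through
  \<open>ln ((T d - T c) / (d - c))\<close>, where a jump only adds slack. The tangent bound on
  \<open>ln y\<close> is an equality at \<open>y = 1 / w\<close>. Since
  \<open>X' = exp (V (X)) = 1 / w\<close>, the choice of \<open>w\<close> loses nothing when
  \<open>r = \<bar>X - \<xi>\<bar>\<close>. The values \<open>a\<close> and \<open>b\<close> have to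
  be passed at one common level \<open>p\<close>: then \<open>(T - a) (S - b)\<close> is nonnegative
  and \<open>r\<close> is monotone on either side of \<open>p\<close>. In the bound with \<Phi> this
  is the level where \<open>V' (X)\<close> changes sign, which is how the numbers
  \<open>alpha\<close> enter. With \<open>a = bar \<mu>\<close> the mean of \<open>T - a\<close> is
  0 and \<open>b\<close> disappears from the integral of \<open>(T - a) (S - b)\<close>. The level
  of \<open>bar \<mu>\<close> need not be 1/2, so the Gaussian is rescaled on each side of 0 to move
  its sign change there. This contributes the relative entropy of \<open>(p, 1 - p)\<close> against
  \<open>(1/2, 1/2)\<close>, which has the favourable sign.\<close>

lemma mult_ln_bound:
  fixes y w :: real
  assumes "0 < y" "0 < w"
  shows "ln y \<le> y * w - 1 - ln w"
proof -
  have "ln (y * w) \<le> y * w - 1"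
    using assms by (intro ln_le_minus_one) simp
  then show ?thesis using assms by (simp add: ln_mult)
qed

text \<open>Formally \<open>g \<le> 2 ln r'\<close> and \<open>ln r' \<le> r' w - 1 - ln w\<close>, and \<open>r' w\<close> is integrated by parts, with
  \<open>w' = - v\<close>. Since \<open>r\<close> is only monotone, this is done on small intervals, which are glued by
  bisection.\<close>

lemma half_line_entropy_bound:
  fixes p q :: real and g r w v :: "real \<Rightarrow> real"
  assumes pq: "p < q"
    and gint: "g integrable_on {p..q}" and rint: "r integrable_on {p..q}"
    and rvint: "(\<lambda>u. r u * v u) integrable_on {p..q}"
    and lwint: "(\<lambda>u. ln (w u)) integrable_on {p..q}"
    and gr: "\<And>c d. p < c \<Longrightarrow> c < d \<Longrightarrow> d < q \<Longrightarrow>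
        r c < r d \<and> integral {c..d} g \<le> 2 * ((d - c) * ln ((r d - r c) / (d - c)))"
    and r0: "\<And>u. p < u \<Longrightarrow> u < q \<Longrightarrow> 0 \<le> r u"
    and w0: "\<And>u. p < u \<Longrightarrow> u < q \<Longrightarrow> 0 < w u"
    and wder: "\<And>u. p < u \<Longrightarrow> u < q \<Longrightarrow> (w has_real_derivative - v u) (at u)"
    and vmono: "\<And>c d. p < c \<Longrightarrow> c \<le> d \<Longrightarrow> d < q \<Longrightarrow> v c \<le> v d"
    and v0: "\<And>u. p < u \<Longrightarrow> u < q \<Longrightarrow> 0 \<le> v u"
    and vcont: "\<And>u. p < u \<Longrightarrow> u < q \<Longrightarrow> isCont v u"
    and wlim: "(w \<longlongrightarrow> 0) (at_left q)"
  shows "integral {p..q} g \<le> 2 * integral {p..q} (\<lambda>u. r u * v u - 1 - ln (w u))"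
proof -
  define k where "k = (\<lambda>u. r u * v u - 1 - ln (w u))"
  have kint: "k integrable_on {p..q}"
    unfolding k_def by (intro integrable_diff rvint lwint integrable_const_ivl)
  have sub: "f integrable_on {a..b}" if "f integrable_on {p..q}" "p \<le> a" "b \<le> q" for f :: "real \<Rightarrow> real" and a b
    using integrable_on_subinterval[OF that(1)] that by (simp add: atLeastatMost_subset_iff)
  have wle: "w c - w d \<le> (d - c) * v d" if "p < c" "c \<le> d" "d < q" for c d
  proof (cases "c = d")
    case False
    then have "c < d" using that by simp
    then have "\<exists>z>c. z < d \<and> w d - w c = (d - c) * (- v z)"
      by (rule MVT2) (use wder that in auto)
    then obtain z where z: "c < z" "z < d" "w d - w c = (d - c) * (- v z)"
      by blast
    have "(d - c) * v z \<le> (d - c) * v d"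
      using vmono[of z d] z that by (intro mult_left_mono) auto
    then show ?thesis using z by (simp add: algebra_simps)
  qed simp
  have rmono: "r c \<le> r d" if "p < c" "c \<le> d" "d < q" for c d
    using gr[of c d] that by (cases "c = d") auto
  have wcont: "isCont w u" if "p < u" "u < q" for u
    using wder[OF that] by (rule DERIV_isCont)
  \<comment> \<open>On a short interval \<open>v\<close> and \<open>w\<close> are frozen at the
    right end \<open>b\<close>. Replacing \<open>v b\<close> by \<open>v u\<close> costs
    \<open>\<epsilon> * r u\<close>, replacing \<open>ln (w b)\<close> by \<open>ln (w u)\<close>
    costs \<epsilon>; hence the error \<open>\<epsilon> * (r u + 1)\<close>.\<close>
  have step: "integral {a..b} g \<le> 2 * (r b * w b - r a * w a + integral {a..b} (\<lambda>u. k u + \<epsilon> * (r u + 1)))"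
    if ab: "p < a" "a \<le> b" "b < q" and eps: "0 < \<epsilon>"
      and near: "\<And>u. a \<le> u \<Longrightarrow> u \<le> b \<Longrightarrow> v b \<le> v u + \<epsilon> \<and> - ln (w b) \<le> - ln (w u) + \<epsilon>" for a b \<epsilon>
  proof (cases "a = b")
    case False
    then have ab': "a < b" using ab by simp
    have rab: "r a < r b" and gi: "integral {a..b} g \<le> 2 * ((b - a) * ln ((r b - r a) / (b - a)))"
      using gr[of a b] ab ab' by auto
    have "(b - a) * ln ((r b - r a) / (b - a)) \<le> (b - a) * ((r b - r a) / (b - a) * w b - 1 - ln (w b))"
      using mult_ln_bound[of "(r b - r a) / (b - a)" "w b"] rab ab' w0[of b] ab
      by (intro mult_left_mono) auto
    also have "\<dots> = (r b - r a) * w b - (b - a) * (1 + ln (w b))"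
      using ab' by (simp add: field_simps)
    \<comment> \<open>Summation by parts: boundary terms that telescope over adjacent intervals,
      plus \<open>r a\<close> times the drop of \<open>w\<close>, which \<open>wle\<close> bounds by
      \<open>(b - a) * v b\<close>.\<close>
    also have "\<dots> = r b * w b - r a * w a + r a * (w a - w b) - (b - a) * (1 + ln (w b))"
      by (simp add: algebra_simps)
    also have "\<dots> \<le> r b * w b - r a * w a + r a * ((b - a) * v b) - (b - a) * (1 + ln (w b))"
      using wle[of a b] r0[of a] ab by (simp add: mult_left_mono)
    also have "\<dots> = r b * w b - r a * w a + integral {a..b} (\<lambda>u. r a * v b - 1 - ln (w b))"
      using ab' by (simp add: algebra_simps)
    also have "integral {a..b} (\<lambda>u. r a * v b - 1 - ln (w b)) \<le> integral {a..b} (\<lambda>u. k u + \<epsilon> * (r u + 1))"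
    proof (rule integral_le)
      show "(\<lambda>u. k u + \<epsilon> * (r u + 1)) integrable_on {a..b}"
        by (intro integrable_add integrable_on_mult_right integrable_const_ivl sub[OF kint] sub[OF rint]) (use ab in auto)
      fix u assume u: "u \<in> {a..b}"
      have "r a * v b \<le> r u * v b"
        using rmono[of a u] v0[of b] u ab by (intro mult_right_mono) auto
      also have "\<dots> \<le> r u * (v u + \<epsilon>)"
        using near[of u] r0[of u] u ab by (intro mult_left_mono) auto
      finally show "r a * v b - 1 - ln (w b) \<le> k u + \<epsilon> * (r u + 1)"
        using near[of u] u by (simp add: k_def algebra_simps)
    qed (rule integrable_const_ivl)
    finally show ?thesis using gi by simp
  qed simp
  \<comment> \<open>The guard is there because the bisection principle also asks for small intervals
    around \<open>x\<close> that stick out of \<open>{c..d}\<close>, while the hypotheses hold only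
    strictly inside \<open>{p..q}\<close>. Both sides of the inequality are additive in the
    interval, which gives transitivity.\<close>
  define P where "P = (\<lambda>\<epsilon> a b. p < a \<and> b < q \<longrightarrow>
     integral {a..b} g \<le> 2 * (r b * w b - r a * w a + integral {a..b} (\<lambda>u. k u + \<epsilon> * (r u + 1))))"
  have Pcd: "P \<epsilon> c d" if cd: "p < c" "c \<le> d" "d < q" and eps: "0 < \<epsilon>" for c d \<epsilon>
    using cd(2)
  proof (induction rule: Bolzano)
    case (trans a b c)
    show ?case unfolding P_def
    proof
      assume ac: "p < a \<and> c < q"
      have 1: "integral {a..b} g + integral {b..c} g = integral {a..c} g"
        by (rule Henstock_Kurzweil_Integration.integral_combine) (use trans ac in \<open>auto intro: sub[OF gint]\<close>)
      have 2: "integral {a..b} (\<lambda>u. k u + \<epsilon> * (r u + 1)) + integral {b..c} (\<lambda>u. k u + \<epsilon> * (r u + 1))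
           = integral {a..c} (\<lambda>u. k u + \<epsilon> * (r u + 1))"
        by (rule Henstock_Kurzweil_Integration.integral_combine)
           (use trans ac in \<open>auto intro!: sub[OF kint] sub[OF rint] integrable_add integrable_on_mult_right integrable_const_ivl\<close>)
      have "p < b" "b < q" using trans ac by auto
      then show "integral {a..c} g \<le> 2 * (r c * w c - r a * w a + integral {a..c} (\<lambda>u. k u + \<epsilon> * (r u + 1)))"
        using trans(1,2) ac unfolding P_def 1[symmetric] 2[symmetric] by (simp add: algebra_simps)
    qed
  next
    case (local x)
    then have x: "p < x" "x < q" using cd by auto
    have "isCont (\<lambda>u. ln (w u)) x"
      using wcont[OF x] w0[OF x] by (intro continuous_intros) auto
    then obtain d1 where d1: "d1 > 0" "\<And>y. \<bar>y - x\<bar> < d1 \<Longrightarrow> \<bar>ln (w y) - ln (w x)\<bar> < \<epsilon> / 2"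
      using eps unfolding continuous_at_eps_delta dist_real_def by (metis half_gt_zero)
    obtain d2 where d2: "d2 > 0" "\<And>y. \<bar>y - x\<bar> < d2 \<Longrightarrow> \<bar>v y - v x\<bar> < \<epsilon> / 2"
      using eps vcont[OF x] unfolding continuous_at_eps_delta dist_real_def by (metis half_gt_zero)
    show ?case
    proof (intro exI[of _ "min d1 d2"] conjI allI impI)
      fix a b assume ab: "a \<le> x \<and> x \<le> b \<and> b - a < min d1 d2"
      show "P \<epsilon> a b" unfolding P_def
      proof
        assume "p < a \<and> b < q"
        moreover have "v b \<le> v u + \<epsilon> \<and> - ln (w b) \<le> - ln (w u) + \<epsilon>" if "a \<le> u" "u \<le> b" for u
        proof -
          have "\<bar>u - x\<bar> < d1" "\<bar>u - x\<bar> < d2" "\<bar>b - x\<bar> < d1" "\<bar>b - x\<bar> < d2"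
            using ab that by auto
          from d1(2)[OF this(1)] d2(2)[OF this(2)] d1(2)[OF this(3)] d2(2)[OF this(4)]
          show ?thesis by linarith
        qed
        ultimately show "integral {a..b} g \<le> 2 * (r b * w b - r a * w a + integral {a..b} (\<lambda>u. k u + \<epsilon> * (r u + 1)))"
          using ab eps by (intro step) auto
      qed
    qed (use d1 d2 in auto)
  qed
  have main: "integral {c..d} g \<le> 2 * (r d * w d - r c * w c + integral {c..d} k)"
    if cd: "p < c" "c \<le> d" "d < q" for c d
  proof -
    \<comment> \<open>The added 1 keeps \<open>B\<close> positive, so that \<epsilon> can be taken
      as \<open>e / (2 * B)\<close>; the 2 there compensates the factor 2 of the inequality.\<close>
    define B where "B = \<bar>integral {c..d} (\<lambda>u. r u + 1)\<bar> + 1"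
    have B: "B > 0" by (simp add: B_def)
    show ?thesis
    proof (rule field_le_epsilon)
      fix e :: real assume e: "0 < e"
      define \<epsilon> where "\<epsilon> = e / (2 * B)"
      have eps: "\<epsilon> > 0" using e B by (simp add: \<epsilon>_def)
      have "integral {c..d} (\<lambda>u. k u + \<epsilon> * (r u + 1)) = integral {c..d} k + integral {c..d} (\<lambda>u. \<epsilon> * (r u + 1))"
        by (rule Henstock_Kurzweil_Integration.integral_add)
          (use cd in \<open>auto intro!: sub[OF kint] sub[OF rint] integrable_add integrable_on_mult_right integrable_const_ivl\<close>)
      also have "integral {c..d} (\<lambda>u. \<epsilon> * (r u + 1)) = \<epsilon> * integral {c..d} (\<lambda>u. r u + 1)"
        by simp
      also have "\<dots> \<le> \<epsilon> * B"
        using eps by (intro mult_left_mono) (auto simp: B_def)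
      also have "\<dots> = e / 2" using B by (simp add: \<epsilon>_def)
      finally show "integral {c..d} g \<le> 2 * (r d * w d - r c * w c + integral {c..d} k) + e"
        using Pcd[OF cd eps] cd by (simp add: P_def)
    qed
  qed
  \<comment> \<open>The boundary term at \<open>q\<close> is controlled although \<open>r\<close>
    may be unbounded: \<open>w d\<close> is the integral of \<open>v\<close> from \<open>d\<close>
    to \<open>q\<close>, and \<open>r d \<le> r u\<close> on that interval. So the term is at most a
    tail of a convergent integral, and vanishes as \<open>d\<close> tends to
    \<open>q\<close>.\<close>
  have bdry: "r d * w d \<le> integral {d..q} (\<lambda>u. r u * v u)" if d: "p < d" "d < q" for d
  proof -
    have ev: "eventually (\<lambda>e. r d * (w d - w e) \<le> integral {d..e} (\<lambda>u. r u * v u)) (at_left q)"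
      unfolding eventually_at_left[OF pq]
    proof (intro exI[of _ d] conjI allI impI)
      fix e assume e: "d < e" "e < q"
      have "((\<lambda>u. - v u) has_integral (w e - w d)) {d..e}"
        using e d by (intro fundamental_theorem_of_calculus)
          (auto simp flip: has_real_derivative_iff_has_vector_derivative intro!: DERIV_subset[OF wder])
      then have hi: "((\<lambda>u. r d * v u) has_integral r d * (w d - w e)) {d..e}"
        using has_integral_mult_right[OF has_integral_neg, of "\<lambda>u. - v u" "w e - w d" _ "r d"] by simp
      have "(\<lambda>u. r u * v u) integrable_on {d..e}" by (rule sub[OF rvint]) (use d e in auto)
      then show "r d * (w d - w e) \<le> integral {d..e} (\<lambda>u. r u * v u)"
        using hi rmono[of d] v0 d e
        by (intro has_integral_le[OF hi integrable_integral]) (auto intro!: mult_right_mono)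
    qed (use d in auto)
    have "continuous_on {d..q} (\<lambda>x. integral {d..x} (\<lambda>u. r u * v u))"
      using d by (intro indefinite_integral_continuous_1 sub[OF rvint]) auto
    then have lim2: "((\<lambda>x. integral {d..x} (\<lambda>u. r u * v u)) \<longlongrightarrow> integral {d..q} (\<lambda>u. r u * v u)) (at_left q)"
      using d by (rule_tac continuous_on_Icc_at_leftD) auto
    have lim1: "((\<lambda>e. r d * (w d - w e)) \<longlongrightarrow> r d * (w d - 0)) (at_left q)"
      by (intro tendsto_intros wlim)
    show ?thesis
      using tendsto_le[OF _ lim2 lim1 ev] by simp
  qed
  have fin1: "integral {c..q} g \<le> 2 * integral {c..q} k" if c: "p < c" "c < q" for c
  proof -
    have ev: "eventually (\<lambda>d. integral {c..d} g \<le> 2 * (integral {d..q} (\<lambda>u. r u * v u) + integral {c..d} k)) (at_left q)"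
      unfolding eventually_at_left[OF pq]
    proof (intro exI[of _ c] conjI allI impI)
      fix d assume d: "c < d" "d < q"
      \<comment> \<open>The lower boundary term enters with a minus sign and is dropped. So no
        behaviour of \<open>r\<close> or \<open>w\<close> at \<open>p\<close> has to be
        known.\<close>
      have "0 \<le> r c * w c" using r0[of c] w0[of c] c by simp
      then show "integral {c..d} g \<le> 2 * (integral {d..q} (\<lambda>u. r u * v u) + integral {c..d} k)"
        using main[of c d] bdry[of d] c d by simp
    qed (use c in auto)
    have lim: "((\<lambda>x. integral {c..x} f) \<longlongrightarrow> integral {c..q} f) (at_left q)" if "f integrable_on {p..q}" for f :: "real \<Rightarrow> real"
    proof -
      have "continuous_on {c..q} (\<lambda>x. integral {c..x} f)"
        using c by (intro indefinite_integral_continuous_1 sub[OF that]) auto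
      then show ?thesis using c by (rule_tac continuous_on_Icc_at_leftD) auto
    qed
    have "continuous_on {c..q} (\<lambda>x. integral {x..q} (\<lambda>u. r u * v u))"
      using c by (intro indefinite_integral_continuous_1' sub[OF rvint]) auto
    then have "((\<lambda>x. integral {x..q} (\<lambda>u. r u * v u)) \<longlongrightarrow> integral {q..q} (\<lambda>u. r u * v u)) (at_left q)"
      using c by (rule_tac continuous_on_Icc_at_leftD) auto
    then have lim2: "((\<lambda>d. 2 * (integral {d..q} (\<lambda>u. r u * v u) + integral {c..d} k)) \<longlongrightarrow> 2 * (0 + integral {c..q} k)) (at_left q)"
      by (intro tendsto_intros lim kint) simp
    show ?thesis
      using tendsto_le[OF _ lim2 lim[OF gint] ev] by simp
  qed
  have ev: "eventually (\<lambda>c. integral {c..q} g \<le> 2 * integral {c..q} k) (at_right p)"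
    unfolding eventually_at_right[OF pq] using fin1 pq by blast
  have lim: "((\<lambda>c. integral {c..q} f) \<longlongrightarrow> integral {p..q} f) (at_right p)" if "f integrable_on {p..q}" for f :: "real \<Rightarrow> real"
  proof -
    have "continuous_on {p..q} (\<lambda>x. integral {x..q} f)"
      using that by (rule indefinite_integral_continuous_1')
    then show ?thesis using pq by (rule_tac continuous_on_Icc_at_rightD) auto
  qed
  have "((\<lambda>c. 2 * integral {c..q} k) \<longlongrightarrow> 2 * integral {p..q} k) (at_right p)"
    by (intro tendsto_intros lim kint)
  from tendsto_le[OF _ this lim[OF gint] ev] show ?thesis
    by (simp add: k_def)
qed

text \<open>The geometric mean \<open>r = sqrt (x y)\<close> of two increasing functions satisfies \<open>dx dy \<le> (dr)\<^sup>2\<close>;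
  this is that inequality for finite differences.\<close>

lemma sqrt_mult_diff_bound:
  fixes x y x' y' :: real
  assumes "0 \<le> x" "x < x'" "0 \<le> y" "y < y'"
  shows "sqrt (x * y) < sqrt (x' * y')"
    and "(x' - x) * (y' - y) \<le> (sqrt (x' * y') - sqrt (x * y))\<^sup>2"
proof -
  show "sqrt (x * y) < sqrt (x' * y')"
    using assms by (intro real_sqrt_less_mono mult_strict_mono') auto
  obtain f g f' g' where fg: "f = sqrt x" "g = sqrt y" "f' = sqrt x'" "g' = sqrt y'" by simp
  have sq: "x = f\<^sup>2" "y = g\<^sup>2" "x' = f'\<^sup>2" "y' = g'\<^sup>2"
    using assms by (auto simp: fg)
  have rt: "sqrt (x' * y') = f' * g'" "sqrt (x * y) = f * g"
    by (simp_all add: fg real_sqrt_mult)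
  \<comment> \<open>The reversed Cauchy-Schwarz inequality for differences of squares; its defect is
    a perfect square.\<close>
  have "(f' * g' - f * g)\<^sup>2 - (f'\<^sup>2 - f\<^sup>2) * (g'\<^sup>2 - g\<^sup>2) = (f' * g - f * g')\<^sup>2"
    by (simp add: power2_eq_square algebra_simps)
  then show "(x' - x) * (y' - y) \<le> (sqrt (x' * y') - sqrt (x * y))\<^sup>2"
    unfolding rt unfolding sq using zero_le_power2[of "f' * g - f * g'"] by linarith
qed

lemma ln_diff_quotient_le:
  fixes x y x' y' h :: real
  assumes "0 \<le> x" "x < x'" "0 \<le> y" "y < y'" "0 < h"
  shows "ln ((x' - x) / h) + ln ((y' - y) / h) \<le> 2 * ln ((sqrt (x' * y') - sqrt (x * y)) / h)"
proof -
  note s = sqrt_mult_diff_bound[OF assms(1-4)]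
  have "ln ((x' - x) / h) + ln ((y' - y) / h) = ln ((x' - x) / h * ((y' - y) / h))"
    using assms by (intro ln_mult_pos[symmetric]) auto
  also have "\<dots> \<le> ln (((sqrt (x' * y') - sqrt (x * y)) / h)\<^sup>2)"
  proof (rule ln_mono)
    show "0 < (x' - x) / h * ((y' - y) / h)" using assms by simp
    show "(x' - x) / h * ((y' - y) / h) \<le> ((sqrt (x' * y') - sqrt (x * y)) / h)\<^sup>2"
      using s(2) assms(5) by (simp add: power_divide divide_right_mono power2_eq_square)
  qed
  also have "\<dots> = 2 * ln ((sqrt (x' * y') - sqrt (x * y)) / h)"
    using s(1) assms(5) by (subst ln_realpow) auto
  finally show ?thesis .
qed

text \<open>Each side of \<open>p\<close> is an instance of the half-line bound: the right side
  directly, the left side after reflecting \<open>u\<close> to \<open>- u\<close>. There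
  \<open>a - T\<close> and \<open>b - S\<close> become the nonnegative increasing factors, and their
  product is the same, so \<open>r\<close> keeps its form. As the half-line bound asks nothing of
  \<open>w\<close> at its lower end, \<open>w\<close> may jump at \<open>p\<close>; the Gaussian
  bound with the means relies on this.\<close>

lemma two_sided_entropy_bound:
  fixes p a b :: real and T S \<psi> \<phi> w v :: "real \<Rightarrow> real"
  defines "r \<equiv> \<lambda>u. sqrt ((T u - a) * (S u - b))"
  assumes p: "0 < p" "p < 1"
    and JT: "\<And>c d. 0 < c \<Longrightarrow> c < d \<Longrightarrow> d < 1 \<Longrightarrow>
        T c < T d \<and> integral {c..d} \<psi> \<le> (d - c) * ln ((T d - T c) / (d - c))"
    and JS: "\<And>c d. 0 < c \<Longrightarrow> c < d \<Longrightarrow> d < 1 \<Longrightarrow>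
        S c < S d \<and> integral {c..d} \<phi> \<le> (d - c) * ln ((S d - S c) / (d - c))"
    and \<psi>int: "\<psi> integrable_on {0..1}" and \<phi>int: "\<phi> integrable_on {0..1}"
    and left: "\<And>u. 0 < u \<Longrightarrow> u < p \<Longrightarrow> T u \<le> a \<and> S u \<le> b"
    and right: "\<And>u. p < u \<Longrightarrow> u < 1 \<Longrightarrow> a \<le> T u \<and> b \<le> S u"
    and rint: "r integrable_on {0..1}"
    and rvint: "(\<lambda>u. r u * \<bar>v u\<bar>) integrable_on {0..1}"
    and lwint: "(\<lambda>u. ln (w u)) integrable_on {0..1}"
    and w0: "\<And>u. 0 < u \<Longrightarrow> u < 1 \<Longrightarrow> u \<noteq> p \<Longrightarrow> 0 < w u"
    and wder: "\<And>u. 0 < u \<Longrightarrow> u < 1 \<Longrightarrow> u \<noteq> p \<Longrightarrow> (w has_real_derivative - v u) (at u)"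
    and vmono: "\<And>c d. 0 < c \<Longrightarrow> c \<le> d \<Longrightarrow> d < 1 \<Longrightarrow> v c \<le> v d"
    and vleft: "\<And>u. 0 < u \<Longrightarrow> u < p \<Longrightarrow> v u \<le> 0"
    and vright: "\<And>u. p < u \<Longrightarrow> u < 1 \<Longrightarrow> 0 \<le> v u"
    and vcont: "\<And>u. 0 < u \<Longrightarrow> u < 1 \<Longrightarrow> u \<noteq> p \<Longrightarrow> isCont v u"
    and wlim: "(w \<longlongrightarrow> 0) (at_left 1)" "(w \<longlongrightarrow> 0) (at_right 0)"
  shows "integral {0..1} \<psi> + integral {0..1} \<phi>
    \<le> 2 * integral {0..1} (\<lambda>u. r u * \<bar>v u\<bar> - 1 - ln (w u))"
proof -
  define g where "g = (\<lambda>u. \<psi> u + \<phi> u)"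
  define k where "k = (\<lambda>u. r u * \<bar>v u\<bar> - 1 - ln (w u))"
  have gint: "g integrable_on {0..1}" unfolding g_def by (intro integrable_add \<psi>int \<phi>int)
  have kint: "k integrable_on {0..1}"
    unfolding k_def by (intro integrable_diff rvint lwint integrable_const_ivl)
  have sub: "f integrable_on {c..d}" if "f integrable_on {0..1}" "0 \<le> c" "d \<le> 1" for f :: "real \<Rightarrow> real" and c d
    using integrable_on_subinterval[OF that(1)] that by (simp add: atLeastatMost_subset_iff)
  have subr: "(\<lambda>u. f (- u)) integrable_on {-p..0}" if "f integrable_on {0..1}" for f :: "real \<Rightarrow> real"
    using sub[OF that, of 0 p] p Henstock_Kurzweil_Integration.integrable_reflect_real[where f=f and a=0 and b=p] by simp
  have gJ: "integral {c..d} g \<le> (d - c) * (ln ((T d - T c) / (d - c)) + ln ((S d - S c) / (d - c)))"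
    if cd: "0 < c" "c < d" "d < 1" for c d
  proof -
    have "integral {c..d} g = integral {c..d} \<psi> + integral {c..d} \<phi>"
      unfolding g_def using cd
      by (intro Henstock_Kurzweil_Integration.integral_add sub[OF \<psi>int] sub[OF \<phi>int]) auto
    then show ?thesis using JT[OF cd] JS[OF cd] by (simp add: algebra_simps)
  qed
  have R: "integral {p..1} g \<le> 2 * integral {p..1} (\<lambda>u. r u * \<bar>v u\<bar> - 1 - ln (w u))"
  proof (rule half_line_entropy_bound)
    fix c d assume cd: "p < c" "c < d" "d < 1"
    have T: "T c < T d" and S: "S c < S d" using JT[of c d] JS[of c d] cd p by auto
    have ge: "a \<le> T c" "b \<le> S c" using right[of c] cd by auto
    have "ln ((T d - T c) / (d - c)) + ln ((S d - S c) / (d - c)) \<le> 2 * ln ((r d - r c) / (d - c))"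
      using ln_diff_quotient_le[of "T c - a" "T d - a" "S c - b" "S d - b" "d - c"] T S ge cd
      by (simp add: r_def)
    then have "(d - c) * (ln ((T d - T c) / (d - c)) + ln ((S d - S c) / (d - c)))
        \<le> 2 * ((d - c) * ln ((r d - r c) / (d - c)))"
      unfolding mult.left_commute[of 2] using cd by (intro mult_left_mono) auto
    moreover have "r c < r d"
      using sqrt_mult_diff_bound(1)[of "T c - a" "T d - a" "S c - b" "S d - b"] T S ge by (simp add: r_def)
    ultimately show "r c < r d \<and> integral {c..d} g \<le> 2 * ((d - c) * ln ((r d - r c) / (d - c)))"
      using gJ[of c d] cd p by (meson order.strict_trans order.trans)
  next
    fix u assume u: "p < u" "u < 1"
    show "(w has_real_derivative - \<bar>v u\<bar>) (at u)"
      using wder[of u] vright[of u] u p by simp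
    show "isCont (\<lambda>u. \<bar>v u\<bar>) u"
      using vcont[of u] u p by (intro continuous_intros) auto
    show "0 \<le> r u" using right[of u] u by (simp add: r_def)
    show "0 < w u" using w0[of u] u p by simp
  next
    fix c d assume "p < c" "c \<le> d" "d < 1"
    then show "\<bar>v c\<bar> \<le> \<bar>v d\<bar>" using vmono[of c d] vright[of c] vright[of d] p by simp
  qed (use p in \<open>auto intro!: sub[OF gint] sub[OF rint] sub[OF rvint] sub[OF lwint] wlim\<close>)
  have L: "integral {-p..0} (\<lambda>u. g (- u)) \<le> 2 * integral {-p..0} (\<lambda>u. r (- u) * \<bar>v (- u)\<bar> - 1 - ln (w (- u)))"
  proof (rule half_line_entropy_bound)
    fix c d assume cd: "- p < c" "c < d" "d < 0"
    have cd': "0 < -d" "-d < -c" "-c < 1" using cd p by auto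
    have T: "T (-d) < T (-c)" and S: "S (-d) < S (-c)" using JT[OF cd'] JS[OF cd'] by auto
    have ge: "T (-c) \<le> a" "S (-c) \<le> b" using left[of "-c"] cd p by auto
    have neg: "(T u - a) * (S u - b) = (a - T u) * (b - S u)" for u by (simp add: algebra_simps)
    have "ln ((T (-c) - T (-d)) / (d - c)) + ln ((S (-c) - S (-d)) / (d - c)) \<le> 2 * ln ((r (-d) - r (-c)) / (d - c))"
      using ln_diff_quotient_le[of "a - T (-c)" "a - T (-d)" "b - S (-c)" "b - S (-d)" "d - c"] T S ge cd
      by (simp add: r_def neg)
    then have "(d - c) * (ln ((T (-c) - T (-d)) / (d - c)) + ln ((S (-c) - S (-d)) / (d - c)))
        \<le> 2 * ((d - c) * ln ((r (-d) - r (-c)) / (d - c)))"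
      unfolding mult.left_commute[of 2] using cd by (intro mult_left_mono) auto
    moreover have "r (-c) < r (-d)"
      using sqrt_mult_diff_bound(1)[of "a - T (-c)" "a - T (-d)" "b - S (-c)" "b - S (-d)"] T S ge
      by (simp add: r_def neg)
    moreover have "integral {c..d} (\<lambda>u. g (- u)) = integral {-d..-c} g"
      using Henstock_Kurzweil_Integration.integral_reflect_real[of "-c" "-d" g] by simp
    ultimately show "r (-c) < r (-d) \<and> integral {c..d} (\<lambda>u. g (-u)) \<le> 2 * ((d - c) * ln ((r (-d) - r (-c)) / (d - c)))"
      using gJ[OF cd'] by simp
  next
    fix u assume u: "- p < u" "u < 0"
    have "((\<lambda>u. w (- u)) has_real_derivative (- v (- u)) * (- 1)) (at u)"
      by (rule DERIV_chain2[of w "- v (- u)" "\<lambda>u. - u" u "- 1"]) (use wder[of "-u"] u p in \<open>auto intro!: derivative_eq_intros\<close>)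
    then show "((\<lambda>u. w (- u)) has_real_derivative - \<bar>v (- u)\<bar>) (at u)"
      using vleft[of "-u"] u p by simp
    have "isCont (\<lambda>u. v (- u)) u"
      using vcont[of "-u"] u p isCont_o2[where f="\<lambda>u. - u" and a=u and g=v] by (simp add: continuous_intros)
    then show "isCont (\<lambda>u. \<bar>v (- u)\<bar>) u"
      by (intro continuous_intros)
    show "0 \<le> r (-u)" using left[of "-u"] u p
      by (simp add: r_def mult_nonpos_nonpos)
    show "0 < w (-u)" using w0[of "-u"] u p by simp
  next
    fix c d assume "- p < c" "c \<le> d" "d < 0"
    then show "\<bar>v (-c)\<bar> \<le> \<bar>v (-d)\<bar>" using vmono[of "-d" "-c"] vleft[of "-c"] vleft[of "-d"] p by simp
  next
    show "((\<lambda>u. w (- u)) \<longlongrightarrow> 0) (at_left 0)"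
      using wlim(2) by (subst filterlim_at_left_to_right) simp
  qed (use p in \<open>auto intro!: subr[OF gint] subr[OF rint] subr[OF rvint] subr[OF lwint]\<close>)
  have L': "integral {0..p} g \<le> 2 * integral {0..p} k"
    using L Henstock_Kurzweil_Integration.integral_reflect_real[of p 0 g] Henstock_Kurzweil_Integration.integral_reflect_real[of p 0 k] by (simp add: k_def)
  have "integral {0..1} g = integral {0..p} g + integral {p..1} g"
    "integral {0..1} k = integral {0..p} k + integral {p..1} k"
    using p by (auto intro!: Henstock_Kurzweil_Integration.integral_combine[symmetric] gint kint)
  moreover have "integral {0..1} g = integral {0..1} \<psi> + integral {0..1} \<phi>"
    unfolding g_def by (rule Henstock_Kurzweil_Integration.integral_add[OF \<psi>int \<phi>int])
  ultimately show ?thesis using R L' unfolding k_def by simp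
qed

section \<open>Quantile functions as random variables on the unit interval\<close>

text \<open>The left-continuous quantile function, with \<open>u \<le> cdf \<mu> x\<close> in place of the strict inequality in
  \<^const>\<open>quantile\<close>; the two differ only at countably many points.\<close>

definition lquantile :: "real measure \<Rightarrow> real \<Rightarrow> real" where
  "lquantile \<mu> u = Inf {x. u \<le> cdf \<mu> x}"

text \<open>The Galois connection is the reason for working with the nonstrict inequality: for
  \<open>quantile\<close> it fails at a level where the distribution function is flat.\<close>

lemma le_cdf_iff_lquantile_le:
  assumes "real_distribution \<mu>" "0 < u" "u < 1"
  shows "u \<le> cdf \<mu> x \<longleftrightarrow> lquantile \<mu> u \<le> x"
proof -
  interpret cdf_distribution \<mu> using assms by (simp add: cdf_distribution_def)
  show ?thesis unfolding lquantile_def by (rule pseudoinverse[OF assms(2,3)])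
qed

lemma lquantile_mono:
  assumes "real_distribution \<mu>" "0 < c" "c \<le> d" "d < 1"
  shows "lquantile \<mu> c \<le> lquantile \<mu> d"
proof -
  have "d \<le> cdf \<mu> (lquantile \<mu> d)" using le_cdf_iff_lquantile_le[OF assms(1)] assms by simp
  then have "c \<le> cdf \<mu> (lquantile \<mu> d)" using assms by simp
  then show ?thesis using le_cdf_iff_lquantile_le[OF assms(1), of c] assms by simp
qed

lemma lquantile_measurable:
  assumes "real_distribution \<mu>"
  shows "lquantile \<mu> \<in> borel_measurable (restrict_space lborel {0<..<1})"
proof -
  interpret cdf_distribution \<mu> using assms by (simp add: cdf_distribution_def)
  have eq: "lquantile \<mu> = (\<lambda>u. Inf {x. u \<le> cdf \<mu> x})" by (simp add: lquantile_def fun_eq_iff)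
  have "sets (restrict_space lborel {0<..<1::real}) = sets (restrict_space borel {0<..<1})"
    by (rule sets_restrict_space_cong) simp
  then show ?thesis unfolding eq using measurable_CI measurable_cong_sets by blast
qed

lemma distr_lquantile:
  assumes "real_distribution \<mu>"
  shows "distr (restrict_space lborel {0<..<1}) borel (lquantile \<mu>) = \<mu>"
proof -
  interpret cdf_distribution \<mu> using assms by (simp add: cdf_distribution_def)
  have eq: "lquantile \<mu> = (\<lambda>u. Inf {x. u \<le> cdf \<mu> x})" by (simp add: lquantile_def fun_eq_iff)
  show ?thesis unfolding eq by (rule distr_I_eq_M)
qed

text \<open>Connects the open interval, on which quantile functions are meaningful, with the closed
  one, on which the Henstock-Kurzweil integrals above are taken. The end points form a null
  set.\<close>

lemma has_integral_unit_intervalI: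
  fixes f :: "real \<Rightarrow> real"
  assumes "integrable (restrict_space lborel {0<..<1}) f"
  shows "(f has_integral (\<integral>u. f u \<partial>restrict_space lborel {0<..<1})) {0..1}"
proof -
  have si: "set_integrable lborel {0<..<1} f"
    using assms by (simp add: integrable_restrict_space set_integrable_def)
  have "(f has_integral (LINT u:{0<..<1}|lborel. f u)) {0<..<1}"
    using integrable_integral[OF set_borel_integral_eq_integral(1)[OF si]]
    by (simp only: set_borel_integral_eq_integral(2)[OF si])
  then have "(f has_integral (LINT u:{0<..<1}|lborel. f u)) {0..1}"
    by (simp add: has_integral_Icc_iff_Ioo)
  then show ?thesis
    by (simp add: integral_restrict_space set_lebesgue_integral_def)
qed

lemma integrable_lquantile_iff:
  fixes f :: "real \<Rightarrow> real"
  assumes "real_distribution \<mu>" "f \<in> borel_measurable borel"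
  shows "integrable (restrict_space lborel {0<..<1}) (\<lambda>u. f (lquantile \<mu> u)) \<longleftrightarrow> integrable \<mu> f"
  using integrable_distr_eq[OF lquantile_measurable[OF assms(1)] assms(2)] distr_lquantile[OF assms(1)]
  by simp

lemma has_integral_lquantile:
  fixes f :: "real \<Rightarrow> real"
  assumes "real_distribution \<mu>" "f \<in> borel_measurable borel" "integrable \<mu> f"
  shows "((\<lambda>u. f (lquantile \<mu> u)) has_integral (\<integral>x. f x \<partial>\<mu>)) {0..1}"
proof -
  have "(\<integral>u. f (lquantile \<mu> u) \<partial>restrict_space lborel {0<..<1}) = (\<integral>x. f x \<partial>\<mu>)"
    using integral_distr[OF lquantile_measurable[OF assms(1)] assms(2)] distr_lquantile[OF assms(1)]
    by simp
  then show ?thesis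
    using has_integral_unit_intervalI[of "\<lambda>u. f (lquantile \<mu> u)"] integrable_lquantile_iff[OF assms(1,2)] assms(3)
    by simp
qed

text \<open>Without atoms the distribution function is continuous. To the left of
  \<open>lquantile \<mu> u\<close> it stays below \<open>u\<close> by the Galois connection, so its
  value at that point cannot exceed \<open>u\<close>.\<close>

lemma cdf_lquantile:
  assumes "real_distribution \<mu>" "\<And>x. measure \<mu> {x} = 0" "0 < u" "u < 1"
  shows "cdf \<mu> (lquantile \<mu> u) = u"
proof (rule antisym)
  interpret real_distribution \<mu> by fact
  let ?x = "lquantile \<mu> u"
  show "u \<le> cdf \<mu> ?x" using le_cdf_iff_lquantile_le[OF assms(1,3,4)] by simp
  have "isCont (cdf \<mu>) ?x" using isCont_cdf assms(2) by simp
  then have "(cdf \<mu> \<longlongrightarrow> cdf \<mu> ?x) (at_left ?x)"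
    by (simp add: continuous_at filterlim_at_split)
  moreover have "eventually (\<lambda>y. cdf \<mu> y \<le> u) (at_left ?x)"
  proof -
    have "eventually (\<lambda>y. y < ?x) (at_left ?x)" by (rule eventually_at_leftI[of "?x - 1"]) auto
    then show ?thesis
    proof eventually_elim
      case (elim y)
      then show ?case using le_cdf_iff_lquantile_le[OF assms(1,3,4), of y] by linarith
    qed
  qed
  ultimately show "cdf \<mu> ?x \<le> u"
    by (rule tendsto_upperbound) simp
qed

text \<open>Links \<open>alpha\<close>, which is defined by the right-continuous inverse, with the
  left-continuous one used in the integrals: \<open>quantile \<mu> p\<close> separates the values of
  \<open>lquantile \<mu>\<close> before and after \<open>p\<close>, even if there is a jump at
  \<open>p\<close>.\<close>

lemma lquantile_le_quantile_le:
  assumes "real_distribution \<mu>" "0 < p" "p < 1"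
  shows "0 < u \<Longrightarrow> u \<le> p \<Longrightarrow> lquantile \<mu> u \<le> quantile \<mu> p"
    and "p < u \<Longrightarrow> u < 1 \<Longrightarrow> quantile \<mu> p \<le> lquantile \<mu> u"
proof -
  interpret real_distribution \<mu> by fact
  have ne: "{y. p < cdf \<mu> y} \<noteq> {}"
    using order_tendstoD(1)[OF cdf_lim_at_top_prob assms(3)]
    by (auto dest!: eventually_happens'[OF trivial_limit_at_top_linorder])
  have bdd: "bdd_below {y. p < cdf \<mu> y}"
  proof (rule bdd_belowI[of _ "lquantile \<mu> p"])
    fix y assume "y \<in> {y. p < cdf \<mu> y}"
    then have "p \<le> cdf \<mu> y" by simp
    then show "lquantile \<mu> p \<le> y" using le_cdf_iff_lquantile_le[OF assms] by blast
  qed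
  show "lquantile \<mu> u \<le> quantile \<mu> p" if "0 < u" "u \<le> p"
    unfolding quantile_def
  proof (rule cInf_greatest[OF ne])
    fix y assume "y \<in> {y. p < cdf \<mu> y}"
    then show "lquantile \<mu> u \<le> y"
      using le_cdf_iff_lquantile_le[OF assms(1), of u y] that assms by simp
  qed
  show "quantile \<mu> p \<le> lquantile \<mu> u" if "p < u" "u < 1"
    unfolding quantile_def
  proof (rule cInf_lower[OF _ bdd])
    have "u \<le> cdf \<mu> (lquantile \<mu> u)"
      using le_cdf_iff_lquantile_le[OF assms(1), of u] that assms by simp
    then show "lquantile \<mu> u \<in> {y. p < cdf \<mu> y}" using that by simp
  qed
qed

lemma measure_density_lborel_singleton:
  fixes x :: "'a :: euclidean_space"
  assumes "f \<in> borel_measurable lborel"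
  shows "measure (density lborel f) {x} = 0"
proof -
  have "absolutely_continuous lborel (density lborel f)"
    by (rule absolutely_continuousI_density[OF assms])
  then have "{x} \<in> null_sets (density lborel f)"
    unfolding absolutely_continuous_def by (rule subsetD) (simp add: null_sets_def)
  then show ?thesis by (simp add: measure_def null_setsD1)
qed

text \<open>Jensen's inequality for \<open>- ln (q \<circ> T)\<close>, \<open>T\<close> the quantile function: it stands in for the identity
  \<open>- ln (q \<circ> T) = ln T'\<close>.\<close>

lemma lquantile_log_density_bound:
  fixes q :: "real \<Rightarrow> real"
  assumes rd: "real_distribution \<mu>" and [measurable]: "q \<in> borel_measurable borel"
    and q0: "\<And>x. 0 \<le> q x" and \<mu>: "\<mu> = density lborel (\<lambda>x. ennreal (q x))"
    and int: "integrable \<mu> (\<lambda>x. ln (q x))"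
    and cd: "0 < c" "c < d" "d < 1"
  shows "lquantile \<mu> c < lquantile \<mu> d \<and>
    integral {c..d} (\<lambda>u. - ln (q (lquantile \<mu> u)))
      \<le> (d - c) * ln ((lquantile \<mu> d - lquantile \<mu> c) / (d - c))"
proof -
  interpret real_distribution \<mu> by fact
  define T where "T = lquantile \<mu>"
  have atom: "measure \<mu> {x} = 0" for x
    unfolding \<mu> by (rule measure_density_lborel_singleton) simp
  have cT: "cdf \<mu> (T u) = u" if "0 < u" "u < 1" for u
    using cdf_lquantile[OF rd atom that] by (simp add: T_def)
  have Tstrict: "T u < T u' \<longleftrightarrow> u < u'" if "0 < u" "u < 1" "0 < u'" "u' < 1" for u u'
  proof
    assume "T u < T u'"
    then show "u < u'" using lquantile_mono[OF rd that(3) _ that(2)] unfolding T_def by (meson not_less)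
  next
    assume "u < u'"
    moreover have "T u \<noteq> T u'" using cT[OF that(1,2)] cT[OF that(3,4)] \<open>u < u'\<close> by auto
    ultimately show "T u < T u'" using lquantile_mono[OF rd, of u u'] that by (simp add: T_def)
  qed
  have Tcd: "T c < T d" using Tstrict cd by simp
  define A where "A = {T c<..<T d}"
  \<comment> \<open>Since \<open>1 / 0 = 0\<close>, the \<mu>-integral of \<open>i\<close> is the
    Lebesgue measure of the part of \<open>A\<close> where \<open>q\<close> is nonzero. Parts of
    \<open>A\<close> without mass are why only an inequality with \<open>T d - T c\<close>
    results.\<close>
  define i where "i = (\<lambda>x. indicator A x * (1 / q x))"
  have [measurable]: "A \<in> sets borel" by (simp add: A_def)
  have lb: "integrable lborel (indicator A :: real \<Rightarrow> real)"
    unfolding A_def by (intro integrable_real_indicator) (auto simp: emeasure_lborel_Ioo Tcd less_imp_le)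
  have qi: "q x * i x = indicator {x. q x \<noteq> 0} x * indicator A x" for x
    by (auto simp: i_def indicator_def)
  have iint: "integrable \<mu> i" and ile: "(\<integral>x. i x \<partial>\<mu>) \<le> T d - T c"
  proof -
    have il: "integrable lborel (\<lambda>x. q x * i x)"
      unfolding qi by (rule Bochner_Integration.integrable_bound[OF lb]) (auto simp: indicator_def)
    then show "integrable \<mu> i"
      unfolding \<mu> by (subst integrable_density) (auto simp: q0 i_def)
    have "(\<integral>x. i x \<partial>\<mu>) = (\<integral>x. q x * i x \<partial>lborel)"
      unfolding \<mu> by (subst integral_density) (auto simp: q0 i_def)
    also have "\<dots> \<le> (\<integral>x. indicator A x \<partial>lborel)"
      by (rule integral_mono[OF il lb]) (auto simp: qi indicator_def)
    also have "\<dots> = T d - T c"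
      using Tcd by (simp add: A_def)
    finally show "(\<integral>x. i x \<partial>\<mu>) \<le> T d - T c" .
  qed
  have mA: "measure \<mu> A = d - c"
  proof -
    have "measure \<mu> A = cdf \<mu> (T d) - cdf \<mu> (T c)"
    proof -
      have "measure \<mu> {T c<..T d} = cdf \<mu> (T d) - cdf \<mu> (T c)"
        using cdf_diff_eq[OF Tcd] by simp
      moreover have "{T c<..T d} = A \<union> {T d}" using Tcd by (auto simp: A_def)
      moreover have "measure \<mu> (A \<union> {T d}) = measure \<mu> A + measure \<mu> {T d}"
        by (intro finite_measure_Union) (auto simp: A_def)
      ultimately show ?thesis using atom by simp
    qed
    then show ?thesis using cT cd by simp
  qed
  \<comment> \<open>The tangent to \<open>ln\<close> is taken at \<open>1 / z\<close>, the mean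
    slope of \<open>T\<close> over \<open>{c..d}\<close>. This is the choice for which the
    integrated tangent bound turns into Jensen's inequality.\<close>
  define z where "z = (d - c) / (T d - T c)"
  have z: "z > 0" using Tcd cd by (simp add: z_def)
  have ind_int: "integrable \<mu> (indicator A :: real \<Rightarrow> real)"
    by (intro integrable_real_indicator) (auto simp: less_top[symmetric])
  have lint: "integrable \<mu> (\<lambda>x. indicator A x * - ln (q x))"
    using integrable_mult_indicator[of A \<mu> "\<lambda>x. - ln (q x)"] int by simp
  have qpos: "AE x in \<mu>. 0 < q x"
    unfolding \<mu> by (subst AE_density) (auto simp: q0)
  have "integral {c..d} (\<lambda>u. - ln (q (T u))) = integral {0..1} (\<lambda>u. indicator A (T u) * - ln (q (T u)))"
  proof -
    have "integral {c..d} (\<lambda>u. - ln (q (T u))) = integral {0<..<1} (\<lambda>u. if u \<in> {c<..<d} then - ln (q (T u)) else 0)"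
      using cd by (subst integral_restrict_Int)
        (simp add: integral_open_interval_real Int_absorb2 greaterThanLessThan_subseteq_greaterThanLessThan)
    also have "\<dots> = integral {0<..<1} (\<lambda>u. indicator A (T u) * - ln (q (T u)))"
    proof (rule Henstock_Kurzweil_Integration.integral_cong)
      fix u :: real assume "u \<in> {0<..<1}"
      then have "T u \<in> A \<longleftrightarrow> u \<in> {c<..<d}" using Tstrict cd by (auto simp: A_def)
      then show "(if u \<in> {c<..<d} then - ln (q (T u)) else 0) = indicator A (T u) * - ln (q (T u))"
        by (auto simp: indicator_def)
    qed
    finally show ?thesis by (simp add: integral_open_interval_real)
  qed
  also have "\<dots> = (\<integral>x. indicator A x * - ln (q x) \<partial>\<mu>)"
    unfolding T_def by (intro integral_unique has_integral_lquantile[OF rd _ lint]) simp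
  also have "\<dots> \<le> (\<integral>x. z * i x - (1 + ln z) * indicator A x \<partial>\<mu>)"
  proof (rule integral_mono_AE[OF lint])
    show "integrable \<mu> (\<lambda>x. z * i x - (1 + ln z) * indicator A x)"
      by (intro Bochner_Integration.integrable_diff integrable_mult_right iint ind_int)
    show "AE x in \<mu>. indicator A x * - ln (q x) \<le> z * i x - (1 + ln z) * indicator A x"
      using qpos
    proof eventually_elim
      case (elim x)
      then show ?case using mult_ln_bound[of "1 / q x" z] z
        by (auto simp: indicator_def i_def ln_div algebra_simps)
    qed
  qed
  also have "\<dots> = z * (\<integral>x. i x \<partial>\<mu>) - (1 + ln z) * (d - c)"
    using iint ind_int by (simp add: mA)
  also have "\<dots> \<le> z * (T d - T c) - (1 + ln z) * (d - c)"
    using ile z by (simp add: mult_left_mono)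
  also have "z * (T d - T c) = d - c"
    using Tcd by (simp add: z_def)
  also have "d - c - (1 + ln z) * (d - c) = - (d - c) * ln z"
    by (simp add: algebra_simps)
  also have "\<dots> = (d - c) * ln ((T d - T c) / (d - c))"
    using Tcd cd by (simp add: z_def ln_div algebra_simps)
  finally show ?thesis using Tcd by (simp add: T_def)
qed

lemma integrable_sqrt_lquantile_product:
  assumes rd: "real_distribution \<mu>" "real_distribution \<nu>"
    and int: "integrable \<mu> (\<lambda>x. x)" "integrable \<nu> (\<lambda>x. x)"
  shows "integrable (restrict_space lborel {0<..<1})
    (\<lambda>u. sqrt ((lquantile \<mu> u - a) * (lquantile \<nu> u - b)))"
proof -
  let ?U = "restrict_space lborel {0<..<1::real}"
  interpret m: real_distribution \<mu> by fact
  interpret n: real_distribution \<nu> by fact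
  note [measurable] = lquantile_measurable[OF rd(1)] lquantile_measurable[OF rd(2)]
  have 1: "integrable ?U (\<lambda>u. lquantile \<mu> u - a)"
    by (rule iffD2[OF integrable_lquantile_iff[OF rd(1), of "\<lambda>x. x - a"]])
      (measurable, intro Bochner_Integration.integrable_diff int m.integrable_const)
  have 2: "integrable ?U (\<lambda>u. lquantile \<nu> u - b)"
    by (rule iffD2[OF integrable_lquantile_iff[OF rd(2), of "\<lambda>x. x - b"]])
      (measurable, intro Bochner_Integration.integrable_diff int n.integrable_const)
  \<comment> \<open>\<open>sqrt\<close> is an odd function on all reals here, so the bound holds
    whatever the sign of the product.\<close>
  have le: "\<bar>sqrt (x * y)\<bar> \<le> \<bar>x\<bar> + \<bar>y\<bar>" for x y :: real
  proof -
    have "\<bar>x * y\<bar> \<le> (\<bar>x\<bar> + \<bar>y\<bar>)\<^sup>2"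
      by (simp add: power2_sum abs_mult)
    then have "sqrt \<bar>x * y\<bar> \<le> \<bar>x\<bar> + \<bar>y\<bar>"
      by (intro real_le_lsqrt) auto
    moreover have "\<bar>sqrt z\<bar> = sqrt \<bar>z\<bar>" for z
      by (simp add: abs_if real_sqrt_minus)
    ultimately show ?thesis by simp
  qed
  show ?thesis
  proof (rule Bochner_Integration.integrable_bound[OF Bochner_Integration.integrable_add[OF integrable_abs[OF 1] integrable_abs[OF 2]]])
    show "(\<lambda>u. sqrt ((lquantile \<mu> u - a) * (lquantile \<nu> u - b))) \<in> borel_measurable ?U"
      by measurable
    show "AE u in ?U. norm (sqrt ((lquantile \<mu> u - a) * (lquantile \<nu> u - b)))
        \<le> norm (\<bar>lquantile \<mu> u - a\<bar> + \<bar>lquantile \<nu> u - b\<bar>)"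
      using le by (intro AE_I2) auto
  qed
qed

text \<open>The common core of both bounds of the theorem, with the differential entropies of \<mu>
  and \<nu> on the left. The two applications differ in the level \<open>p\<close>, the separating
  values \<open>a\<close> and \<open>b\<close>, and the reference profile \<open>w\<close> with
  \<open>w' = - v\<close>.\<close>

lemma entropy_sum_bound:
  fixes \<mu> \<nu> :: "real measure" and q\<^sub>1 q\<^sub>2 w v :: "real \<Rightarrow> real" and a b p :: real
  defines "r \<equiv> \<lambda>u. sqrt ((lquantile \<mu> u - a) * (lquantile \<nu> u - b))"
  assumes rd: "real_distribution \<mu>" "real_distribution \<nu>"
    and int: "integrable \<mu> (\<lambda>x. x)" "integrable \<nu> (\<lambda>x. x)"
    and qm: "q\<^sub>1 \<in> borel_measurable borel" "q\<^sub>2 \<in> borel_measurable borel"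
    and q0: "\<And>x. 0 \<le> q\<^sub>1 x" "\<And>x. 0 \<le> q\<^sub>2 x"
    and dens: "\<mu> = density lborel (\<lambda>x. ennreal (q\<^sub>1 x))" "\<nu> = density lborel (\<lambda>x. ennreal (q\<^sub>2 x))"
    and lnq: "integrable \<mu> (\<lambda>x. ln (q\<^sub>1 x))" "integrable \<nu> (\<lambda>x. ln (q\<^sub>2 x))"
    and p: "0 < p" "p < 1"
    and left: "\<And>u. 0 < u \<Longrightarrow> u < p \<Longrightarrow> lquantile \<mu> u \<le> a \<and> lquantile \<nu> u \<le> b"
    and right: "\<And>u. p < u \<Longrightarrow> u < 1 \<Longrightarrow> a \<le> lquantile \<mu> u \<and> b \<le> lquantile \<nu> u"
    and rvint: "(\<lambda>u. r u * \<bar>v u\<bar>) integrable_on {0..1}"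
    and lwint: "(\<lambda>u. ln (w u)) integrable_on {0..1}"
    and w0: "\<And>u. 0 < u \<Longrightarrow> u < 1 \<Longrightarrow> u \<noteq> p \<Longrightarrow> 0 < w u"
    and wder: "\<And>u. 0 < u \<Longrightarrow> u < 1 \<Longrightarrow> u \<noteq> p \<Longrightarrow> (w has_real_derivative - v u) (at u)"
    and vmono: "\<And>c d. 0 < c \<Longrightarrow> c \<le> d \<Longrightarrow> d < 1 \<Longrightarrow> v c \<le> v d"
    and vleft: "\<And>u. 0 < u \<Longrightarrow> u < p \<Longrightarrow> v u \<le> 0"
    and vright: "\<And>u. p < u \<Longrightarrow> u < 1 \<Longrightarrow> 0 \<le> v u"
    and vcont: "\<And>u. 0 < u \<Longrightarrow> u < 1 \<Longrightarrow> u \<noteq> p \<Longrightarrow> isCont v u"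
    and wlim: "(w \<longlongrightarrow> 0) (at_left 1)" "(w \<longlongrightarrow> 0) (at_right 0)"
  shows "- (\<integral>x. ln (q\<^sub>1 x) \<partial>\<mu>) - (\<integral>x. ln (q\<^sub>2 x) \<partial>\<nu>)
    \<le> 2 * integral {0..1} (\<lambda>u. r u * \<bar>v u\<bar> - 1 - ln (w u))"
proof -
  have h1: "((\<lambda>u. - ln (q\<^sub>1 (lquantile \<mu> u))) has_integral - (\<integral>x. ln (q\<^sub>1 x) \<partial>\<mu>)) {0..1}"
    by (intro has_integral_neg has_integral_lquantile[OF rd(1) _ lnq(1)] borel_measurable_ln qm)
  have h2: "((\<lambda>u. - ln (q\<^sub>2 (lquantile \<nu> u))) has_integral - (\<integral>x. ln (q\<^sub>2 x) \<partial>\<nu>)) {0..1}"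
    by (intro has_integral_neg has_integral_lquantile[OF rd(2) _ lnq(2)] borel_measurable_ln qm)
  have rint: "r integrable_on {0..1}"
    using has_integral_unit_intervalI[OF integrable_sqrt_lquantile_product[OF rd int, of a b]]
    unfolding r_def by (rule has_integral_integrable)
  have "integral {0..1} (\<lambda>u. - ln (q\<^sub>1 (lquantile \<mu> u))) + integral {0..1} (\<lambda>u. - ln (q\<^sub>2 (lquantile \<nu> u)))
    \<le> 2 * integral {0..1} (\<lambda>u. r u * \<bar>v u\<bar> - 1 - ln (w u))"
    unfolding r_def
  proof (rule two_sided_entropy_bound[where p = p and v = v])
    fix c d :: real assume cd: "0 < c" "c < d" "d < 1"
    show "lquantile \<mu> c < lquantile \<mu> d \<and> integral {c..d} (\<lambda>u. - ln (q\<^sub>1 (lquantile \<mu> u)))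
        \<le> (d - c) * ln ((lquantile \<mu> d - lquantile \<mu> c) / (d - c))"
      by (rule lquantile_log_density_bound[OF rd(1) qm(1) q0(1) dens(1) lnq(1) cd])
    show "lquantile \<nu> c < lquantile \<nu> d \<and> integral {c..d} (\<lambda>u. - ln (q\<^sub>2 (lquantile \<nu> u)))
        \<le> (d - c) * ln ((lquantile \<nu> d - lquantile \<nu> c) / (d - c))"
      by (rule lquantile_log_density_bound[OF rd(2) qm(2) q0(2) dens(2) lnq(2) cd])
  next
    show "(\<lambda>u. sqrt ((lquantile \<mu> u - a) * (lquantile \<nu> u - b))) integrable_on {0..1}"
      using rint by (simp only: r_def)
    show "(\<lambda>u. sqrt ((lquantile \<mu> u - a) * (lquantile \<nu> u - b)) * \<bar>v u\<bar>) integrable_on {0..1}"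
      using rvint by (simp only: r_def)
  qed (fact p left right has_integral_integrable[OF h1] has_integral_integrable[OF h2]
      lwint w0 wder vmono vleft vright vcont wlim)+
  then show ?thesis
    using integral_unique[OF h1] integral_unique[OF h2] by simp
qed

subsection \<open>Strongly convex potentials\<close>

lemma integral_FTC_real_line:
  fixes f F :: "real \<Rightarrow> real"
  assumes F: "\<And>x. (F has_real_derivative f x) (at x)" and f: "\<And>x. isCont f x"
    and int: "integrable lborel f" and A: "(F \<longlongrightarrow> A) at_bot" and B: "(F \<longlongrightarrow> B) at_top"
  shows "(\<integral>x. f x \<partial>lborel) = B - A"
proof -
  have "(LBINT x=-\<infinity>..\<infinity>. f x) = B - A"
    by (rule interval_integral_FTC_integrable)
      (use assms in \<open>auto simp: ereal_tendsto_simps has_real_derivative_iff_has_vector_derivative set_integrable_def\<close>)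
  then show ?thesis
    by (simp add: interval_lebesgue_integral_def set_lebesgue_integral_def)
qed

lemma integrable_FTC_real_line_nonneg:
  fixes f F :: "real \<Rightarrow> real"
  assumes F: "\<And>x. (F has_real_derivative f x) (at x)" and f: "\<And>x. isCont f x"
    and nonneg: "\<And>x. 0 \<le> f x" and A: "(F \<longlongrightarrow> A) at_bot" and B: "(F \<longlongrightarrow> B) at_top"
  shows "integrable lborel f"
proof -
  have "set_integrable lborel (einterval (-\<infinity>) \<infinity>) f"
    by (rule interval_integral_FTC_nonneg(1)) (use assms in \<open>auto simp: ereal_tendsto_simps\<close>)
  then show ?thesis by (simp add: set_integrable_def)
qed

text \<open>Convexity is put in first-order form, the integrated version of
  \<open>V'' \<ge> \<kappa>\<close>. The point \<xi> is a parameter pinned down by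
  \<open>V' \<xi> = 0\<close>; \<open>mode_point_m\<close> identifies it with
  \<open>mode_point\<close>.\<close>

locale strongly_convex_potential =
  fixes V V' :: "real \<Rightarrow> real" and \<kappa> \<xi> :: real
  assumes \<kappa>: "0 < \<kappa>"
    and V_deriv: "\<And>x. (V has_real_derivative V' x) (at x)"
    and V'_mono: "\<And>x y. x \<le> y \<Longrightarrow> \<kappa> * (y - x) \<le> V' y - V' x"
    and V'_cont: "\<And>x. isCont V' x"
    and V'_\<xi>: "V' \<xi> = 0"
    and prob: "prob_space (exp_measure V)"
begin

abbreviation m where "m \<equiv> exp_measure V"

lemma V_cont: "isCont V x"
  using V_deriv by (rule DERIV_isCont)

lemma V_measurable [measurable]: "V \<in> borel_measurable borel"
  by (intro borel_measurable_continuous_onI continuous_at_imp_continuous_on ballI V_cont)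

lemma V'_measurable [measurable]: "V' \<in> borel_measurable borel"
  by (intro borel_measurable_continuous_onI continuous_at_imp_continuous_on ballI V'_cont)

text \<open>Subtracting the tangent slope and the parabola at \<open>x\<close> leaves a function
  whose derivative \<open>V' t - V' x - \<kappa> (t - x)\<close> has the sign of
  \<open>t - x\<close>, so its minimum is at \<open>x\<close>.\<close>

lemma V_lower: "V x + V' x * (y - x) + \<kappa> / 2 * (y - x)\<^sup>2 \<le> V y"
proof -
  define f where "f = (\<lambda>t. V t - V' x * t - \<kappa> / 2 * (t - x)\<^sup>2)"
  have f': "(f has_real_derivative V' t - V' x - \<kappa> * (t - x)) (at t)" for t
    unfolding f_def by (auto intro!: derivative_eq_intros V_deriv)
  have "f x \<le> f y"
  proof (cases "x \<le> y")
    case True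
    show ?thesis
    proof (rule DERIV_nonneg_imp_nondecreasing[OF True])
      fix t assume "x \<le> t" "t \<le> y"
      then show "\<exists>z. (f has_real_derivative z) (at t) \<and> 0 \<le> z"
        using f'[of t] V'_mono[of x t] by (intro exI[of _ "V' t - V' x - \<kappa> * (t - x)"]) auto
    qed
  next
    case False
    then have "y \<le> x" by simp
    then show ?thesis
    proof (rule DERIV_nonpos_imp_nonincreasing)
      fix t assume "y \<le> t" "t \<le> x"
      then show "\<exists>z. (f has_real_derivative z) (at t) \<and> z \<le> 0"
        using f'[of t] V'_mono[of t x]
        by (intro exI[of _ "V' t - V' x - \<kappa> * (t - x)"]) (auto simp: algebra_simps)
    qed
  qed
  then show ?thesis by (simp add: f_def algebra_simps)
qed

lemma V_lower_\<xi>: "V \<xi> + \<kappa> / 2 * (x - \<xi>)\<^sup>2 \<le> V x"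
  using V_lower[of \<xi> x] by (simp add: V'_\<xi>)

lemma V'_sign: "\<xi> \<le> x \<Longrightarrow> 0 \<le> V' x" "x \<le> \<xi> \<Longrightarrow> V' x \<le> 0"
proof -
  show "0 \<le> V' x" if "\<xi> \<le> x"
  proof -
    have "0 \<le> \<kappa> * (x - \<xi>)" using \<kappa> that by simp
    then show ?thesis using V'_mono[OF that] V'_\<xi> by linarith
  qed
  show "V' x \<le> 0" if "x \<le> \<xi>"
  proof -
    have "0 \<le> \<kappa> * (\<xi> - x)" using \<kappa> that by simp
    then show ?thesis using V'_mono[OF that] V'_\<xi> by linarith
  qed
qed

lemma V'_nondecreasing: "x \<le> y \<Longrightarrow> V' x \<le> V' y"
proof -
  assume "x \<le> y"
  then have "0 \<le> \<kappa> * (y - x)" using \<kappa> by simp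
  then show ?thesis using V'_mono[OF \<open>x \<le> y\<close>] by linarith
qed

lemma exp_V_le: "exp (- V x) \<le> exp (- V \<xi>) * exp (- \<kappa> / 2 * (x - \<xi>)\<^sup>2)"
  using V_lower_\<xi>[of x] by (simp flip: exp_add)

lemma exp_V_limits:
  "((\<lambda>x. exp (- V x)) \<longlongrightarrow> 0) at_top" "((\<lambda>x. exp (- V x)) \<longlongrightarrow> 0) at_bot"
  "((\<lambda>x. (x - \<xi>) * exp (- V x)) \<longlongrightarrow> 0) at_top" "((\<lambda>x. (x - \<xi>) * exp (- V x)) \<longlongrightarrow> 0) at_bot"
proof -
  define C where "C = exp (- V \<xi>)"
  have C: "C > 0" by (simp add: C_def)
  have le: "norm (exp (- V x)) \<le> C * exp (- \<kappa> / 2 * (x - \<xi>)\<^sup>2)" for x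
    using exp_V_le by (simp add: C_def)
  have le2: "norm ((x - \<xi>) * exp (- V x)) \<le> \<bar>(x - \<xi>) * (C * exp (- \<kappa> / 2 * (x - \<xi>)\<^sup>2))\<bar>" for x
    using mult_left_mono[OF le[of x], of "\<bar>x - \<xi>\<bar>"] C by (simp add: abs_mult)
  have "((\<lambda>x. C * exp (- \<kappa> / 2 * (x - \<xi>)\<^sup>2)) \<longlongrightarrow> 0) at_top"
    using C \<kappa> by real_asymp
  then show "((\<lambda>x. exp (- V x)) \<longlongrightarrow> 0) at_top"
    by (rule Lim_null_comparison[rotated]) (use le in auto)
  have "((\<lambda>x. C * exp (- \<kappa> / 2 * (x - \<xi>)\<^sup>2)) \<longlongrightarrow> 0) at_bot"
    using C \<kappa> by real_asymp
  then show "((\<lambda>x. exp (- V x)) \<longlongrightarrow> 0) at_bot"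
    by (rule Lim_null_comparison[rotated]) (use le in auto)
  have "((\<lambda>x. (x - \<xi>) * (C * exp (- \<kappa> / 2 * (x - \<xi>)\<^sup>2))) \<longlongrightarrow> 0) at_top"
    using C \<kappa> by real_asymp
  then have "((\<lambda>x. \<bar>(x - \<xi>) * (C * exp (- \<kappa> / 2 * (x - \<xi>)\<^sup>2))\<bar>) \<longlongrightarrow> 0) at_top"
    by (rule tendsto_rabs_zero)
  then show "((\<lambda>x. (x - \<xi>) * exp (- V x)) \<longlongrightarrow> 0) at_top"
    by (rule Lim_null_comparison[rotated]) (use le2 in auto)
  have "((\<lambda>x. (x - \<xi>) * (C * exp (- \<kappa> / 2 * (x - \<xi>)\<^sup>2))) \<longlongrightarrow> 0) at_bot"
    using C \<kappa> by real_asymp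
  then have "((\<lambda>x. \<bar>(x - \<xi>) * (C * exp (- \<kappa> / 2 * (x - \<xi>)\<^sup>2))\<bar>) \<longlongrightarrow> 0) at_bot"
    by (rule tendsto_rabs_zero)
  then show "((\<lambda>x. (x - \<xi>) * exp (- V x)) \<longlongrightarrow> 0) at_bot"
    by (rule Lim_null_comparison[rotated]) (use le2 in auto)
qed

lemma m_real_distribution: "real_distribution m"
  using prob by (simp add: real_distribution_def real_distribution_axioms_def exp_measure_def)

sublocale m: real_distribution m
  by (rule m_real_distribution)

lemma integrable_m_iff:
  fixes f :: "real \<Rightarrow> real"
  assumes "f \<in> borel_measurable borel"
  shows "integrable m f \<longleftrightarrow> integrable lborel (\<lambda>x. exp (- V x) * f x)"
  unfolding exp_measure_def using assms by (subst integrable_density) auto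

lemma integral_m:
  fixes f :: "real \<Rightarrow> real"
  assumes "f \<in> borel_measurable borel"
  shows "(\<integral>x. f x \<partial>m) = (\<integral>x. exp (- V x) * f x \<partial>lborel)"
  unfolding exp_measure_def using assms by (subst integral_density) auto

lemma m_atom: "measure m {x} = 0"
  unfolding exp_measure_def by (rule measure_density_lborel_singleton) simp

lemma cdf_m_deriv: "(cdf m has_real_derivative exp (- V x)) (at x)"
proof -
  \<comment> \<open>A base point to the left of \<open>x\<close> splits off a constant and leaves an
    integral over a compact interval, to which the fundamental theorem applies.\<close>
  have diff: "cdf m y = cdf m (x - 1) + integral {x - 1..y} (\<lambda>t. exp (- V t))" if "x - 1 < y" for y
  proof -
    have ex: "integrable lborel (\<lambda>t. exp (- V t) * indicator {x - 1<..y} t)"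
    proof (rule iffD1[OF integrable_m_iff])
      show "integrable m (indicator {x - 1<..y} :: real \<Rightarrow> real)"
        by (rule integrable_real_indicator) (auto simp: less_top[symmetric])
    qed simp
    have "cdf m y - cdf m (x - 1) = (\<integral>t. indicator {x - 1<..y} t \<partial>m)"
      using m.cdf_diff_eq[OF that] by simp
    also have "\<dots> = (\<integral>t. exp (- V t) * indicator {x - 1<..y} t \<partial>lborel)"
      by (rule integral_m) simp
    also have "\<dots> = (LINT t:{x - 1<..y}|lborel. exp (- V t))"
      by (simp add: set_lebesgue_integral_def mult.commute)
    also have "\<dots> = integral {x - 1<..y} (\<lambda>t. exp (- V t))"
      using ex by (intro set_borel_integral_eq_integral(2)) (simp add: set_integrable_def mult.commute)
    also have "\<dots> = integral {x - 1..y} (\<lambda>t. exp (- V t))"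
      by (rule integral_spike_set) (auto intro: negligible_subset[OF negligible_sing[of "x - 1"]])
    finally show ?thesis by simp
  qed
  have "((\<lambda>y. integral {x - 1..y} (\<lambda>t. exp (- V t))) has_real_derivative exp (- V x)) (at x within {x - 1..x + 1})"
    by (intro integral_has_real_derivative continuous_at_imp_continuous_on ballI continuous_intros V_cont) auto
  then have "((\<lambda>y. integral {x - 1..y} (\<lambda>t. exp (- V t))) has_real_derivative exp (- V x)) (at x)"
    by (subst (asm) at_within_interior) (auto simp: interior_atLeastAtMost_real)
  then have "((\<lambda>y. cdf m (x - 1) + integral {x - 1..y} (\<lambda>t. exp (- V t))) has_real_derivative exp (- V x)) (at x)"
    by (auto intro!: derivative_eq_intros)
  then show ?thesis
    by (rule has_field_derivative_transform_within_open[where S = "{x - 1<..}"]) (auto simp: diff)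
qed

lemma cdf_m_strict_mono: "x < y \<Longrightarrow> cdf m x < cdf m y"
  by (rule DERIV_pos_imp_increasing) (use cdf_m_deriv exp_gt_zero in blast)+

lemma cdf_m_bounds: "0 < cdf m x" "cdf m x < 1"
proof -
  have "cdf m (x - 1) < cdf m x" by (rule cdf_m_strict_mono) simp
  then show "0 < cdf m x" using m.cdf_nonneg[of "x - 1"] by linarith
  have "cdf m x < cdf m (x + 1)" by (rule cdf_m_strict_mono) simp
  then show "cdf m x < 1" using m.cdf_bounded_prob[of "x + 1"] by linarith
qed

abbreviation X where "X \<equiv> lquantile m"

lemma cdf_X: "0 < u \<Longrightarrow> u < 1 \<Longrightarrow> cdf m (X u) = u"
  by (rule cdf_lquantile[OF m_real_distribution m_atom])

lemma X_cdf: "X (cdf m x) = x"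
proof -
  have "cdf m (X (cdf m x)) = cdf m x" by (rule cdf_X[OF cdf_m_bounds])
  then show ?thesis using cdf_m_strict_mono by (metis linorder_less_linear order_less_irrefl)
qed

lemma X_le_iff: "0 < u \<Longrightarrow> u < 1 \<Longrightarrow> X u \<le> x \<longleftrightarrow> u \<le> cdf m x"
  using le_cdf_iff_lquantile_le[OF m_real_distribution] by blast

lemma X_cont: assumes "0 < u" "u < 1" shows "isCont X u"
proof -
  have "isCont X (cdf m (X u))"
    by (rule isCont_inverse_function[where d = 1]) (auto simp: X_cdf intro: DERIV_isCont[OF cdf_m_deriv])
  then show ?thesis using cdf_X[OF assms] by simp
qed

lemma X_deriv: assumes "0 < u" "u < 1" shows "(X has_real_derivative exp (V (X u))) (at u)"
proof -
  have "(X has_real_derivative inverse (exp (- V (X u)))) (at u)"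
    by (rule DERIV_inverse_function[OF cdf_m_deriv _ assms]) (use cdf_X X_cont[OF assms] in auto)
  then show ?thesis by (simp add: exp_minus)
qed

text \<open>This is \<open>w' = - v\<close> for the profile \<open>w = exp (- V (X))\<close>: the
  factor \<open>X' = exp (V (X))\<close> from the chain rule cancels the exponential.\<close>

lemma exp_V_X_deriv:
  assumes "0 < u" "u < 1"
  shows "((\<lambda>u. exp (- V (X u))) has_real_derivative - V' (X u)) (at u)"
proof -
  have "((\<lambda>u. V (X u)) has_real_derivative V' (X u) * exp (V (X u))) (at u)"
    by (rule DERIV_chain2[OF V_deriv X_deriv[OF assms]])
  then have "((\<lambda>u. exp (- V (X u))) has_real_derivative exp (- V (X u)) * - (V' (X u) * exp (V (X u)))) (at u)"
    by (intro DERIV_fun_exp DERIV_minus)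
  moreover have "exp (- V (X u)) * - (V' (X u) * exp (V (X u))) = - V' (X u)"
    by (simp add: exp_minus)
  ultimately show ?thesis by (simp only:)
qed

lemma V'_X_cont: "0 < u \<Longrightarrow> u < 1 \<Longrightarrow> isCont (\<lambda>u. V' (X u)) u"
  by (rule isCont_o2[OF X_cont V'_cont])

lemma V'_X_mono: "0 < c \<Longrightarrow> c \<le> d \<Longrightarrow> d < 1 \<Longrightarrow> V' (X c) \<le> V' (X d)"
  by (intro V'_nondecreasing lquantile_mono[OF m_real_distribution])

lemma X_vs_\<xi>:
  shows "0 < u \<Longrightarrow> u \<le> cdf m \<xi> \<Longrightarrow> X u \<le> \<xi>"
    and "cdf m \<xi> \<le> u \<Longrightarrow> u < 1 \<Longrightarrow> \<xi> \<le> X u"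
proof -
  show "X u \<le> \<xi>" if "0 < u" "u \<le> cdf m \<xi>"
    using X_le_iff[of u \<xi>] cdf_m_bounds[of \<xi>] that by simp
  show "\<xi> \<le> X u" if "cdf m \<xi> \<le> u" "u < 1"
    using lquantile_mono[OF m_real_distribution, of "cdf m \<xi>" u] cdf_m_bounds[of \<xi>] that by (simp add: X_cdf)
qed

lemma exp_V_X_limits:
  "((\<lambda>u. exp (- V (X u))) \<longlongrightarrow> 0) (at_left 1)" "((\<lambda>u. exp (- V (X u))) \<longlongrightarrow> 0) (at_right 0)"
proof -
  have "filterlim X at_top (at_left 1)"
    unfolding filterlim_at_top
  proof
    fix Z
    show "eventually (\<lambda>u. Z \<le> X u) (at_left 1)"
    proof (rule eventually_at_leftI[of "cdf m Z"])
      fix u assume "u \<in> {cdf m Z<..<1}"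
      then show "Z \<le> X u"
        using lquantile_mono[OF m_real_distribution, of "cdf m Z" u] cdf_m_bounds[of Z] by (simp add: X_cdf)
    qed (rule cdf_m_bounds)
  qed
  then show "((\<lambda>u. exp (- V (X u))) \<longlongrightarrow> 0) (at_left 1)"
    by (rule filterlim_compose[OF exp_V_limits(1)])
  have "filterlim X at_bot (at_right 0)"
    unfolding filterlim_at_bot
  proof
    fix Z
    show "eventually (\<lambda>u. X u \<le> Z) (at_right 0)"
    proof (rule eventually_at_rightI[of 0 "cdf m Z"])
      fix u assume "u \<in> {0<..<cdf m Z}"
      then show "X u \<le> Z"
        using X_le_iff[of u Z] cdf_m_bounds[of Z] by simp
    qed (rule cdf_m_bounds)
  qed
  then show "((\<lambda>u. exp (- V (X u))) \<longlongrightarrow> 0) (at_right 0)"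
    by (rule filterlim_compose[OF exp_V_limits(2)])
qed

text \<open>The value 1, taken once for \<mu> and once for \<nu>, cancels the constant
  \<open>- 1\<close> of the tangent bound, which also occurs twice.\<close>

lemma deriv_moment: "integrable m (\<lambda>x. (x - \<xi>) * V' x)" "(\<integral>x. (x - \<xi>) * V' x \<partial>m) = 1"
proof -
  \<comment> \<open>The antiderivative found by integrating by parts. The correction term vanishes
    at both ends, so the limits are those of \<open>cdf m\<close>. The integrand is nonnegative,
    which yields integrability together with the value.\<close>
  define H where "H = (\<lambda>x. cdf m x - (x - \<xi>) * exp (- V x))"
  have H: "(H has_real_derivative exp (- V x) * ((x - \<xi>) * V' x)) (at x)" for x
  proof -
    have "((\<lambda>x. exp (- V x)) has_real_derivative exp (- V x) * - V' x) (at x)"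
      by (intro DERIV_fun_exp DERIV_minus V_deriv)
    then show ?thesis unfolding H_def
      using DERIV_diff[OF cdf_m_deriv[of x] DERIV_mult[OF DERIV_diff[OF DERIV_ident DERIV_const[of \<xi>]]]]
      by (force simp: algebra_simps)
  qed
  have cont: "isCont (\<lambda>x. exp (- V x) * ((x - \<xi>) * V' x)) x" for x
    by (intro continuous_intros V_cont V'_cont)
  have "(H \<longlongrightarrow> 0 - 0) at_bot"
    unfolding H_def by (intro tendsto_diff m.cdf_lim_at_bot exp_V_limits)
  moreover have "(H \<longlongrightarrow> 1 - 0) at_top"
    unfolding H_def by (intro tendsto_diff m.cdf_lim_at_top_prob exp_V_limits)
  moreover have "0 \<le> exp (- V x) * ((x - \<xi>) * V' x)" for x
    using V'_sign[of x] by (cases "\<xi> \<le> x") (auto simp: mult_nonpos_nonpos)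
  ultimately have "integrable lborel (\<lambda>x. exp (- V x) * ((x - \<xi>) * V' x))"
      "(\<integral>x. exp (- V x) * ((x - \<xi>) * V' x) \<partial>lborel) = 1"
    using integrable_FTC_real_line_nonneg[OF H cont] integral_FTC_real_line[OF H cont]
    by force+
  then show "integrable m (\<lambda>x. (x - \<xi>) * V' x)" "(\<integral>x. (x - \<xi>) * V' x \<partial>m) = 1"
    by (simp_all add: integrable_m_iff integral_m)
qed

text \<open>Removes the term linear in \<open>V' (X)\<close> from the integrated pointwise bound.
  For integrability, \<open>\<bar>V'\<bar> \<le> (x - \<xi>) V'\<close> away from \<xi>, and within
  distance 1 of \<xi> monotonicity bounds \<open>V'\<close> by its values at
  \<open>\<xi> - 1\<close> and \<open>\<xi> + 1\<close>.\<close>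

lemma deriv_mean_zero: "integrable m V'" "(\<integral>x. V' x \<partial>m) = 0"
proof -
  show int: "integrable m V'"
  proof (rule Bochner_Integration.integrable_bound)
    show "integrable m (\<lambda>x. (x - \<xi>) * V' x + (\<bar>V' (\<xi> + 1)\<bar> + \<bar>V' (\<xi> - 1)\<bar>))"
      by (intro Bochner_Integration.integrable_add deriv_moment m.integrable_const)
    show "AE x in m. norm (V' x) \<le> norm ((x - \<xi>) * V' x + (\<bar>V' (\<xi> + 1)\<bar> + \<bar>V' (\<xi> - 1)\<bar>))"
    proof (rule AE_I2)
      fix x
      have nn: "(x - \<xi>) * V' x = \<bar>x - \<xi>\<bar> * \<bar>V' x\<bar>"
        using V'_sign[of x] by (cases "\<xi> \<le> x") (simp_all add: abs_of_nonpos algebra_simps)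
      have "\<bar>V' x\<bar> \<le> \<bar>x - \<xi>\<bar> * \<bar>V' x\<bar> + (\<bar>V' (\<xi> + 1)\<bar> + \<bar>V' (\<xi> - 1)\<bar>)"
      proof (cases "\<bar>x - \<xi>\<bar> \<le> 1")
        case True
        then have "V' (\<xi> - 1) \<le> V' x" "V' x \<le> V' (\<xi> + 1)" by (auto intro!: V'_nondecreasing)
        moreover have "0 \<le> \<bar>x - \<xi>\<bar> * \<bar>V' x\<bar>" by simp
        ultimately show ?thesis by linarith
      next
        case False
        then have "1 * \<bar>V' x\<bar> \<le> \<bar>x - \<xi>\<bar> * \<bar>V' x\<bar>" by (intro mult_right_mono) auto
        then show ?thesis by linarith
      qed
      then show "norm (V' x) \<le> norm ((x - \<xi>) * V' x + (\<bar>V' (\<xi> + 1)\<bar> + \<bar>V' (\<xi> - 1)\<bar>))"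
        unfolding nn by simp
    qed
  qed simp
  have "((\<lambda>x. - exp (- V x)) has_real_derivative exp (- V x) * V' x) (at x)" for x
  proof -
    have "((\<lambda>x. exp (- V x)) has_real_derivative exp (- V x) * - V' x) (at x)"
      by (intro DERIV_fun_exp DERIV_minus V_deriv)
    from DERIV_minus[OF this] show ?thesis by simp
  qed
  moreover have "isCont (\<lambda>x. exp (- V x) * V' x) x" for x
    by (intro continuous_intros V_cont V'_cont)
  moreover have "integrable lborel (\<lambda>x. exp (- V x) * V' x)"
    using int by (simp add: integrable_m_iff)
  moreover have "((\<lambda>x. - exp (- V x)) \<longlongrightarrow> - 0) at_bot" "((\<lambda>x. - exp (- V x)) \<longlongrightarrow> - 0) at_top"
    by (intro tendsto_minus exp_V_limits)+
  ultimately have "(\<integral>x. exp (- V x) * V' x \<partial>lborel) = - 0 - (- 0)"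
    by (rule integral_FTC_real_line)
  then show "(\<integral>x. V' x \<partial>m) = 0" by (simp add: integral_m)
qed

text \<open>By convexity \<open>V\<close> lies between its minimum \<open>V \<xi>\<close> and
  \<open>V \<xi> + (x - \<xi>) V' x\<close>; the upper bound is the tangent at \<open>x\<close>
  evaluated at \<xi>.\<close>

lemma integrable_potential: "integrable m V"
proof (rule Bochner_Integration.integrable_bound)
  show "integrable m (\<lambda>x. (x - \<xi>) * V' x + \<bar>V \<xi>\<bar>)"
    by (intro Bochner_Integration.integrable_add deriv_moment m.integrable_const)
  show "AE x in m. norm (V x) \<le> norm ((x - \<xi>) * V' x + \<bar>V \<xi>\<bar>)"
  proof (rule AE_I2)
    fix x
    have "0 \<le> \<kappa> / 2 * (x - \<xi>)\<^sup>2" "0 \<le> \<kappa> / 2 * (\<xi> - x)\<^sup>2" using \<kappa> by simp_all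
    then have "V \<xi> \<le> V x" "V x \<le> V \<xi> + (x - \<xi>) * V' x"
      using V_lower_\<xi>[of x] V_lower[of x \<xi>] by (simp_all add: algebra_simps)
    then show "norm (V x) \<le> norm ((x - \<xi>) * V' x + \<bar>V \<xi>\<bar>)" by simp
  qed
qed simp

lemma integrable_power2_m: "integrable m (\<lambda>x. (x - \<xi>)\<^sup>2)"
proof (rule Bochner_Integration.integrable_bound)
  show "integrable m (\<lambda>x. 2 / \<kappa> * (V x - V \<xi>))"
    by (intro integrable_mult_right Bochner_Integration.integrable_diff integrable_potential m.integrable_const)
  show "AE x in m. norm ((x - \<xi>)\<^sup>2) \<le> norm (2 / \<kappa> * (V x - V \<xi>))"
  proof (rule AE_I2)
    fix x
    have "(x - \<xi>)\<^sup>2 \<le> 2 / \<kappa> * (V x - V \<xi>)"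
      using V_lower_\<xi>[of x] \<kappa> by (simp add: field_simps)
    then have "\<bar>(x - \<xi>)\<^sup>2\<bar> \<le> \<bar>2 / \<kappa> * (V x - V \<xi>)\<bar>"
      by (metis abs_ge_self abs_power2 order.trans)
    then show "norm ((x - \<xi>)\<^sup>2) \<le> norm (2 / \<kappa> * (V x - V \<xi>))" by (simp only: real_norm_def)
  qed
qed simp

end

subsection \<open>Relative entropy and Wasserstein distance\<close>

lemma minus_mult_ln_le_1:
  fixes x :: real
  assumes "0 \<le> x"
  shows "- (x * ln x) \<le> 1"
proof (cases "x = 0")
  case False
  then have x: "0 < x" using assms by simp
  have "x * ln (1 / x) \<le> x * (1 / x - 1)"
    using ln_le_minus_one[of "1 / x"] x by (intro mult_left_mono) auto
  also have "\<dots> = 1 - x" using x by (simp add: field_simps)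
  finally show ?thesis using x by (simp add: ln_div)
qed simp

text \<open>On a probability space the negative part of \<open>\<rho> ln \<rho>\<close> has integral
  at most 1. So for an absolutely continuous \<mu> the extended integral is infinite exactly when
  the positive part diverges, and otherwise agrees with the Bochner integral.\<close>

lemma Ent_cases:
  assumes m: "prob_space m" "sets m = sets borel" and rd: "real_distribution \<mu>"
  obtains "Ent m \<mu> = \<infinity>"
    | \<rho> where "\<rho> \<in> borel_measurable borel" "\<And>x. 0 \<le> \<rho> x" "\<mu> = density m (\<lambda>x. ennreal (\<rho> x))"
        "integrable m (\<lambda>x. \<rho> x * ln (\<rho> x))" "Ent m \<mu> = ereal (\<integral>x. \<rho> x * ln (\<rho> x) \<partial>m)"
proof (cases "absolutely_continuous m \<mu>")
  case False
  then show ?thesis using that(1) by (simp add: Ent_def)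
next
  case ac: True
  interpret m: prob_space m by fact
  interpret real_distribution \<mu> by fact
  define \<rho> where "\<rho> = (\<lambda>x. enn2real (RN_deriv m \<mu> x))"
  have sets: "sets \<mu> = sets m" using m by simp
  have mc: "borel_measurable m = borel_measurable borel" using m by (intro measurable_cong_sets) auto
  have RNm: "RN_deriv m \<mu> \<in> borel_measurable m" by simp
  then have \<rho>m: "\<rho> \<in> borel_measurable borel" unfolding \<rho>_def mc by simp
  then have \<rho>m': "\<rho> \<in> borel_measurable m" by (simp only: mc)
  have fin: "AE x in m. RN_deriv m \<mu> x \<noteq> \<infinity>"
    by (rule m.RN_deriv_finite[OF _ ac sets]) unfold_locales
  have "density m (\<lambda>x. ennreal (\<rho> x)) = density m (RN_deriv m \<mu>)"
  proof (rule density_cong)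
    show "AE x in m. ennreal (\<rho> x) = RN_deriv m \<mu> x"
      using fin by eventually_elim (auto simp: \<rho>_def less_top)
  qed (use \<rho>m' RNm in auto)
  then have \<mu>: "\<mu> = density m (\<lambda>x. ennreal (\<rho> x))"
    using m.density_RN_deriv[OF ac sets] by simp
  let ?f = "\<lambda>x. \<rho> x * ln (\<rho> x)"
  have fm: "?f \<in> borel_measurable m" using \<rho>m' by simp
  have E: "Ent m \<mu> = enn2ereal (\<integral>\<^sup>+x. ennreal (?f x) \<partial>m) - enn2ereal (\<integral>\<^sup>+x. ennreal (- ?f x) \<partial>m)"
    using ac by (simp add: Ent_def ext_integral_def \<rho>_def)
  have "(\<integral>\<^sup>+x. ennreal (- ?f x) \<partial>m) \<le> (\<integral>\<^sup>+x. 1 \<partial>m)"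
    using minus_mult_ln_le_1 by (intro nn_integral_mono) (auto simp: \<rho>_def ennreal_le_1)
  also have "\<dots> = 1" by (simp add: m.emeasure_space_1)
  finally have neg: "(\<integral>\<^sup>+x. ennreal (- ?f x) \<partial>m) \<le> 1" .
  then obtain b where b: "(\<integral>\<^sup>+x. ennreal (- ?f x) \<partial>m) = ennreal b" "0 \<le> b"
    by (cases "\<integral>\<^sup>+x. ennreal (- ?f x) \<partial>m") (auto simp: top_unique)
  show ?thesis
  proof (cases "\<integral>\<^sup>+x. ennreal (?f x) \<partial>m")
    case top
    then have "Ent m \<mu> = \<infinity>" unfolding E b by (simp add: b(2))
    then show ?thesis by (rule that(1))
  next
    case (real a)
    then have int: "integrable m ?f" using b fm by (auto simp: real_integrable_def)
    have "Ent m \<mu> = ereal (\<integral>x. ?f x \<partial>m)"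
      unfolding E real_lebesgue_integral_def[OF int] using real b by simp
    moreover have "0 \<le> \<rho> x" for x by (simp add: \<rho>_def)
    ultimately show ?thesis by (intro that(2)[OF \<rho>m _ \<mu> int])
  qed
qed

lemma Ent_ne_MInf:
  assumes "prob_space m" "sets m = sets borel" "real_distribution \<mu>"
  shows "Ent m \<mu> \<noteq> -\<infinity>"
proof (rule Ent_cases[OF assms])
  fix \<rho> assume "Ent m \<mu> = ereal (\<integral>x. \<rho> x * ln (\<rho> x) \<partial>m)"
  then show ?thesis by (simp only: ereal_infty_less MInfty_neq_ereal not_False_eq_True)
qed simp

text \<open>The monotone coupling, realised as the joint law of both quantile functions at one
  uniform variable, is a competitor in the infimum.\<close>

lemma W2_sq_le_lquantile:
  assumes rd: "real_distribution \<mu>" "real_distribution \<nu>"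
    and int: "integrable (restrict_space lborel {0<..<1}) (\<lambda>u. (lquantile \<mu> u - lquantile \<nu> u)\<^sup>2)"
  shows "W2_sq \<mu> \<nu> \<le> ennreal (integral {0..1} (\<lambda>u. (lquantile \<mu> u - lquantile \<nu> u)\<^sup>2))"
proof -
  let ?U = "restrict_space lborel {0<..<1::real}"
  note T = lquantile_measurable[OF rd(1)] and S = lquantile_measurable[OF rd(2)]
  define \<pi> where "\<pi> = distr ?U (borel \<Otimes>\<^sub>M borel) (\<lambda>u. (lquantile \<mu> u, lquantile \<nu> u))"
  have pm: "(\<lambda>u. (lquantile \<mu> u, lquantile \<nu> u)) \<in> measurable ?U (borel \<Otimes>\<^sub>M borel)"
    by (rule measurable_Pair[OF T S])
  have "distr \<pi> borel fst = distr ?U borel (lquantile \<mu>)"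
    unfolding \<pi>_def by (subst distr_distr[OF measurable_fst pm]) (simp add: comp_def)
  moreover have "distr \<pi> borel snd = distr ?U borel (lquantile \<nu>)"
    unfolding \<pi>_def by (subst distr_distr[OF measurable_snd pm]) (simp add: comp_def)
  ultimately have "\<pi> \<in> couplings \<mu> \<nu>"
    using distr_lquantile[OF rd(1)] distr_lquantile[OF rd(2)] by (simp add: couplings_def \<pi>_def)
  then have "W2_sq \<mu> \<nu> \<le> (\<integral>\<^sup>+p. ennreal ((fst p - snd p)\<^sup>2) \<partial>\<pi>)"
    unfolding W2_sq_def by (rule INF_lower)
  also have "\<dots> = (\<integral>\<^sup>+u. ennreal ((lquantile \<mu> u - lquantile \<nu> u)\<^sup>2) \<partial>?U)"
    unfolding \<pi>_def by (subst nn_integral_distr[OF pm]) auto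
  also have "\<dots> = ennreal (\<integral>u. (lquantile \<mu> u - lquantile \<nu> u)\<^sup>2 \<partial>?U)"
    by (rule nn_integral_eq_integral[OF int]) simp
  also have "(\<integral>u. (lquantile \<mu> u - lquantile \<nu> u)\<^sup>2 \<partial>?U) = integral {0..1} (\<lambda>u. (lquantile \<mu> u - lquantile \<nu> u)\<^sup>2)"
    by (rule integral_unique[OF has_integral_unit_intervalI[OF int], symmetric])
  finally show ?thesis .
qed

text \<open>A finite second moment bounds the entropy from below, by comparison with a Gaussian density.\<close>

lemma integrable_ln_minus_part:
  fixes q :: "real \<Rightarrow> real"
  assumes rd: "real_distribution \<mu>" and qm [measurable]: "q \<in> borel_measurable borel"
    and q0: "\<And>x. 0 \<le> q x" and \<mu>: "\<mu> = density lborel (\<lambda>x. ennreal (q x))"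
    and int2: "integrable \<mu> (\<lambda>x. x\<^sup>2)"
  shows "integrable \<mu> (\<lambda>x. max 0 (- ln (q x)))"
proof -
  interpret real_distribution \<mu> by fact
  define C where "C = ln (sqrt (2 * pi))"
  have C: "0 \<le> C"
  proof -
    have "1 \<le> 2 * pi" using pi_ge_two by linarith
    then show ?thesis by (simp add: C_def)
  qed
  have lng: "ln (std_normal_density x) = - x\<^sup>2 / 2 - C" for x
    by (simp add: std_normal_density_def ln_mult ln_div C_def)
  have "integrable \<mu> (\<lambda>x. x\<^sup>2 / 2 + C)"
    by (intro Bochner_Integration.integrable_add integrable_divide int2 integrable_const)
  then have i1: "integrable lborel (\<lambda>x. q x * (x\<^sup>2 / 2 + C))"
    unfolding \<mu> by (subst (asm) integrable_density) (auto simp: q0)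
  have i2: "integrable lborel std_normal_density"
    by (rule integrable_normal_density) simp
  have "integrable lborel (\<lambda>x. q x * max 0 (- ln (q x)))"
  proof (rule Bochner_Integration.integrable_bound[OF Bochner_Integration.integrable_add[OF i2 i1]])
    show "AE x in lborel. norm (q x * max 0 (- ln (q x))) \<le> norm (std_normal_density x + q x * (x\<^sup>2 / 2 + C))"
    proof (rule AE_I2)
      fix x
      have rhs: "0 \<le> q x * (x\<^sup>2 / 2 + C)" "0 < std_normal_density x"
        using q0[of x] C by (auto intro!: mult_nonneg_nonneg normal_density_pos)
      have "q x * max 0 (- ln (q x)) \<le> std_normal_density x + q x * (x\<^sup>2 / 2 + C)"
      proof (cases "q x = 0 \<or> 0 \<le> ln (q x)")
        case True
        then show ?thesis using rhs by auto
      next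
        case False
        then have qx: "0 < q x" using q0[of x] by (simp add: order_less_le)
        \<comment> \<open>The tangent bound at \<open>1 / q\<close>, compared with the Gaussian
          density. After multiplication by \<open>q\<close> the right side is integrable: the
          Gaussian has mass 1, and its logarithm is quadratic, hence \<mu>-integrable.\<close>
        have "q x * - ln (q x) \<le> q x * (1 / q x * std_normal_density x - 1 - ln (std_normal_density x))"
          using mult_ln_bound[of "1 / q x" "std_normal_density x"] qx rhs
          by (intro mult_left_mono) (auto simp: ln_div)
        also have "\<dots> = std_normal_density x - q x + q x * (x\<^sup>2 / 2 + C)"
          unfolding lng using qx by (simp add: field_simps)
        finally show ?thesis using False qx by simp
      qed
      then show "norm (q x * max 0 (- ln (q x))) \<le> norm (std_normal_density x + q x * (x\<^sup>2 / 2 + C))"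
        using rhs q0[of x] by simp
    qed
  qed simp
  then show ?thesis unfolding \<mu> by (subst integrable_density) (auto simp: q0)
qed

text \<open>Splits the relative entropy into \<open>\<integral> ln q d\<mu>\<close> and the
  potential energy. The danger is a difference of two infinities. It is excluded since
  \<open>V = ln \<rho> - ln q\<close> holds almost everywhere: \<open>V\<close> is bounded below by
  \<open>V \<xi>\<close>, and above by \<open>\<bar>ln \<rho>\<bar>\<close> plus the negative part
  of \<open>ln q\<close>, which the second moment makes integrable.\<close>

lemma (in strongly_convex_potential) finite_Ent_obtains:
  assumes rd: "real_distribution \<mu>" and int2: "integrable \<mu> (\<lambda>x. x\<^sup>2)" and fin: "Ent m \<mu> \<noteq> \<infinity>"
  obtains q where "q \<in> borel_measurable borel" "\<And>x. 0 \<le> q x" "\<mu> = density lborel (\<lambda>x. ennreal (q x))"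
    "integrable \<mu> (\<lambda>x. ln (q x))" "integrable \<mu> V"
    "Ent m \<mu> = ereal ((\<integral>x. ln (q x) \<partial>\<mu>) + (\<integral>x. V x \<partial>\<mu>))"
proof -
  interpret real_distribution \<mu> by fact
  show thesis
  proof (rule Ent_cases[OF prob _ rd])
    show "sets m = sets borel" by simp
    show thesis if "Ent m \<mu> = \<infinity>" using fin that by simp
  next
    fix \<rho> assume \<rho>m[measurable]: "\<rho> \<in> borel_measurable borel" and \<rho>0: "\<And>x. 0 \<le> \<rho> x"
      and \<mu>: "\<mu> = density m (\<lambda>x. ennreal (\<rho> x))"
      and \<rho>int: "integrable m (\<lambda>x. \<rho> x * ln (\<rho> x))" and E: "Ent m \<mu> = ereal (\<integral>x. \<rho> x * ln (\<rho> x) \<partial>m)"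
    define q where "q = (\<lambda>x. exp (- V x) * \<rho> x)"
    have qm [measurable]: "q \<in> borel_measurable borel" by (simp add: q_def)
    have q0: "0 \<le> q x" for x using \<rho>0 by (simp add: q_def)
    have \<mu>q: "\<mu> = density lborel (\<lambda>x. ennreal (q x))"
    proof -
      have "\<mu> = density lborel (\<lambda>x. ennreal (exp (- V x)) * ennreal (\<rho> x))"
        unfolding \<mu> exp_measure_def by (rule density_density_eq) auto
      then show ?thesis by (simp add: q_def ennreal_mult \<rho>0)
    qed
    have Lint: "integrable \<mu> (\<lambda>x. ln (\<rho> x))" and Leq: "(\<integral>x. ln (\<rho> x) \<partial>\<mu>) = (\<integral>x. \<rho> x * ln (\<rho> x) \<partial>m)"
    proof -
      have ln_m: "(\<lambda>x. ln (\<rho> x)) \<in> borel_measurable m" "\<rho> \<in> borel_measurable m" by simp_all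
      show "integrable \<mu> (\<lambda>x. ln (\<rho> x))"
        using \<rho>int unfolding \<mu> by (subst integrable_density[OF ln_m]) (auto simp: \<rho>0)
      show "(\<integral>x. ln (\<rho> x) \<partial>\<mu>) = (\<integral>x. \<rho> x * ln (\<rho> x) \<partial>m)"
        unfolding \<mu> by (subst integral_density[OF ln_m]) (auto simp: \<rho>0)
    qed
    have "AE x in \<mu>. 0 < q x"
      unfolding \<mu>q by (subst AE_density) (auto simp: q0)
    then have sum: "AE x in \<mu>. ln (\<rho> x) = ln (q x) + V x"
    proof eventually_elim
      case (elim x)
      then have "0 < \<rho> x" by (simp add: q_def zero_less_mult_iff)
      then show ?case by (simp add: q_def ln_mult)
    qed
    have N: "integrable \<mu> (\<lambda>x. max 0 (- ln (q x)))"
      by (rule integrable_ln_minus_part[OF rd qm q0 \<mu>q int2])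
    have Vint: "integrable \<mu> V"
    proof (rule Bochner_Integration.integrable_bound)
      show "integrable \<mu> (\<lambda>x. \<bar>V \<xi>\<bar> + \<bar>ln (\<rho> x)\<bar> + max 0 (- ln (q x)))"
        by (intro Bochner_Integration.integrable_add integrable_abs Lint N integrable_const)
      show "AE x in \<mu>. norm (V x) \<le> norm (\<bar>V \<xi>\<bar> + \<bar>ln (\<rho> x)\<bar> + max 0 (- ln (q x)))"
        using sum
      proof eventually_elim
        case (elim x)
        have "0 \<le> \<kappa> / 2 * (x - \<xi>)\<^sup>2" using \<kappa> by simp
        then have "V \<xi> \<le> V x" using V_lower_\<xi>[of x] by linarith
        then show ?case using elim unfolding real_norm_def by linarith
      qed
    qed simp
    have lnq: "integrable \<mu> (\<lambda>x. ln (q x))"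
    proof (rule integrable_cong_AE_imp[OF Bochner_Integration.integrable_diff[OF Lint Vint]])
      show "AE x in \<mu>. ln (\<rho> x) - V x = ln (q x)" using sum by eventually_elim simp
    qed simp
    have "(\<integral>x. ln (\<rho> x) \<partial>\<mu>) = (\<integral>x. ln (q x) + V x \<partial>\<mu>)"
      using sum by (intro integral_cong_AE) auto
    also have "\<dots> = (\<integral>x. ln (q x) \<partial>\<mu>) + (\<integral>x. V x \<partial>\<mu>)"
      by (rule Bochner_Integration.integral_add[OF lnq Vint])
    finally have "Ent m \<mu> = ereal ((\<integral>x. ln (q x) \<partial>\<mu>) + (\<integral>x. V x \<partial>\<mu>))"
      by (simp only: E Leq[symmetric])
    then show thesis by (rule that[OF qm q0 \<mu>q lnq Vint])
  qed
qed

lemma P2_D: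
  assumes "\<mu> \<in> P2"
  shows "real_distribution \<mu>" "integrable \<mu> (\<lambda>x. x\<^sup>2)" "integrable \<mu> (\<lambda>x. x)"
proof -
  show rd: "real_distribution \<mu>" and i2: "integrable \<mu> (\<lambda>x. x\<^sup>2)" using assms by (auto simp: P2_def)
  interpret real_distribution \<mu> by fact
  show "integrable \<mu> (\<lambda>x. x)" by (rule square_integrable_imp_integrable[OF _ i2]) simp
qed

lemma has_integral_const_unit_interval: "((\<lambda>u::real. c::real) has_integral c) {0..1}"
  using has_integral_const_real[of c 0 1] by simp

lemma integrable_lquantile_square_diff:
  assumes \<mu>: "real_distribution \<mu>" "integrable \<mu> (\<lambda>x. x\<^sup>2)" and \<nu>: "real_distribution \<nu>" "integrable \<nu> (\<lambda>x. x\<^sup>2)"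
  shows "integrable (restrict_space lborel {0<..<1}) (\<lambda>u. (lquantile \<mu> u - lquantile \<nu> u)\<^sup>2)"
proof -
  let ?U = "restrict_space lborel {0<..<1::real}"
  note [measurable] = lquantile_measurable[OF \<mu>(1)] lquantile_measurable[OF \<nu>(1)]
  have 1: "integrable ?U (\<lambda>u. (lquantile \<mu> u)\<^sup>2)"
    by (rule iffD2[OF integrable_lquantile_iff[OF \<mu>(1)] \<mu>(2)]) measurable
  have 2: "integrable ?U (\<lambda>u. (lquantile \<nu> u)\<^sup>2)"
    by (rule iffD2[OF integrable_lquantile_iff[OF \<nu>(1)] \<nu>(2)]) measurable
  show ?thesis
  proof (rule Bochner_Integration.integrable_bound[OF integrable_mult_right[OF Bochner_Integration.integrable_add[OF 1 2], of 2]])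
    show "(\<lambda>u. (lquantile \<mu> u - lquantile \<nu> u)\<^sup>2) \<in> borel_measurable ?U" by measurable
    show "AE u in ?U. norm ((lquantile \<mu> u - lquantile \<nu> u)\<^sup>2) \<le> norm (2 * ((lquantile \<mu> u)\<^sup>2 + (lquantile \<nu> u)\<^sup>2))"
    proof (rule AE_I2)
      fix u
      have "0 \<le> (lquantile \<mu> u + lquantile \<nu> u)\<^sup>2" by simp
      then have "(lquantile \<mu> u - lquantile \<nu> u)\<^sup>2 \<le> 2 * ((lquantile \<mu> u)\<^sup>2 + (lquantile \<nu> u)\<^sup>2)"
        by (simp add: power2_eq_square algebra_simps)
      then show "norm ((lquantile \<mu> u - lquantile \<nu> u)\<^sup>2) \<le> norm (2 * ((lquantile \<mu> u)\<^sup>2 + (lquantile \<nu> u)\<^sup>2))"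
        by simp
    qed
  qed
qed

text \<open>Reduces both bounds to finite entropies. As \<open>Ent\<close> is never
  \<open>-\<infinity>\<close>, one infinite entropy makes the right side infinite. Otherwise the
  cost \<open>W\<close> of the monotone coupling replaces the infimum.\<close>

lemma W2_sq_entropy_ereal:
  fixes \<mu> \<nu> :: "real measure"
  defines "W \<equiv> integral {0..1} (\<lambda>u. (lquantile \<mu> u - lquantile \<nu> u)\<^sup>2)"
  assumes m: "prob_space m" "sets m = sets borel" and P2: "\<mu> \<in> P2" "\<nu> \<in> P2" and c: "0 < c"
    and fin: "\<And>e\<^sub>1 e\<^sub>2. Ent m \<mu> = ereal e\<^sub>1 \<Longrightarrow> Ent m \<nu> = ereal e\<^sub>2 \<Longrightarrow> W / 2 \<le> c * (e\<^sub>1 + e\<^sub>2) + \<phi>"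
  shows "ereal (1 / 2) * enn2ereal (W2_sq \<mu> \<nu>) \<le> ereal c * (Ent m \<mu> + Ent m \<nu>) + ereal \<phi>"
proof -
  note \<mu> = P2_D[OF P2(1)] and \<nu> = P2_D[OF P2(2)]
  note ne = Ent_ne_MInf[OF m \<mu>(1)] Ent_ne_MInf[OF m \<nu>(1)]
  show ?thesis
  proof (cases "Ent m \<mu> = \<infinity> \<or> Ent m \<nu> = \<infinity>")
    case True
    then have "Ent m \<mu> + Ent m \<nu> = \<infinity>" using ne by auto
    then have "ereal c * (Ent m \<mu> + Ent m \<nu>) + ereal \<phi> = \<infinity>" using c by (simp only:) simp
    then show ?thesis by (simp only:) simp
  next
    case False
    then obtain e1 e2 where e: "Ent m \<mu> = ereal e1" "Ent m \<nu> = ereal e2"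
      using ne by (cases "Ent m \<mu>"; cases "Ent m \<nu>") auto
    note int = integrable_lquantile_square_diff[OF \<mu>(1,2) \<nu>(1,2)]
    have "0 \<le> W" unfolding W_def
      by (rule integral_nonneg[OF has_integral_integrable[OF has_integral_unit_intervalI[OF int]]]) simp
    moreover have "W2_sq \<mu> \<nu> \<le> ennreal W"
      unfolding W_def by (rule W2_sq_le_lquantile[OF \<mu>(1) \<nu>(1) int])
    ultimately have "enn2ereal (W2_sq \<mu> \<nu>) \<le> ereal W"
      by (metis enn2ereal_ennreal less_eq_ennreal.rep_eq)
    then have "ereal (1 / 2) * enn2ereal (W2_sq \<mu> \<nu>) \<le> ereal (1 / 2) * ereal W"
      by (intro ereal_mult_left_mono) auto
    also have "\<dots> \<le> ereal (c * (e1 + e2) + \<phi>)" using fin[OF e] by simp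
    finally show ?thesis by (simp add: e)
  qed
qed

section \<open>The bound with \<open>Phi\<close> for finite entropies\<close>

text \<open>Put \<open>y = \<bar>x - \<xi>\<bar>\<close> and
  \<open>h = \<bar>t - a\<bar> + \<bar>s - b\<bar>\<close>. The arithmetic-geometric mean inequality
  gives \<open>2 r \<le> h\<close>, convexity gives \<open>\<kappa> y \<le> \<bar>v\<bar>\<close>,
  and together \<open>\<kappa> (y (h - 2 r) - (y - r)^2) \<le> \<bar>v\<bar> (h - 2 r)\<close>,
  which is the fact \<open>key\<close>. Hypothesis \<open>A\<close> is the strengthened tangent
  inequality for \<open>V\<close> at \<open>x\<close>, summed over \<open>t\<close> and
  \<open>s\<close>.\<close>

lemma convex_transport_pointwise:
  fixes a b c x t s r v A \<kappa> \<xi> :: real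
  assumes \<kappa>: "0 < \<kappa>" and r: "r = sqrt ((t - a) * (s - b))"
    and sgn: "0 \<le> x - \<xi> \<and> \<kappa> * (x - \<xi>) \<le> v \<and> a \<le> t \<and> b \<le> s \<or>
      x - \<xi> \<le> 0 \<and> v \<le> \<kappa> * (x - \<xi>) \<and> t \<le> a \<and> s \<le> b"
    and A: "v * (t - x) + \<kappa> / 2 * (t - x)\<^sup>2 + (v * (s - x) + \<kappa> / 2 * (s - x)\<^sup>2) \<le> A"
  shows "\<kappa> * ((t - s)\<^sup>2 / 2 + b * t + a * s - \<xi> * t - \<xi> * s - (a + b - 2 * \<xi>) * x + ((a + b) * \<xi> - \<xi>\<^sup>2 - a * b))
    \<le> A - 2 * (r * \<bar>v\<bar>) + 2 * ((x - \<xi>) * v) + (2 * \<xi> - a - b) * v"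
proof -
  define y where "y = \<bar>x - \<xi>\<bar>"
  have ts: "0 \<le> (t - a) * (s - b)" using sgn by (auto intro: mult_nonpos_nonpos)
  have r0: "0 \<le> r" and r2: "r\<^sup>2 = (t - a) * (s - b)" using ts by (simp_all add: r)
  have v: "\<kappa> * y \<le> \<bar>v\<bar>"
  proof (cases "0 \<le> x - \<xi> \<and> \<kappa> * (x - \<xi>) \<le> v")
    case False
    then have "v \<le> \<kappa> * (x - \<xi>)" "x - \<xi> \<le> 0" using sgn by auto
    then show ?thesis by (auto simp: y_def abs_if algebra_simps)
  qed (auto simp: y_def abs_if)
  have y2: "y\<^sup>2 = (x - \<xi>)\<^sup>2" by (simp add: y_def)
  define h where "h = \<bar>t - a\<bar> + \<bar>s - b\<bar>"
  have h0: "0 \<le> h - 2 * r"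
  proof -
    have "r \<le> (\<bar>t - a\<bar> + \<bar>s - b\<bar>) / 2"
      unfolding r using arith_geo_mean_sqrt[of "\<bar>t - a\<bar>" "\<bar>s - b\<bar>"] ts by (simp flip: abs_mult)
    then show ?thesis by (simp add: h_def)
  qed
  have vh: "v * ((t - a) + (s - b)) = \<bar>v\<bar> * h" and yh: "(x - \<xi>) * ((t - a) + (s - b)) = y * h"
  proof -
    have "0 \<le> v \<and> 0 \<le> x - \<xi> \<and> a \<le> t \<and> b \<le> s \<or> v \<le> 0 \<and> x - \<xi> \<le> 0 \<and> t \<le> a \<and> s \<le> b"
      using sgn \<kappa> by (smt (verit) mult_nonneg_nonneg mult_nonneg_nonpos)
    then show "v * ((t - a) + (s - b)) = \<bar>v\<bar> * h" "(x - \<xi>) * ((t - a) + (s - b)) = y * h"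
      by (elim disjE; simp add: h_def y_def abs_of_nonpos algebra_simps)+
  qed
  have "\<kappa> * (y * (h - 2 * r)) \<le> \<bar>v\<bar> * (h - 2 * r)"
    using mult_right_mono[OF v h0] by (simp add: mult.assoc)
  moreover have "\<kappa> * 0 \<le> \<kappa> * (y - r)\<^sup>2" using \<kappa> by (intro mult_left_mono) auto
  moreover have "(x - \<xi>) * ((t - a) + (s - b)) - (x - \<xi>)\<^sup>2 - (t - a) * (s - b) = y * (h - 2 * r) - (y - r)\<^sup>2"
    unfolding yh using y2 r2 by (simp add: power2_diff algebra_simps)
  moreover have "\<bar>v\<bar> * (h - 2 * r) = v * ((t - a) + (s - b)) - 2 * (r * \<bar>v\<bar>)"
    unfolding vh by (simp add: algebra_simps)
  moreover have "\<kappa> * (y * (h - 2 * r) - (y - r)\<^sup>2) = \<kappa> * (y * (h - 2 * r)) - \<kappa> * (y - r)\<^sup>2"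
    by (rule right_diff_distrib)
  ultimately have key: "\<kappa> * ((x - \<xi>) * ((t - a) + (s - b)) - (x - \<xi>)\<^sup>2 - (t - a) * (s - b))
      \<le> v * ((t - a) + (s - b)) - 2 * (r * \<bar>v\<bar>)"
    by (simp only:)
  \<comment> \<open>Polarisation: \<open>(t - x)^2 / 2 + (s - x)^2 / 2 = (t - s)^2 / 2 + (t - x) (s
    - x)\<close>. The products \<open>t s\<close>, \<open>x t\<close>, \<open>x s\<close> and
    \<open>x^2\<close> then cancel. Apart from \<open>(t - s)^2\<close> only linear terms remain,
    and these integrate to means.\<close>
  have "\<kappa> * ((t - s)\<^sup>2 / 2 + b * t + a * s - \<xi> * t - \<xi> * s - (a + b - 2 * \<xi>) * x + ((a + b) * \<xi> - \<xi>\<^sup>2 - a * b))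
     = \<kappa> * ((x - \<xi>) * ((t - a) + (s - b)) - (x - \<xi>)\<^sup>2 - (t - a) * (s - b)) + (\<kappa> / 2 * (t - x)\<^sup>2 + \<kappa> / 2 * (s - x)\<^sup>2)"
    by (simp add: power2_eq_square field_simps)
  also have "\<dots> \<le> v * ((t - a) + (s - b)) - 2 * (r * \<bar>v\<bar>) + (A - v * (t - x) - v * (s - x))"
    using key A by linarith
  also have "\<dots> = A - 2 * (r * \<bar>v\<bar>) + 2 * ((x - \<xi>) * v) + (2 * \<xi> - a - b) * v"
    by (simp add: algebra_simps)
  finally show ?thesis .
qed

text \<open>The pointwise bound at \<open>t = T u\<close>, \<open>s = S u\<close>,
  \<open>x = X u\<close>, integrated over \<open>u\<close>, plus the entropy bound with profile
  \<open>exp (- V (X))\<close>. The bracket is half the transport cost minus \<open>Phi\<close>,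
  written with \<open>a\<close> and \<open>b\<close> for the two values of
  \<open>alpha\<close>.\<close>

lemma (in strongly_convex_potential) finite_transport_entropy_bound:
  fixes \<mu> \<nu> :: "real measure"
  defines "a \<equiv> quantile \<mu> (cdf m \<xi>)" and "b \<equiv> quantile \<nu> (cdf m \<xi>)"
  assumes P2: "\<mu> \<in> P2" "\<nu> \<in> P2" and e: "Ent m \<mu> = ereal e\<^sub>1" "Ent m \<nu> = ereal e\<^sub>2"
  shows "\<kappa> * (integral {0..1} (\<lambda>u. (lquantile \<mu> u - lquantile \<nu> u)\<^sup>2) / 2 + b * bar \<mu> + a * bar \<nu>
      - \<xi> * bar \<mu> - \<xi> * bar \<nu> - (a + b - 2 * \<xi>) * bar m + ((a + b) * \<xi> - \<xi>\<^sup>2 - a * b)) \<le> e\<^sub>1 + e\<^sub>2"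
proof -
  let ?U = "restrict_space lborel {0<..<1::real}"
  define T where "T = lquantile \<mu>"
  define S where "S = lquantile \<nu>"
  define p where "p = cdf m \<xi>"
  have p: "0 < p" "p < 1" unfolding p_def by (rule cdf_m_bounds)+
  note \<mu> = P2_D[OF P2(1)] and \<nu> = P2_D[OF P2(2)]
  obtain q1 where q1: "q1 \<in> borel_measurable borel" "\<And>x. 0 \<le> q1 x" "\<mu> = density lborel (\<lambda>x. ennreal (q1 x))"
    "integrable \<mu> (\<lambda>x. ln (q1 x))" "integrable \<mu> V" and E1: "Ent m \<mu> = ereal ((\<integral>x. ln (q1 x) \<partial>\<mu>) + (\<integral>x. V x \<partial>\<mu>))"
    by (rule finite_Ent_obtains[OF \<mu>(1,2)]) (simp add: e, blast)
  obtain q2 where q2: "q2 \<in> borel_measurable borel" "\<And>x. 0 \<le> q2 x" "\<nu> = density lborel (\<lambda>x. ennreal (q2 x))"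
    "integrable \<nu> (\<lambda>x. ln (q2 x))" "integrable \<nu> V" and E2: "Ent m \<nu> = ereal ((\<integral>x. ln (q2 x) \<partial>\<nu>) + (\<integral>x. V x \<partial>\<nu>))"
    by (rule finite_Ent_obtains[OF \<nu>(1,2)]) (simp add: e, blast)
  define v where "v = (\<lambda>u. V' (X u))"
  define r where "r = (\<lambda>u. sqrt ((T u - a) * (S u - b)))"
  define A where "A = (\<lambda>u. V (T u) + V (S u) - 2 * V (X u))"
  have sgn: "0 \<le> X u - \<xi> \<and> \<kappa> * (X u - \<xi>) \<le> v u \<and> a \<le> T u \<and> b \<le> S u \<or>
      X u - \<xi> \<le> 0 \<and> v u \<le> \<kappa> * (X u - \<xi>) \<and> T u \<le> a \<and> S u \<le> b" if u: "0 < u" "u < 1" for u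
  proof (cases "u \<le> p")
    case True
    then have "X u \<le> \<xi>" using X_vs_\<xi>(1) u by (simp add: p_def)
    moreover from this have "v u \<le> \<kappa> * (X u - \<xi>)"
      using V'_mono[of "X u" \<xi>] by (simp add: v_def V'_\<xi> algebra_simps)
    ultimately show ?thesis
      using lquantile_le_quantile_le(1)[OF \<mu>(1) p u(1) True] lquantile_le_quantile_le(1)[OF \<nu>(1) p u(1) True]
      by (simp add: T_def S_def a_def b_def p_def)
  next
    case False
    then have up: "p < u" by simp
    then have "\<xi> \<le> X u" using X_vs_\<xi>(2)[of u] u by (simp add: p_def)
    moreover from this have "\<kappa> * (X u - \<xi>) \<le> v u"
      using V'_mono[of \<xi> "X u"] by (simp add: v_def V'_\<xi>)
    ultimately show ?thesis
      using lquantile_le_quantile_le(2)[OF \<mu>(1) p up u(2)] lquantile_le_quantile_le(2)[OF \<nu>(1) p up u(2)]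
      by (simp add: T_def S_def a_def b_def p_def)
  qed
  have Alow: "v u * (T u - X u) + \<kappa> / 2 * (T u - X u)\<^sup>2 + (v u * (S u - X u) + \<kappa> / 2 * (S u - X u)\<^sup>2) \<le> A u" for u
    using V_lower[of "X u" "T u"] V_lower[of "X u" "S u"] by (simp add: A_def v_def)
  have iX: "integrable ?U (\<lambda>u. f (X u))" if "f \<in> borel_measurable borel" "integrable m f" for f :: "real \<Rightarrow> real"
    using integrable_lquantile_iff[OF m_real_distribution that(1)] that(2) by (simp only:)
  have iA: "integrable ?U A"
    unfolding A_def T_def S_def
    by (intro Bochner_Integration.integrable_diff Bochner_Integration.integrable_add integrable_mult_right
        iffD2[OF integrable_lquantile_iff[OF \<mu>(1) V_measurable] q1(5)]
        iffD2[OF integrable_lquantile_iff[OF \<nu>(1) V_measurable] q2(5)] iX V_measurable integrable_potential)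
  have iv: "integrable ?U v"
    unfolding v_def by (rule iX[OF V'_measurable deriv_mean_zero(1)])
  have ixv: "integrable ?U (\<lambda>u. (X u - \<xi>) * v u)"
    unfolding v_def by (rule iX[OF _ deriv_moment(1)]) measurable
  have im: "integrable m (\<lambda>x. x)"
  proof -
    have "integrable m (\<lambda>x. x - \<xi>)"
      by (rule m.square_integrable_imp_integrable[OF _ integrable_power2_m]) measurable
    from Bochner_Integration.integrable_add[OF this m.integrable_const[of \<xi>]] show ?thesis by simp
  qed
  \<comment> \<open>Square integrability of \<open>V'\<close> under \<open>m\<close> is not at hand,
    so Cauchy-Schwarz cannot give integrability of \<open>r * \<bar>v\<bar>\<close>. The dominating
    function comes from convexity instead: it contains \<open>V (T u) + V (S u)\<close>, which is
    integrable because the entropies are finite.\<close>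
  have rv_le: "2 * (r u * \<bar>v u\<bar>) \<le> A u + 2 * ((X u - \<xi>) * v u) + (2 * \<xi> - a - b) * v u"
    and rv0: "0 \<le> r u * \<bar>v u\<bar>" if u: "0 < u" "u < 1" for u
  proof -
    have ts: "0 \<le> (T u - a) * (S u - b)" using sgn[OF u] by (auto intro: mult_nonpos_nonpos)
    then show "0 \<le> r u * \<bar>v u\<bar>" by (simp add: r_def)
    have "2 * r u \<le> \<bar>T u - a\<bar> + \<bar>S u - b\<bar>"
      using arith_geo_mean_sqrt[of "\<bar>T u - a\<bar>" "\<bar>S u - b\<bar>"] ts by (simp add: r_def flip: abs_mult)
    then have "2 * r u * \<bar>v u\<bar> \<le> (\<bar>T u - a\<bar> + \<bar>S u - b\<bar>) * \<bar>v u\<bar>" by (rule mult_right_mono) simp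
    also have "\<dots> = v u * ((T u - a) + (S u - b))"
    proof -
      have "0 \<le> v u \<and> a \<le> T u \<and> b \<le> S u \<or> v u \<le> 0 \<and> T u \<le> a \<and> S u \<le> b"
        using sgn[OF u] \<kappa> by (smt (verit) mult_nonneg_nonneg mult_nonneg_nonpos)
      then show ?thesis by (elim disjE; simp add: abs_of_nonpos algebra_simps)
    qed
    also have "\<dots> = (v u * (T u - X u) + v u * (S u - X u)) + 2 * ((X u - \<xi>) * v u) + (2 * \<xi> - a - b) * v u"
      by (simp add: algebra_simps)
    also have "v u * (T u - X u) + v u * (S u - X u) \<le> A u"
    proof -
      have "0 \<le> \<kappa> / 2 * (T u - X u)\<^sup>2" "0 \<le> \<kappa> / 2 * (S u - X u)\<^sup>2" using \<kappa> by simp_all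
      then show ?thesis using Alow[of u] by linarith
    qed
    finally show "2 * (r u * \<bar>v u\<bar>) \<le> A u + 2 * ((X u - \<xi>) * v u) + (2 * \<xi> - a - b) * v u"
      by (simp add: mult.assoc)
  qed
  have irv: "integrable ?U (\<lambda>u. r u * \<bar>v u\<bar>)"
  proof (rule Bochner_Integration.integrable_bound)
    show "integrable ?U (\<lambda>u. A u + 2 * ((X u - \<xi>) * v u) + (2 * \<xi> - a - b) * v u)"
      by (intro Bochner_Integration.integrable_add integrable_mult_right iA ixv iv)
    have "r \<in> borel_measurable ?U"
      using integrable_sqrt_lquantile_product[OF \<mu>(1) \<nu>(1) \<mu>(3) \<nu>(3), of a b] unfolding r_def T_def S_def
      by (rule borel_measurable_integrable)
    then show "(\<lambda>u. r u * \<bar>v u\<bar>) \<in> borel_measurable ?U"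
      using borel_measurable_integrable[OF iv] by (intro borel_measurable_times borel_measurable_abs)
    show "AE u in ?U. norm (r u * \<bar>v u\<bar>) \<le> norm (A u + 2 * ((X u - \<xi>) * v u) + (2 * \<xi> - a - b) * v u)"
    proof (rule AE_I2)
      fix u assume "u \<in> space ?U"
      then have "0 < u" "u < 1" by (auto simp: space_restrict_space)
      from rv_le[OF this] rv0[OF this] show
        "norm (r u * \<bar>v u\<bar>) \<le> norm (A u + 2 * ((X u - \<xi>) * v u) + (2 * \<xi> - a - b) * v u)"
        unfolding real_norm_def by linarith
    qed
  qed
  define J where "J = (\<integral>u. r u * \<bar>v u\<bar> \<partial>?U)"
  have HJ: "((\<lambda>u. r u * \<bar>v u\<bar>) has_integral J) {0..1}"
    unfolding J_def by (rule has_integral_unit_intervalI[OF irv])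
  have HVX: "((\<lambda>u. V (X u)) has_integral (\<integral>x. V x \<partial>m)) {0..1}"
    by (rule has_integral_lquantile[OF m_real_distribution V_measurable integrable_potential])
  have Hw: "((\<lambda>u. r u * \<bar>v u\<bar> - 1 - ln (exp (- V (X u)))) has_integral J - 1 - - (\<integral>x. V x \<partial>m)) {0..1}"
    unfolding ln_exp by (intro has_integral_diff has_integral_neg HJ HVX has_integral_const_unit_interval)
  have ent: "- (\<integral>x. ln (q1 x) \<partial>\<mu>) - (\<integral>x. ln (q2 x) \<partial>\<nu>)
      \<le> 2 * integral {0..1} (\<lambda>u. sqrt ((lquantile \<mu> u - a) * (lquantile \<nu> u - b)) * \<bar>v u\<bar> - 1 - ln (exp (- V (X u))))"
  proof (rule entropy_sum_bound[OF \<mu>(1) \<nu>(1) \<mu>(3) \<nu>(3) q1(1) q2(1) q1(2) q2(2) q1(3) q2(3) q1(4) q2(4) p])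
    fix u assume u: "0 < u" "u < p"
    then have "u \<le> p" "u < 1" using p by auto
    then show "lquantile \<mu> u \<le> a \<and> lquantile \<nu> u \<le> b"
      using lquantile_le_quantile_le(1)[OF \<mu>(1) p u(1)] lquantile_le_quantile_le(1)[OF \<nu>(1) p u(1)]
      by (simp add: a_def b_def p_def)
    show "v u \<le> 0" unfolding v_def
      using X_vs_\<xi>(1)[of u] u by (intro V'_sign(2)) (simp add: p_def)
  next
    fix u assume u: "p < u" "u < 1"
    then show "a \<le> lquantile \<mu> u \<and> b \<le> lquantile \<nu> u"
      using lquantile_le_quantile_le(2)[OF \<mu>(1) p u] lquantile_le_quantile_le(2)[OF \<nu>(1) p u]
      by (simp add: a_def b_def p_def)
    show "0 \<le> v u" unfolding v_def
      using X_vs_\<xi>(2)[of u] u by (intro V'_sign(1)) (simp add: p_def)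
  next
    show "(\<lambda>u. sqrt ((lquantile \<mu> u - a) * (lquantile \<nu> u - b)) * \<bar>v u\<bar>) integrable_on {0..1}"
      using has_integral_integrable[OF HJ] by (simp only: r_def T_def S_def)
    show "(\<lambda>u. ln (exp (- V (X u)))) integrable_on {0..1}"
      unfolding ln_exp by (rule has_integral_integrable[OF has_integral_neg[OF HVX]])
  next
    fix u :: real assume u: "0 < u" "u < 1"
    show "0 < exp (- V (X u))" by simp
    show "((\<lambda>u. exp (- V (X u))) has_real_derivative - v u) (at u)"
      unfolding v_def by (rule exp_V_X_deriv[OF u])
    show "isCont v u" unfolding v_def by (rule V'_X_cont[OF u])
  next
    fix c d :: real assume "0 < c" "c \<le> d" "d < 1"
    then show "v c \<le> v d" unfolding v_def by (rule V'_X_mono)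
  qed (rule exp_V_X_limits)+
  then have ent': "- (\<integral>x. ln (q1 x) \<partial>\<mu>) - (\<integral>x. ln (q2 x) \<partial>\<nu>) \<le> 2 * (J - 1 - - (\<integral>x. V x \<partial>m))"
    using integral_unique[OF Hw] by (simp only: r_def T_def S_def)
  define W where "W = integral {0..1} (\<lambda>u. (T u - S u)\<^sup>2)"
  have HT: "(T has_integral bar \<mu>) {0..1}"
    using has_integral_lquantile[OF \<mu>(1) measurable_ident_sets[OF refl] \<mu>(3)] by (simp add: T_def bar_def)
  have HS: "(S has_integral bar \<nu>) {0..1}"
    using has_integral_lquantile[OF \<nu>(1) measurable_ident_sets[OF refl] \<nu>(3)] by (simp add: S_def bar_def)
  have HX: "(X has_integral bar m) {0..1}"
    using has_integral_lquantile[OF m_real_distribution measurable_ident_sets[OF refl] im] by (simp add: bar_def)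
  have HW: "((\<lambda>u. (T u - S u)\<^sup>2) has_integral W) {0..1}"
    unfolding W_def T_def S_def
    by (rule integrable_integral[OF has_integral_integrable[OF has_integral_unit_intervalI[OF
        integrable_lquantile_square_diff[OF \<mu>(1,2) \<nu>(1,2)]]]])
  have Hxv: "((\<lambda>u. (X u - \<xi>) * v u) has_integral 1) {0..1}"
    using has_integral_lquantile[OF m_real_distribution _ deriv_moment(1)] by (simp add: deriv_moment(2) v_def)
  have Hv: "(v has_integral 0) {0..1}"
    using has_integral_lquantile[OF m_real_distribution _ deriv_mean_zero(1)] by (simp add: deriv_mean_zero(2) v_def)
  have HVT: "((\<lambda>u. V (T u)) has_integral (\<integral>x. V x \<partial>\<mu>)) {0..1}"
    unfolding T_def by (rule has_integral_lquantile[OF \<mu>(1) V_measurable q1(5)])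
  have HVS: "((\<lambda>u. V (S u)) has_integral (\<integral>x. V x \<partial>\<nu>)) {0..1}"
    unfolding S_def by (rule has_integral_lquantile[OF \<nu>(1) V_measurable q2(5)])
  let ?l = "\<lambda>u. \<kappa> * ((T u - S u)\<^sup>2 / 2 + b * T u + a * S u - \<xi> * T u - \<xi> * S u - (a + b - 2 * \<xi>) * X u
      + ((a + b) * \<xi> - \<xi>\<^sup>2 - a * b))"
  let ?r = "\<lambda>u. A u - 2 * (r u * \<bar>v u\<bar>) + 2 * ((X u - \<xi>) * v u) + (2 * \<xi> - a - b) * v u"
  have L: "(?l has_integral \<kappa> * (W / 2 + b * bar \<mu> + a * bar \<nu> - \<xi> * bar \<mu> - \<xi> * bar \<nu>
      - (a + b - 2 * \<xi>) * bar m + ((a + b) * \<xi> - \<xi>\<^sup>2 - a * b))) {0..1}"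
    by (intro has_integral_mult_right has_integral_add has_integral_diff has_integral_divide HW HT HS HX
        has_integral_const_unit_interval)
  have R: "(?r has_integral (\<integral>x. V x \<partial>\<mu>) + (\<integral>x. V x \<partial>\<nu>) - 2 * (\<integral>x. V x \<partial>m) - 2 * J + 2 * 1 + (2 * \<xi> - a - b) * 0) {0..1}"
    unfolding A_def
    by (intro has_integral_mult_right has_integral_add has_integral_diff HVT HVS HVX HJ Hxv Hv)
  have "\<kappa> * (W / 2 + b * bar \<mu> + a * bar \<nu> - \<xi> * bar \<mu> - \<xi> * bar \<nu>
      - (a + b - 2 * \<xi>) * bar m + ((a + b) * \<xi> - \<xi>\<^sup>2 - a * b))
    \<le> (\<integral>x. V x \<partial>\<mu>) + (\<integral>x. V x \<partial>\<nu>) - 2 * (\<integral>x. V x \<partial>m) - 2 * J + 2 * 1 + (2 * \<xi> - a - b) * 0"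
  proof (rule has_integral_le)
    show "(?l has_integral \<kappa> * (W / 2 + b * bar \<mu> + a * bar \<nu> - \<xi> * bar \<mu> - \<xi> * bar \<nu>
      - (a + b - 2 * \<xi>) * bar m + ((a + b) * \<xi> - \<xi>\<^sup>2 - a * b))) {0<..<1}"
      using L by (simp only: has_integral_Icc_iff_Ioo)
    show "(?r has_integral (\<integral>x. V x \<partial>\<mu>) + (\<integral>x. V x \<partial>\<nu>) - 2 * (\<integral>x. V x \<partial>m) - 2 * J + 2 * 1 + (2 * \<xi> - a - b) * 0) {0<..<1}"
      using R by (simp only: has_integral_Icc_iff_Ioo)
    fix u :: real assume "u \<in> {0<..<1}"
    then have u: "0 < u" "u < 1" by auto
    show "?l u \<le> ?r u"
      by (rule convex_transport_pointwise[OF \<kappa> _ sgn[OF u] Alow]) (simp add: r_def)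
  qed
  \<comment> \<open>The terms \<open>2 * J\<close> and twice the mean of \<open>V\<close> under
    \<open>m\<close> occur with opposite signs in the two inequalities, and the constant 2 from
    \<open>Hxv\<close> meets the \<open>- 2\<close> of the entropy bound.\<close>
  then show ?thesis using ent' E1 E2 e unfolding W_def T_def S_def by simp
qed

section \<open>Identification of the mode, and the general theorem\<close>

text \<open>The set where the functions differ is open; if it were nonempty it would contain a ball
  of positive measure.\<close>

lemma continuous_AE_eq_imp_eq:
  fixes f g :: "real \<Rightarrow> real"
  assumes cont: "continuous_on UNIV f" "continuous_on UNIV g" and ae: "AE x in lborel. f x = g x"
  shows "f = g"
proof (rule ext, rule ccontr)
  fix x assume "f x \<noteq> g x"
  have op: "open {x. f x \<noteq> g x}" by (rule open_Collect_neq[OF cont])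
  then obtain e where e: "0 < e" "ball x e \<subseteq> {x. f x \<noteq> g x}"
    using \<open>f x \<noteq> g x\<close> by (auto simp: open_contains_ball)
  from op have "{x. f x \<noteq> g x} \<in> sets lborel" by simp
  moreover have "AE x in lborel. x \<notin> {x. f x \<noteq> g x}" using ae by eventually_elim simp
  ultimately have "{x. f x \<noteq> g x} \<in> null_sets lborel"
    using AE_iff_null_sets by blast
  then have "ball x e \<in> null_sets lborel" by (rule null_sets_subset) (use e in auto)
  then have "emeasure lborel (ball x e) = 0" by (rule null_setsD1)
  moreover have "emeasure lborel (ball x e) = ennreal (2 * e)"
    using e by (simp add: ball_eq_greaterThanLessThan emeasure_lborel_Ioo)
  ultimately show False using e by (simp add: ennreal_eq_0_iff)
qed

context strongly_convex_potential
begin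

text \<open>Any continuous density of \<open>m\<close> must be \<open>exp (- V)\<close> itself, so a
  maximum point minimises \<open>V\<close>; the quadratic growth of \<open>V\<close> around \<xi>
  makes this point unique.\<close>

lemma mode_point_m: "mode_point m = \<xi>"
  unfolding mode_point_def
proof (rule the_equality)
  have ce: "continuous_on UNIV (\<lambda>x. exp (- V x))"
    by (intro continuous_at_imp_continuous_on ballI continuous_intros V_cont)
  have min: "V \<xi> \<le> V y" for y
  proof -
    have "0 \<le> \<kappa> / 2 * (y - \<xi>)\<^sup>2" using \<kappa> by simp
    then show ?thesis using V_lower_\<xi>[of y] by linarith
  qed
  show "\<exists>f. continuous_on UNIV f \<and> (\<forall>x. 0 \<le> f x) \<and> m = density lborel (\<lambda>x. ennreal (f x)) \<and> (\<forall>y. f y \<le> f \<xi>)"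
    by (rule exI[of _ "\<lambda>x. exp (- V x)"]) (use ce min in \<open>simp add: exp_measure_def\<close>)
  fix \<zeta> assume "\<exists>f. continuous_on UNIV f \<and> (\<forall>x. 0 \<le> f x) \<and> m = density lborel (\<lambda>x. ennreal (f x)) \<and> (\<forall>y. f y \<le> f \<zeta>)"
  then obtain f where f: "continuous_on UNIV f" "\<And>x. 0 \<le> f x" "m = density lborel (\<lambda>x. ennreal (f x))"
    "\<And>y. f y \<le> f \<zeta>" by blast
  have fm: "f \<in> borel_measurable borel" by (rule borel_measurable_continuous_onI[OF f(1)])
  have "density lborel (\<lambda>x. ennreal (f x)) = density lborel (\<lambda>x. ennreal (exp (- V x)))"
    by (rule f(3)[symmetric, unfolded exp_measure_def])
  then have "AE x in lborel. ennreal (f x) = ennreal (exp (- V x))"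
    by (rule iffD1[OF sigma_finite_measure.density_unique_iff[OF lborel.sigma_finite_measure_axioms], rotated 2])
      (use fm in simp_all)
  then have "AE x in lborel. f x = exp (- V x)"
  proof eventually_elim
    case (elim x)
    then show ?case using f(2)[of x] by (subst (asm) ennreal_inj) auto
  qed
  then have "f = (\<lambda>x. exp (- V x))" by (rule continuous_AE_eq_imp_eq[OF f(1) ce])
  then have "V \<zeta> \<le> V \<xi>" using f(4)[of \<xi>] by simp
  then have "\<kappa> / 2 * (\<zeta> - \<xi>)\<^sup>2 \<le> 0" using V_lower_\<xi>[of \<zeta>] by linarith
  then have "(\<zeta> - \<xi>)\<^sup>2 \<le> 0" using \<kappa> by (simp add: mult_le_0_iff)
  then show "\<zeta> = \<xi>" by simp
qed

lemma alpha_m: "alpha m \<mu> = quantile \<mu> (cdf m \<xi>)"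
  by (simp add: alpha_def transport_map_def mode_point_m)

theorem transport_entropy_bound:
  assumes P2: "\<mu> \<in> P2" "\<nu> \<in> P2"
  shows "ereal (1 / 2) * enn2ereal (W2_sq \<mu> \<nu>) \<le> ereal (1 / \<kappa>) * (Ent m \<mu> + Ent m \<nu>) + ereal (Phi m \<mu> \<nu>)"
proof (rule W2_sq_entropy_ereal[OF prob _ P2])
  show "sets m = sets borel" by simp
  show "0 < 1 / \<kappa>" using \<kappa> by simp
  fix e1 e2 assume e: "Ent m \<mu> = ereal e1" "Ent m \<nu> = ereal e2"
  define W where "W = integral {0..1} (\<lambda>u. (lquantile \<mu> u - lquantile \<nu> u)\<^sup>2)"
  define a where "a = alpha m \<mu>"
  define b where "b = alpha m \<nu>"
  have "\<kappa> * (W / 2 + b * bar \<mu> + a * bar \<nu> - \<xi> * bar \<mu> - \<xi> * bar \<nu> - (a + b - 2 * \<xi>) * bar m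
      + ((a + b) * \<xi> - \<xi>\<^sup>2 - a * b)) \<le> e1 + e2"
    using finite_transport_entropy_bound[OF P2 e] by (simp only: W_def a_def b_def alpha_m)
  then have "W / 2 + b * bar \<mu> + a * bar \<nu> - \<xi> * bar \<mu> - \<xi> * bar \<nu> - (a + b - 2 * \<xi>) * bar m
      + ((a + b) * \<xi> - \<xi>\<^sup>2 - a * b) \<le> 1 / \<kappa> * (e1 + e2)"
    using \<kappa> by (simp add: pos_le_divide_eq mult.commute)
  \<comment> \<open>With \<open>d = bar m - (bar \<mu> + bar \<nu>) / 2\<close> the two squares in
    \<open>Phi\<close> are \<open>(\<xi> - d)^2\<close> and \<open>d^2\<close>, so their difference
    is \<open>\<xi>^2 - 2 \<xi> d\<close>, which is linear in the means.\<close>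
  moreover have "Phi m \<mu> \<nu> = - (b * bar \<mu> + a * bar \<nu> - \<xi> * bar \<mu> - \<xi> * bar \<nu> - (a + b - 2 * \<xi>) * bar m
      + ((a + b) * \<xi> - \<xi>\<^sup>2 - a * b))"
    unfolding Phi_def mode_point_m a_def[symmetric] b_def[symmetric] by (simp add: power2_eq_square field_simps)
  ultimately show "integral {0..1} (\<lambda>u. (lquantile \<mu> u - lquantile \<nu> u)\<^sup>2) / 2 \<le> 1 / \<kappa> * (e1 + e2) + Phi m \<mu> \<nu>"
    unfolding W_def by linarith
qed

end

lemma strongly_convex_potential_of_smooth:
  assumes \<kappa>: "0 < \<kappa>" and V: "smooth_real V" "kappa_convex \<kappa> V" and prob: "prob_space (exp_measure V)"
  obtains \<xi> where "strongly_convex_potential V (deriv V) \<kappa> \<xi>"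
proof -
  have d: "(V has_real_derivative deriv V x) (at x)" "(deriv V has_real_derivative deriv (deriv V) x) (at x)" for x
    using V(1)[unfolded smooth_real_def, rule_format, of 0 x] V(1)[unfolded smooth_real_def, rule_format, of 1 x]
    by (auto dest: field_differentiable_derivI)
  have mono: "\<kappa> * (y - x) \<le> deriv V y - deriv V x" if "x \<le> y" for x y
  proof -
    have "deriv V x - \<kappa> * x \<le> deriv V y - \<kappa> * y"
    proof (rule DERIV_nonneg_imp_nondecreasing[OF that])
      fix t
      have "((\<lambda>t. deriv V t - \<kappa> * t) has_real_derivative deriv (deriv V) t - \<kappa>) (at t)"
        by (auto intro!: derivative_eq_intros d)
      moreover have "0 \<le> deriv (deriv V) t - \<kappa>" using V(2) by (simp add: kappa_convex_def)
      ultimately show "\<exists>z. ((\<lambda>t. deriv V t - \<kappa> * t) has_real_derivative z) (at t) \<and> 0 \<le> z" by blast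
    qed
    then show ?thesis by (simp add: algebra_simps)
  qed
  have cont: "isCont (deriv V) x" for x by (rule DERIV_isCont[OF d(2)])
  \<comment> \<open>Strong monotonicity changes \<open>V'\<close> by at least
    \<open>\<kappa> * R = \<bar>V' 0\<bar>\<close> over the distance \<open>R\<close>. Hence
    \<open>V'\<close> has a zero between \<open>- R\<close> and \<open>R\<close>.\<close>
  define R where "R = \<bar>deriv V 0\<bar> / \<kappa>"
  have R: "0 \<le> R" "\<kappa> * R = \<bar>deriv V 0\<bar>" using \<kappa> by (simp_all add: R_def)
  have "deriv V (- R) \<le> 0" "0 \<le> deriv V R"
    using mono[of "- R" 0] mono[of 0 R] R by auto
  moreover have "continuous_on {- R..R} (deriv V)"
    by (intro continuous_at_imp_continuous_on ballI cont)
  moreover have "- R \<le> R" using R(1) by simp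
  ultimately have "\<exists>\<xi>\<ge>- R. \<xi> \<le> R \<and> deriv V \<xi> = 0" by (intro IVT')
  then obtain \<xi> where \<xi>: "deriv V \<xi> = 0" by blast
  have "strongly_convex_potential V (deriv V) \<kappa> \<xi>"
    by (rule strongly_convex_potential.intro[OF \<kappa> d(1) mono cont \<xi> prob])
  then show thesis by (rule that)
qed

subsection \<open>The Gaussian reference measure\<close>

definition gauss_potential :: "real \<Rightarrow> real" where
  "gauss_potential x = x\<^sup>2 / 2 + ln (sqrt (2 * pi))"

lemma exp_measure_gauss_potential: "exp_measure gauss_potential = gamma1"
proof -
  have "exp (- gauss_potential x) = std_normal_density x" for x
  proof -
    have "exp (- gauss_potential x) = exp (- (x\<^sup>2 / 2) - ln (sqrt (2 * pi)))"
      by (simp add: gauss_potential_def)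
    also have "\<dots> = exp (- (x\<^sup>2 / 2)) / exp (ln (sqrt (2 * pi)))" by (rule exp_diff)
    also have "exp (ln (sqrt (2 * pi))) = sqrt (2 * pi)" by (rule exp_ln) simp
    finally show ?thesis by (simp add: std_normal_density_def)
  qed
  then show ?thesis by (simp add: exp_measure_def gamma1_def)
qed

interpretation gauss: strongly_convex_potential gauss_potential "\<lambda>x. x" 1 0
proof (rule strongly_convex_potential.intro)
  show "(gauss_potential has_real_derivative x) (at x)" for x
    unfolding gauss_potential_def by (auto intro!: derivative_eq_intros)
  show "prob_space (exp_measure gauss_potential)"
    unfolding exp_measure_gauss_potential gamma1_def by (rule prob_space_normal_density) simp
qed auto

lemma integral_gauss_uminus:
  fixes f :: "real \<Rightarrow> real"
  assumes f: "f \<in> borel_measurable borel"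
  shows "(\<integral>x. f (- x) \<partial>gauss.m) = (\<integral>x. f x \<partial>gauss.m)"
proof -
  have f': "(\<lambda>x. f (- x)) \<in> borel_measurable borel"
    by (rule measurable_compose[OF borel_measurable_uminus[OF measurable_ident_sets[OF refl]] f])
  have "(\<integral>x. exp (- gauss_potential x) * f x \<partial>lborel)
      = \<bar>- 1\<bar> *\<^sub>R (\<integral>x. exp (- gauss_potential (0 + - 1 * x)) * f (0 + - 1 * x) \<partial>lborel)"
    by (rule lborel_integral_real_affine) simp
  also have "\<dots> = (\<integral>x. exp (- gauss_potential x) * f (- x) \<partial>lborel)"
    by (simp add: gauss_potential_def)
  finally show ?thesis
    by (simp only: gauss.integral_m[OF f] gauss.integral_m[OF f'])
qed

lemma gauss_second_moment: "integrable gauss.m (\<lambda>x. x\<^sup>2)" "(\<integral>x. x\<^sup>2 \<partial>gauss.m) = 1"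
proof -
  have "(\<lambda>x::real. (x - 0) * x) = (\<lambda>x. x\<^sup>2)" by (simp add: power2_eq_square)
  then show "integrable gauss.m (\<lambda>x. x\<^sup>2)" "(\<integral>x. x\<^sup>2 \<partial>gauss.m) = 1"
    using gauss.deriv_moment by (metis, metis)
qed

lemma bar_gauss: "bar gauss.m = 0"
  unfolding bar_def by (rule gauss.deriv_mean_zero(2))

lemma cdf_gauss_0: "cdf gauss.m 0 = 1 / 2"
proof -
  have "(\<lambda>x::real. indicator {..0} (- x)) = (indicator {0..} :: real \<Rightarrow> real)"
    by (auto simp: indicator_def)
  then have "measure gauss.m {..0} = measure gauss.m {0..}"
    using integral_gauss_uminus[of "indicator {..0}"] by simp
  moreover have "measure gauss.m {0..} = measure gauss.m {0<..} + measure gauss.m {0}"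
  proof -
    have "{0::real..} = {0<..} \<union> {0}" by auto
    then show ?thesis by (simp only:) (rule gauss.m.finite_measure_Union, auto)
  qed
  moreover have "measure gauss.m {0<..} = 1 - measure gauss.m {..0}"
    using gauss.m.prob_compl[of "{..0}"] by (simp add: Compl_eq_Diff_UNIV[symmetric] Compl_atMost)
  ultimately show ?thesis using gauss.m_atom[of 0] by (simp add: cdf_def)
qed

text \<open>The two halves are weighted \<open>2 p\<close> and \<open>2 (1 - p)\<close> in the split
  reference measure. As they contribute equally, its second moment is 1 for every
  \<open>p\<close>.\<close>

lemma gauss_half_second_moment:
  "((\<lambda>u. (gauss.X u)\<^sup>2) has_integral 1 / 2) {0..1 / 2}" "((\<lambda>u. (gauss.X u)\<^sup>2) has_integral 1 / 2) {1 / 2..1}"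
proof -
  define f where "f = (\<lambda>x::real. x\<^sup>2 * indicator {..0} x)"
  define f' where "f' = (\<lambda>x::real. x\<^sup>2 * indicator {0..} x)"
  have fm: "f \<in> borel_measurable borel" "f' \<in> borel_measurable borel" by (simp_all add: f_def f'_def)
  have fi: "integrable gauss.m f" "integrable gauss.m f'"
    unfolding f_def f'_def by (auto intro!: integrable_real_mult_indicator gauss_second_moment(1))
  have "(\<integral>x. f x \<partial>gauss.m) = (\<integral>x. f' x \<partial>gauss.m)"
  proof -
    have "(\<lambda>x. f (- x)) = f'" by (auto simp: f_def f'_def indicator_def)
    then show ?thesis using integral_gauss_uminus[OF fm(1)] by simp
  qed
  moreover have "(\<integral>x. f x \<partial>gauss.m) + (\<integral>x. f' x \<partial>gauss.m) = 1"
  proof -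
    have "(\<lambda>x. f x + f' x) = (\<lambda>x. x\<^sup>2)" by (auto simp: f_def f'_def indicator_def)
    then show ?thesis using Bochner_Integration.integral_add[OF fi] gauss_second_moment(2) by simp
  qed
  ultimately have I: "(\<integral>x. f x \<partial>gauss.m) = 1 / 2" "(\<integral>x. f' x \<partial>gauss.m) = 1 / 2" by simp_all
  have 1: "((\<lambda>u. f (gauss.X u)) has_integral 1 / 2) {0..1}"
    using has_integral_lquantile[OF gauss.m_real_distribution fm(1) fi(1)] unfolding I .
  have 2: "((\<lambda>u. f' (gauss.X u)) has_integral 1 / 2) {0..1}"
    using has_integral_lquantile[OF gauss.m_real_distribution fm(2) fi(2)] unfolding I .
  have s: "gauss.X u \<le> 0 \<longleftrightarrow> u \<le> 1 / 2" if "0 < u" "u < 1" for u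
    using gauss.X_le_iff[OF that, of 0] by (simp add: cdf_gauss_0)
  have s': "0 \<le> gauss.X u \<longleftrightarrow> 1 / 2 \<le> u" if "0 < u" "u < 1" for u
  proof
    assume "0 \<le> gauss.X u"
    then have "cdf gauss.m 0 \<le> cdf gauss.m (gauss.X u)" by (rule gauss.m.cdf_nondecreasing)
    then show "1 / 2 \<le> u" using gauss.cdf_X[OF that] by (simp add: cdf_gauss_0)
  next
    assume "1 / 2 \<le> u"
    then show "0 \<le> gauss.X u" using gauss.X_vs_\<xi>(2)[of u] that by (simp add: cdf_gauss_0)
  qed
  have "((\<lambda>u. if u \<in> {0..1 / 2} then (gauss.X u)\<^sup>2 else 0) has_integral 1 / 2) {0..1}"
    by (rule has_integral_spike_finite[OF _ _ 1, of "{0, 1}"]) (auto simp: f_def indicator_def s)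
  then show "((\<lambda>u. (gauss.X u)\<^sup>2) has_integral 1 / 2) {0..1 / 2}"
    by (rule iffD1[OF has_integral_restrict, rotated]) auto
  have "((\<lambda>u. if u \<in> {1 / 2..1} then (gauss.X u)\<^sup>2 else 0) has_integral 1 / 2) {0..1}"
    by (rule has_integral_spike_finite[OF _ _ 2, of "{0, 1}"]) (auto simp: f'_def indicator_def s')
  then show "((\<lambda>u. (gauss.X u)\<^sup>2) has_integral 1 / 2) {1 / 2..1}"
    by (rule iffD1[OF has_integral_restrict, rotated]) auto
qed

lemma Phi_gauss_eq:
  "Phi_gauss \<mu> \<nu> = - alpha gamma1 \<nu> * bar \<mu> - alpha gamma1 \<mu> * bar \<nu> + alpha gamma1 \<mu> * alpha gamma1 \<nu>"
proof -
  have "mode_point gamma1 = 0" "bar gamma1 = 0"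
    using gauss.mode_point_m bar_gauss by (simp_all only: exp_measure_gauss_potential)
  then show ?thesis by (simp add: Phi_gauss_def Phi_def)
qed

section \<open>The split Gaussian reference measure\<close>

text \<open>Composed with the Gaussian quantile function this is the quantile function of the
  measure with density \<open>2 p\<close> times the Gaussian left of 0 and \<open>2 (1 - p)\<close>
  times it right of 0. Both pieces take the value 1/2 at \<open>p\<close>, so only the slope can
  jump there.\<close>

definition split_map :: "real \<Rightarrow> real \<Rightarrow> real" where
  "split_map p u = (if u < p then u / (2 * p) else 1 / 2 + (u - p) / (2 * (1 - p)))"

lemma split_map_bounds:
  assumes "0 < p" "p < 1"
  shows "0 < u \<Longrightarrow> u < 1 \<Longrightarrow> 0 < split_map p u" and "0 < u \<Longrightarrow> u < 1 \<Longrightarrow> split_map p u < 1"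
    and "u < p \<Longrightarrow> split_map p u < 1 / 2" and "p \<le> u \<Longrightarrow> 1 / 2 \<le> split_map p u"
  using assms by (auto simp: split_map_def field_simps intro: add_pos_nonneg)

lemma split_map_mono:
  assumes "0 < p" "p < 1" "c \<le> d"
  shows "split_map p c \<le> split_map p d"
proof (cases "c < p \<longleftrightarrow> d < p")
  case True
  then show ?thesis using assms by (auto simp: split_map_def intro!: divide_right_mono)
next
  case False
  then have "c < p" "p \<le> d" using assms by auto
  then show ?thesis using split_map_bounds(3)[OF assms(1,2)] split_map_bounds(4)[OF assms(1,2)] by force
qed

lemma split_map_deriv:
  assumes "0 < p" "p < 1"
  shows "u < p \<Longrightarrow> (split_map p has_real_derivative 1 / (2 * p)) (at u)"
    and "p < u \<Longrightarrow> (split_map p has_real_derivative 1 / (2 * (1 - p))) (at u)"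
proof -
  assume "u < p"
  have "((\<lambda>u. u / (2 * p)) has_real_derivative 1 / (2 * p)) (at u)"
    by (rule DERIV_cdivide[OF DERIV_ident])
  then show "(split_map p has_real_derivative 1 / (2 * p)) (at u)"
    by (rule has_field_derivative_transform_within_open[where S = "{..<p}"])
      (use \<open>u < p\<close> in \<open>auto simp: split_map_def\<close>)
next
  assume "p < u"
  have "((\<lambda>u. 1 / 2 + (u - p) / (2 * (1 - p))) has_real_derivative 0 + (1 - 0) / (2 * (1 - p))) (at u)"
    by (intro DERIV_add DERIV_const DERIV_cdivide DERIV_diff DERIV_ident)
  then have "((\<lambda>u. 1 / 2 + (u - p) / (2 * (1 - p))) has_real_derivative 1 / (2 * (1 - p))) (at u)"
    by simp
  then show "(split_map p has_real_derivative 1 / (2 * (1 - p))) (at u)"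
    by (rule has_field_derivative_transform_within_open[where S = "{p<..}"])
      (use \<open>p < u\<close> in \<open>auto simp: split_map_def\<close>)
qed

lemma has_integral_piecewise:
  fixes f g :: "real \<Rightarrow> real"
  assumes p: "0 < p" "p < 1" and f: "(f has_integral I) {0..p}" and g: "(g has_integral J) {p..1}"
  shows "((\<lambda>u. if u < p then f u else g u) has_integral I + J) {0..1}"
proof (rule has_integral_combine)
  show "((\<lambda>u. if u < p then f u else g u) has_integral I) {0..p}"
    by (rule has_integral_spike_finite[OF _ _ f, of "{p}"]) auto
  show "((\<lambda>u. if u < p then f u else g u) has_integral J) {p..1}"
    by (rule has_integral_eq[OF _ g]) auto
qed (use p in auto)

lemma has_integral_split_map:
  fixes f :: "real \<Rightarrow> real"
  assumes p: "0 < p" "p < 1" and I: "(f has_integral I) {0..1 / 2}" and J: "(f has_integral J) {1 / 2..1}"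
  shows "((\<lambda>u. f (split_map p u)) has_integral 2 * p * I + 2 * (1 - p) * J) {0..1}"
proof -
  have "((\<lambda>u. f (1 / (2 * p) * u + 0)) has_integral 2 * p * I) {0..p}"
    using has_integral_affinity'[of f I 0 "1 / 2" "1 / (2 * p)" 0] I p
    by (simp add: field_simps)
  then have 1: "((\<lambda>u. f (u / (2 * p))) has_integral 2 * p * I) {0..p}" by simp
  define c where "c = 1 / 2 - p / (2 * (1 - p))"
  have J': "(f has_integral J) (cbox (1 / 2) 1)" using J by simp
  have "0 < 1 / (2 * (1 - p))" using p by simp
  note has_integral_affinity'[OF J' this, of c]
  moreover have "(1 / 2 - c) /\<^sub>R (1 / (2 * (1 - p))) = p" "(1 - c) /\<^sub>R (1 / (2 * (1 - p))) = 1"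
    "J /\<^sub>R (1 / (2 * (1 - p))) ^ DIM(real) = 2 * (1 - p) * J"
    using p by (simp_all add: c_def field_simps)
  moreover have "(\<lambda>u. f ((1 / (2 * (1 - p))) *\<^sub>R u + c)) = (\<lambda>u. f (1 / 2 + (u - p) / (2 * (1 - p))))"
    by (simp add: c_def diff_divide_distrib algebra_simps)
  ultimately have 2: "((\<lambda>u. f (1 / 2 + (u - p) / (2 * (1 - p)))) has_integral 2 * (1 - p) * J) {p..1}"
    by (simp only: cbox_interval)
  have "(\<lambda>u. f (split_map p u)) = (\<lambda>u. if u < p then f (u / (2 * p)) else f (1 / 2 + (u - p) / (2 * (1 - p))))"
    by (auto simp: split_map_def)
  then show ?thesis using has_integral_piecewise[OF p 1 2] by (simp only:)
qed

text \<open>If one side of the mean carried no mass, \<open>x - bar \<mu>\<close> would have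
  constant sign and integral 0, hence vanish almost everywhere, and \<mu> would be a point mass.
  This keeps the splitting level strictly between 0 and 1.\<close>

lemma cdf_bar_bounds:
  assumes rd: "real_distribution \<mu>" and int: "integrable \<mu> (\<lambda>x. x)" and atom: "\<And>x. measure \<mu> {x} = 0"
  shows "0 < cdf \<mu> (bar \<mu>)" "cdf \<mu> (bar \<mu>) < 1"
proof -
  interpret real_distribution \<mu> by fact
  define a where "a = bar \<mu>"
  have ia: "integrable \<mu> (\<lambda>x. x - a)"
    by (intro Bochner_Integration.integrable_diff int integrable_const)
  have I0: "(\<integral>x. x - a \<partial>\<mu>) = 0"
    using Bochner_Integration.integral_diff[OF int integrable_const[of a]] prob_space by (simp add: a_def bar_def)
  have no: False if "AE x in \<mu>. x - a = 0"
  proof -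
    have "AE x in \<mu>. x \<in> {a}" using that by eventually_elim simp
    then have "prob {a} = 1" by (intro prob_eq_1[THEN iffD2]) auto
    then show False using atom[of a] by simp
  qed
  show "0 < cdf \<mu> (bar \<mu>)"
  proof (rule ccontr)
    assume "\<not> 0 < cdf \<mu> (bar \<mu>)"
    then have "prob {..a} = 0" unfolding cdf_def a_def by (simp only: zero_less_measure_iff not_not)
    then have "AE x in \<mu>. x \<notin> {..a}" by (intro prob_eq_0[THEN iffD1]) auto
    then have "AE x in \<mu>. 0 \<le> x - a" by eventually_elim auto
    from integral_nonneg_eq_0_iff_AE[OF ia this] show False using I0 no by simp
  qed
  show "cdf \<mu> (bar \<mu>) < 1"
  proof (rule ccontr)
    assume "\<not> cdf \<mu> (bar \<mu>) < 1"
    then have "prob {..a} = 1" using prob_le_1[of "{..a}"] unfolding cdf_def a_def by linarith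
    then have "AE x in \<mu>. x \<in> {..a}" by (intro prob_eq_1[THEN iffD1]) auto
    then have ae: "AE x in \<mu>. 0 \<le> - (x - a)" by eventually_elim auto
    have "integrable \<mu> (\<lambda>x. - (x - a))" by (rule Bochner_Integration.integrable_minus[OF ia])
    from integral_nonneg_eq_0_iff_AE[OF this ae] have "AE x in \<mu>. - (x - a) = 0"
      using I0 unfolding Bochner_Integration.integral_minus by simp
    then have "AE x in \<mu>. x - a = 0" by eventually_elim simp
    then show False by (rule no)
  qed
qed

text \<open>The expression is the relative entropy of \<open>(p, 1 - p)\<close> with respect to
  \<open>(1/2, 1/2)\<close>.\<close>

lemma split_log_nonneg:
  assumes p: "0 < p" "p < (1::real)"
  shows "0 \<le> p * ln (2 * p) + (1 - p) * ln (2 * (1 - p))"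
proof -
  have le: "x - 1 / 2 \<le> x * ln (2 * x)" if "0 < x" for x :: real
  proof -
    have "x * ln (1 / (2 * x)) \<le> x * (1 / (2 * x) - 1)"
      using ln_le_minus_one[of "1 / (2 * x)"] that by (intro mult_left_mono) auto
    then show ?thesis using that by (simp add: ln_div algebra_simps)
  qed
  show ?thesis using le[of p] le[of "1 - p"] p by linarith
qed

text \<open>Here the reference measure has density \<open>2p\<gamma>\<close> to the left and \<open>2(1 - p)\<gamma>\<close> to the right of 0,
  so that 0 splits it in the same proportion \<open>p : 1 - p\<close> in which the mean of \<open>\<mu>\<close> splits \<open>\<mu>\<close>.\<close>

lemma finite_gauss_entropy_bar_bound:
  assumes P2: "\<mu> \<in> P2" "\<nu> \<in> P2" and e: "Ent gamma1 \<mu> = ereal e\<^sub>1" "Ent gamma1 \<nu> = ereal e\<^sub>2"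
  shows "integral {0..1} (\<lambda>u. (lquantile \<mu> u - lquantile \<nu> u)\<^sup>2) / 2 \<le> e\<^sub>1 + e\<^sub>2 - bar \<mu> * bar \<nu>"
proof -
  note e' = e[folded exp_measure_gauss_potential]
  have ne: "Ent gauss.m \<mu> \<noteq> \<infinity>" "Ent gauss.m \<nu> \<noteq> \<infinity>" unfolding e' by simp_all
  note \<mu> = P2_D[OF P2(1)] and \<nu> = P2_D[OF P2(2)]
  define C where "C = ln (sqrt (2 * pi))"
  have gp: "gauss_potential x = x\<^sup>2 / 2 + C" for x by (simp add: gauss_potential_def C_def)
  obtain q1 where q1: "q1 \<in> borel_measurable borel" "\<And>x. 0 \<le> q1 x" "\<mu> = density lborel (\<lambda>x. ennreal (q1 x))"
    "integrable \<mu> (\<lambda>x. ln (q1 x))" "integrable \<mu> gauss_potential"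
    and E1: "Ent gauss.m \<mu> = ereal ((\<integral>x. ln (q1 x) \<partial>\<mu>) + (\<integral>x. gauss_potential x \<partial>\<mu>))"
    by (fact gauss.finite_Ent_obtains[OF \<mu>(1,2) ne(1)])
  obtain q2 where q2: "q2 \<in> borel_measurable borel" "\<And>x. 0 \<le> q2 x" "\<nu> = density lborel (\<lambda>x. ennreal (q2 x))"
    "integrable \<nu> (\<lambda>x. ln (q2 x))" "integrable \<nu> gauss_potential"
    and E2: "Ent gauss.m \<nu> = ereal ((\<integral>x. ln (q2 x) \<partial>\<nu>) + (\<integral>x. gauss_potential x \<partial>\<nu>))"
    by (fact gauss.finite_Ent_obtains[OF \<nu>(1,2) ne(2)])
  define T where "T = lquantile \<mu>"
  define S where "S = lquantile \<nu>"
  \<comment> \<open>Taking the mean for \<open>a\<close> makes \<open>- b * a\<close> and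
    \<open>a * b\<close> in \<open>K\<close> below cancel. So the value of \<open>b\<close> does not
    matter in the end, and \<open>- a * bar \<nu>\<close> survives.\<close>
  define a where "a = bar \<mu>"
  define p where "p = cdf \<mu> a"
  define b where "b = quantile \<nu> p"
  have "(\<lambda>x. ennreal (q1 x)) \<in> borel_measurable lborel"
    by (rule measurable_compose[OF _ measurable_ennreal]) (simp add: q1(1))
  from measure_density_lborel_singleton[OF this] have atom: "measure \<mu> {x} = 0" for x
    unfolding q1(3)[symmetric] .
  have p: "0 < p" "p < 1" unfolding p_def a_def by (rule cdf_bar_bounds[OF \<mu>(1,3) atom])+
  define \<sigma> where "\<sigma> = split_map p"
  note \<sigma>_bounds = split_map_bounds[OF p, folded \<sigma>_def]
  define X where "X = gauss.X"
  define v where "v = (\<lambda>u. X (\<sigma> u))"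
  define c where "c = (\<lambda>u. if u < p then 2 * p else 2 * (1 - p))"
  \<comment> \<open>The density of the split reference measure at its quantile \<open>v\<close>. In
    \<open>w'\<close> the factor \<open>c\<close> of the density cancels the slope
    \<open>1 / c\<close> of \<sigma>, which leaves \<open>- v\<close> on both sides of
    \<open>p\<close>; \<open>w\<close> itself may jump at \<open>p\<close>.\<close>
  define w where "w = (\<lambda>u. c u * exp (- gauss_potential (X (\<sigma> u))))"
  define r where "r = (\<lambda>u. sqrt ((T u - a) * (S u - b)))"
  have c0: "0 < c u" for u using p by (simp add: c_def)
  have left: "T u \<le> a \<and> S u \<le> b" if "0 < u" "u \<le> p" for u
    using le_cdf_iff_lquantile_le[OF \<mu>(1), of u a] lquantile_le_quantile_le(1)[OF \<nu>(1) p that] that p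
    by (simp add: T_def S_def b_def p_def)
  have right: "a \<le> T u \<and> b \<le> S u" if "p < u" "u < 1" for u
    using le_cdf_iff_lquantile_le[OF \<mu>(1), of u a] lquantile_le_quantile_le(2)[OF \<nu>(1) p that] that p
    by (auto simp: T_def S_def b_def p_def)
  have ts: "0 \<le> (T u - a) * (S u - b)" if "0 < u" "u < 1" for u
    using left[of u] right[of u] that by (cases "u \<le> p") (auto intro: mult_nonpos_nonpos)
  have Hv2: "((\<lambda>u. (v u)\<^sup>2) has_integral 1) {0..1}"
  proof -
    have "2 * p * (1 / 2) + 2 * (1 - p) * (1 / 2) = 1" by (simp add: field_simps)
    then show ?thesis
      using has_integral_split_map[OF p gauss_half_second_moment] by (simp only: v_def X_def \<sigma>_def)
  qed
  have vint: "(\<lambda>u. \<bar>v u\<bar>) integrable_on {0..1}"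
  proof -
    have "((\<lambda>u. \<bar>X u\<bar>) has_integral (\<integral>x. \<bar>x\<bar> \<partial>gauss.m)) {0..1}"
      unfolding X_def
      by (rule has_integral_lquantile[OF gauss.m_real_distribution _ integrable_abs[OF gauss.deriv_mean_zero(1)]]) simp
    then have i: "(\<lambda>u. \<bar>X u\<bar>) integrable_on {0..1}" by (rule has_integral_integrable)
    have "(\<lambda>u. \<bar>X u\<bar>) integrable_on {0..1 / 2}" "(\<lambda>u. \<bar>X u\<bar>) integrable_on {1 / 2..1}"
      by (rule integrable_on_subinterval[OF i], simp)+
    from has_integral_split_map[OF p this[THEN integrable_integral]] show ?thesis
      unfolding v_def \<sigma>_def by (rule has_integral_integrable)
  qed
  have rint: "r integrable_on {0<..<1}"
    using has_integral_integrable[OF has_integral_unit_intervalI[OF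
      integrable_sqrt_lquantile_product[OF \<mu>(1) \<nu>(1) \<mu>(3) \<nu>(3), of a b]]]
    unfolding r_def T_def S_def integrable_on_open_interval_real .
  define W where "W = integral {0..1} (\<lambda>u. (T u - S u)\<^sup>2)"
  have HW: "((\<lambda>u. (T u - S u)\<^sup>2) has_integral W) {0..1}"
    unfolding W_def T_def S_def
    by (rule integrable_integral[OF has_integral_integrable[OF has_integral_unit_intervalI[OF
        integrable_lquantile_square_diff[OF \<mu>(1,2) \<nu>(1,2)]]]])
  have HT: "(T has_integral a) {0..1}"
    using has_integral_lquantile[OF \<mu>(1) measurable_ident_sets[OF refl] \<mu>(3)] by (simp add: T_def bar_def a_def)
  have HS: "(S has_integral bar \<nu>) {0..1}"
    using has_integral_lquantile[OF \<nu>(1) measurable_ident_sets[OF refl] \<nu>(3)] by (simp add: S_def bar_def)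
  have HT2: "((\<lambda>u. (T u)\<^sup>2) has_integral (\<integral>x. x\<^sup>2 \<partial>\<mu>)) {0..1}"
    unfolding T_def by (rule has_integral_lquantile[OF \<mu>(1) _ \<mu>(2)]) simp
  have HS2: "((\<lambda>u. (S u)\<^sup>2) has_integral (\<integral>x. x\<^sup>2 \<partial>\<nu>)) {0..1}"
    unfolding S_def by (rule has_integral_lquantile[OF \<nu>(1) _ \<nu>(2)]) simp
  \<comment> \<open>The integral of \<open>(T - a) (S - b)\<close>, with the product
    \<open>T S\<close> expressed by polarisation through both second moments and the transport cost
    \<open>W\<close>.\<close>
  define K where "K = (\<integral>x. x\<^sup>2 \<partial>\<mu>) / 2 + (\<integral>x. x\<^sup>2 \<partial>\<nu>) / 2 - W / 2 - b * a - a * bar \<nu> + a * b"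
  have Hts: "((\<lambda>u. (T u - a) * (S u - b)) has_integral K) {0..1}"
  proof -
    have "((\<lambda>u. (T u)\<^sup>2 / 2 + (S u)\<^sup>2 / 2 - (T u - S u)\<^sup>2 / 2 - b * T u - a * S u + a * b) has_integral K) {0..1}"
      unfolding K_def
      by (intro has_integral_add has_integral_diff has_integral_divide has_integral_mult_right HT HS HT2 HS2 HW
          has_integral_const_unit_interval)
    then show ?thesis by (rule has_integral_eq[rotated]) (simp add: power2_eq_square field_simps)
  qed
  \<comment> \<open>For the Gaussian, \<open>v\<close> is square integrable, so Young's inequality
    suffices; \<open>r^2\<close> integrates to \<open>K\<close> and \<open>v^2\<close> to 1.\<close>
  have rv_le: "r u * \<bar>v u\<bar> \<le> (T u - a) * (S u - b) / 2 + (v u)\<^sup>2 / 2" and rv0: "0 \<le> r u * \<bar>v u\<bar>"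
    if u: "0 < u" "u < 1" for u
  proof -
    have r2: "(r u)\<^sup>2 = (T u - a) * (S u - b)" and r0: "0 \<le> r u" using ts[OF u] by (simp_all add: r_def)
    then show "0 \<le> r u * \<bar>v u\<bar>" by simp
    have "0 \<le> (r u - \<bar>v u\<bar>)\<^sup>2" by simp
    then show "r u * \<bar>v u\<bar> \<le> (T u - a) * (S u - b) / 2 + (v u)\<^sup>2 / 2"
      unfolding r2[symmetric] by (simp add: power2_diff)
  qed
  have Hbd: "((\<lambda>u. (T u - a) * (S u - b) / 2 + (v u)\<^sup>2 / 2) has_integral K / 2 + 1 / 2) {0..1}"
    by (intro has_integral_add has_integral_divide Hts Hv2)
  \<comment> \<open>After the change of variable \<open>\<bar>v\<bar>\<close> is known to be
    integrable only in the Henstock-Kurzweil sense. Nonnegativity makes it, and likewise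
    \<open>r\<close>, absolutely integrable, which supplies the measurability that domination
    needs.\<close>
  have rvint: "(\<lambda>u. r u * \<bar>v u\<bar>) integrable_on {0..1}"
  proof -
    have "r absolutely_integrable_on {0<..<1}"
      by (rule nonnegative_absolutely_integrable_1[OF rint]) (use ts in \<open>auto simp: r_def\<close>)
    then have rm: "r \<in> borel_measurable (lebesgue_on {0<..<1})"
      by (rule absolutely_integrable_imp_borel_measurable) simp
    have "(\<lambda>u. \<bar>v u\<bar>) absolutely_integrable_on {0<..<1}"
      by (rule nonnegative_absolutely_integrable_1) (use vint in \<open>simp_all add: integrable_on_open_interval_real\<close>)
    then have vm: "(\<lambda>u. \<bar>v u\<bar>) \<in> borel_measurable (lebesgue_on {0<..<1})"
      by (rule absolutely_integrable_imp_borel_measurable) simp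
    have "(\<lambda>u. r u * \<bar>v u\<bar>) absolutely_integrable_on {0<..<1}"
    proof (rule measurable_bounded_by_integrable_imp_absolutely_integrable[OF borel_measurable_times[OF rm vm]])
      show "(\<lambda>u. (T u - a) * (S u - b) / 2 + (v u)\<^sup>2 / 2) integrable_on {0<..<1}"
        unfolding integrable_on_open_interval_real by (rule has_integral_integrable[OF Hbd])
      show "norm (r u * \<bar>v u\<bar>) \<le> (T u - a) * (S u - b) / 2 + (v u)\<^sup>2 / 2" if "u \<in> {0<..<1}" for u
        using rv_le[of u] rv0[of u] that by simp
    qed simp
    then show ?thesis
      unfolding integrable_on_open_interval_real[symmetric] by (rule set_lebesgue_integral_eq_integral(1))
  qed
  define L where "L = p * ln (2 * p) + (1 - p) * ln (2 * (1 - p))"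
  have lnw: "ln (w u) = ln (c u) - ((v u)\<^sup>2 / 2 + C)" for u
    using c0[of u] by (simp add: w_def v_def gp ln_mult)
  have Hlnc: "((\<lambda>u. ln (c u)) has_integral L) {0..1}"
  proof -
    have "((\<lambda>u. ln (2 * p)) has_integral p * ln (2 * p)) {0..p}"
      "((\<lambda>u. ln (2 * (1 - p))) has_integral (1 - p) * ln (2 * (1 - p))) {p..1}"
      using has_integral_const_real[of "ln (2 * p)" 0 p] has_integral_const_real[of "ln (2 * (1 - p))" p 1] p
      by simp_all
    from has_integral_piecewise[OF p this] have "((\<lambda>u. if u < p then ln (2 * p) else ln (2 * (1 - p))) has_integral L) {0..1}"
      unfolding L_def .
    moreover have "(\<lambda>u. ln (c u)) = (\<lambda>u. if u < p then ln (2 * p) else ln (2 * (1 - p)))"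
      by (auto simp: c_def)
    ultimately show ?thesis by (simp only:)
  qed
  have Hlnw: "((\<lambda>u. ln (w u)) has_integral L - (1 / 2 + C)) {0..1}"
    unfolding lnw
    by (intro has_integral_add has_integral_diff has_integral_divide Hlnc Hv2 has_integral_const_unit_interval)
  have \<sigma>_deriv: "\<exists>D. (\<sigma> has_real_derivative D) (at u)" if "u \<noteq> p" for u
    using split_map_deriv[OF p, of u] that unfolding \<sigma>_def by (cases "u < p") (simp, blast)+
  have \<sigma>_cont: "isCont \<sigma> u" if "u \<noteq> p" for u
    using \<sigma>_deriv[OF that] DERIV_isCont by blast
  have \<sigma>1: "\<sigma> 1 = 1" "\<sigma> 0 = 0" using p by (simp_all add: \<sigma>_def split_map_def field_simps)
  have ent: "- (\<integral>x. ln (q1 x) \<partial>\<mu>) - (\<integral>x. ln (q2 x) \<partial>\<nu>)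
      \<le> 2 * integral {0..1} (\<lambda>u. sqrt ((lquantile \<mu> u - a) * (lquantile \<nu> u - b)) * \<bar>v u\<bar> - 1 - ln (w u))"
  proof (rule entropy_sum_bound[OF \<mu>(1) \<nu>(1) \<mu>(3) \<nu>(3) q1(1) q2(1) q1(2) q2(2) q1(3) q2(3) q1(4) q2(4) p])
    fix u assume u: "0 < u" "u < p"
    then have u': "u \<le> p" "u < 1" using p by auto
    show "lquantile \<mu> u \<le> a \<and> lquantile \<nu> u \<le> b" using left[OF u(1) u'(1)] by (simp only: T_def S_def)
    have "\<sigma> u < 1 / 2" by (rule \<sigma>_bounds(3)[OF u(2)])
    then show "v u \<le> 0"
      unfolding v_def X_def using gauss.X_vs_\<xi>(1)[of "\<sigma> u"] \<sigma>_bounds(1)[of u] u u' by (simp add: cdf_gauss_0)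
  next
    fix u assume u: "p < u" "u < 1"
    show "a \<le> lquantile \<mu> u \<and> b \<le> lquantile \<nu> u" using right[OF u] by (simp only: T_def S_def)
    have "1 / 2 \<le> \<sigma> u" by (rule \<sigma>_bounds(4)) (use u in simp)
    then show "0 \<le> v u"
      unfolding v_def X_def using gauss.X_vs_\<xi>(2)[of "\<sigma> u"] \<sigma>_bounds(2)[of u] u p by (simp add: cdf_gauss_0)
  next
    show "(\<lambda>u. sqrt ((lquantile \<mu> u - a) * (lquantile \<nu> u - b)) * \<bar>v u\<bar>) integrable_on {0..1}"
      using rvint by (simp only: r_def T_def S_def)
    show "(\<lambda>u. ln (w u)) integrable_on {0..1}" by (rule has_integral_integrable[OF Hlnw])
  next
    fix u :: real assume u: "0 < u" "u < 1" "u \<noteq> p"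
    show "0 < w u" using c0[of u] by (simp add: w_def)
    have s: "0 < \<sigma> u" "\<sigma> u < 1" using \<sigma>_bounds u by auto
    have "(\<sigma> has_real_derivative 1 / c u) (at u)"
      using split_map_deriv[OF p, of u] u(3) by (cases "u < p") (simp_all add: c_def \<sigma>_def)
    then have "((\<lambda>t. c u * exp (- gauss_potential (X (\<sigma> t)))) has_real_derivative c u * (- X (\<sigma> u) * (1 / c u))) (at u)"
      unfolding X_def by (intro DERIV_cmult gauss.exp_V_X_deriv s
        DERIV_chain2[where f = "\<lambda>u. exp (- gauss_potential (gauss.X u))" and g = \<sigma>])
    then have "((\<lambda>t. c u * exp (- gauss_potential (X (\<sigma> t)))) has_real_derivative - v u) (at u)"
      using c0[of u] by (simp add: v_def)
    then show "(w has_real_derivative - v u) (at u)"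
      by (rule has_field_derivative_transform_within_open[where S = "if u < p then {..<p} else {p<..}"])
        (use u in \<open>auto simp: w_def c_def split: if_splits\<close>)
    have "isCont X (\<sigma> u)" unfolding X_def by (rule gauss.X_cont[OF s])
    then show "isCont v u" unfolding v_def by (rule isCont_o2[OF \<sigma>_cont[OF u(3)]])
  next
    fix c d :: real assume cd: "0 < c" "c \<le> d" "d < 1"
    show "v c \<le> v d" unfolding v_def X_def
      by (rule lquantile_mono[OF gauss.m_real_distribution])
        (use \<sigma>_bounds cd in \<open>auto simp: \<sigma>_def intro!: split_map_mono p\<close>)
  next
    have "filterlim \<sigma> (at_left 1) (at_left 1)"
    proof (rule tendsto_imp_filterlim_at_left)
      show "(\<sigma> \<longlongrightarrow> 1) (at_left 1)"
        using \<sigma>_cont[of 1] p \<sigma>1 by (simp add: continuous_at filterlim_at_split)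
      show "\<forall>\<^sub>F x in at_left 1. \<sigma> x < 1"
        by (rule eventually_at_leftI[of 0]) (use \<sigma>_bounds in auto)
    qed
    then have "((\<lambda>u. exp (- gauss_potential (X (\<sigma> u)))) \<longlongrightarrow> 0) (at_left 1)"
      unfolding X_def by (rule filterlim_compose[OF gauss.exp_V_X_limits(1)])
    then have "((\<lambda>u. 2 * (1 - p) * exp (- gauss_potential (X (\<sigma> u)))) \<longlongrightarrow> 2 * (1 - p) * 0) (at_left 1)"
      by (intro tendsto_mult tendsto_const)
    moreover have "\<forall>\<^sub>F u in at_left 1. 2 * (1 - p) * exp (- gauss_potential (X (\<sigma> u))) = w u"
      by (rule eventually_at_leftI[of p]) (use p in \<open>auto simp: w_def c_def\<close>)
    ultimately show "(w \<longlongrightarrow> 0) (at_left 1)" by (simp add: tendsto_cong)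
    have "filterlim \<sigma> (at_right 0) (at_right 0)"
    proof (rule tendsto_imp_filterlim_at_right)
      show "(\<sigma> \<longlongrightarrow> 0) (at_right 0)"
        using \<sigma>_cont[of 0] p \<sigma>1 by (simp add: continuous_at filterlim_at_split)
      show "\<forall>\<^sub>F x in at_right 0. 0 < \<sigma> x"
        by (rule eventually_at_rightI[of 0 1]) (use \<sigma>_bounds in auto)
    qed
    then have "((\<lambda>u. exp (- gauss_potential (X (\<sigma> u)))) \<longlongrightarrow> 0) (at_right 0)"
      unfolding X_def by (rule filterlim_compose[OF gauss.exp_V_X_limits(2)])
    then have "((\<lambda>u. 2 * p * exp (- gauss_potential (X (\<sigma> u)))) \<longlongrightarrow> 2 * p * 0) (at_right 0)"
      by (intro tendsto_mult tendsto_const)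
    moreover have "\<forall>\<^sub>F u in at_right 0. 2 * p * exp (- gauss_potential (X (\<sigma> u))) = w u"
      by (rule eventually_at_rightI[of 0 p]) (use p in \<open>auto simp: w_def c_def\<close>)
    ultimately show "(w \<longlongrightarrow> 0) (at_right 0)" by (simp add: tendsto_cong)
  qed
  have "integral {0..1} (\<lambda>u. r u * \<bar>v u\<bar> - 1 - ln (w u)) \<le> K / 2 + 1 / 2 - 1 - (L - (1 / 2 + C))"
  proof (rule has_integral_le)
    show "((\<lambda>u. r u * \<bar>v u\<bar> - 1 - ln (w u)) has_integral integral {0..1} (\<lambda>u. r u * \<bar>v u\<bar> - 1 - ln (w u))) {0<..<1}"
      unfolding has_integral_Icc_iff_Ioo[symmetric]
      by (intro integrable_integral integrable_diff rvint has_integral_integrable[OF Hlnw] integrable_const_ivl)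
    show "((\<lambda>u. (T u - a) * (S u - b) / 2 + (v u)\<^sup>2 / 2 - 1 - ln (w u)) has_integral K / 2 + 1 / 2 - 1 - (L - (1 / 2 + C))) {0<..<1}"
      unfolding has_integral_Icc_iff_Ioo[symmetric]
      by (intro has_integral_diff Hbd Hlnw has_integral_const_unit_interval)
    show "r u * \<bar>v u\<bar> - 1 - ln (w u) \<le> (T u - a) * (S u - b) / 2 + (v u)\<^sup>2 / 2 - 1 - ln (w u)" if "u \<in> {0<..<1}" for u
      using rv_le[of u] that by simp
  qed
  \<comment> \<open>The rescaling of the two halves enters the upper bound as
    \<open>- 2 * L\<close>, so it can be discarded.\<close>
  moreover have "0 \<le> L" unfolding L_def by (rule split_log_nonneg[OF p])
  ultimately have "- (\<integral>x. ln (q1 x) \<partial>\<mu>) - (\<integral>x. ln (q2 x) \<partial>\<nu>) \<le> K + 2 * C"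
    using ent unfolding r_def T_def S_def by linarith
  moreover have "(\<integral>x. gauss_potential x \<partial>\<mu>) = (\<integral>x. x\<^sup>2 \<partial>\<mu>) / 2 + C"
  proof -
    interpret real_distribution \<mu> by (rule \<mu>(1))
    have "(\<integral>x. x\<^sup>2 / 2 + C \<partial>\<mu>) = (\<integral>x. x\<^sup>2 / 2 \<partial>\<mu>) + (\<integral>x. C \<partial>\<mu>)"
      by (rule Bochner_Integration.integral_add[OF integrable_divide[OF \<mu>(2)] integrable_const])
    then show ?thesis unfolding gp using prob_space by simp
  qed
  moreover have "(\<integral>x. gauss_potential x \<partial>\<nu>) = (\<integral>x. x\<^sup>2 \<partial>\<nu>) / 2 + C"
  proof -
    interpret real_distribution \<nu> by (rule \<nu>(1))
    have "(\<integral>x. x\<^sup>2 / 2 + C \<partial>\<nu>) = (\<integral>x. x\<^sup>2 / 2 \<partial>\<nu>) + (\<integral>x. C \<partial>\<nu>)"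
      by (rule Bochner_Integration.integral_add[OF integrable_divide[OF \<nu>(2)] integrable_const])
    then show ?thesis unfolding gp using prob_space by simp
  qed
  moreover have "e\<^sub>1 = (\<integral>x. ln (q1 x) \<partial>\<mu>) + (\<integral>x. gauss_potential x \<partial>\<mu>)"
    "e\<^sub>2 = (\<integral>x. ln (q2 x) \<partial>\<nu>) + (\<integral>x. gauss_potential x \<partial>\<nu>)"
    using E1 E2 unfolding e' by simp_all
  ultimately have "W / 2 + a * bar \<nu> \<le> e\<^sub>1 + e\<^sub>2"
    unfolding K_def by (simp add: algebra_simps)
  then show ?thesis unfolding W_def T_def S_def a_def by simp
qed

lemma gauss_entropy_bar_bound:
  assumes P2: "\<mu> \<in> P2" "\<nu> \<in> P2"
  shows "ereal (1 / 2) * enn2ereal (W2_sq \<mu> \<nu>)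
    \<le> ereal 1 * (Ent gamma1 \<mu> + Ent gamma1 \<nu>) + ereal (- bar \<mu> * bar \<nu>)"
proof (rule W2_sq_entropy_ereal[OF _ _ P2])
  show "prob_space gamma1" "sets gamma1 = sets borel"
    using gauss.prob gauss.m.events_eq_borel by (simp_all only: exp_measure_gauss_potential)
  show "(0::real) < 1" by simp
  fix e1 e2 assume "Ent gamma1 \<mu> = ereal e1" "Ent gamma1 \<nu> = ereal e2"
  from finite_gauss_entropy_bar_bound[OF P2 this]
  show "integral {0..1} (\<lambda>u. (lquantile \<mu> u - lquantile \<nu> u)\<^sup>2) / 2 \<le> 1 * (e1 + e2) + - bar \<mu> * bar \<nu>"
    by simp
qed

theorem theorem5p11:
  fixes \<mu> \<nu> :: "real measure"
  assumes "\<mu> \<in> P2" and "\<nu> \<in> P2"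
  shows "(\<forall>(m :: real measure) (V :: real \<Rightarrow> real) (\<kappa> :: real).
            0 < \<kappa> \<and> smooth_real V \<and> kappa_convex \<kappa> V \<and> m = exp_measure V \<and> prob_space m \<longrightarrow>
            ereal (1 / 2) * enn2ereal (W2_sq \<mu> \<nu>)
              \<le> ereal (1 / \<kappa>) * (Ent m \<mu> + Ent m \<nu>) + ereal (Phi m \<mu> \<nu>))
       \<and> Phi_gauss \<mu> \<nu> =
            - alpha gamma1 \<nu> * bar \<mu> - alpha gamma1 \<mu> * bar \<nu> + alpha gamma1 \<mu> * alpha gamma1 \<nu>
       \<and> ereal (1 / 2) * enn2ereal (W2_sq \<mu> \<nu>)
            \<le> Ent gamma1 \<mu> + Ent gamma1 \<nu> + ereal (min (Phi_gauss \<mu> \<nu>) (- bar \<mu> * bar \<nu>))"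
proof (intro conjI allI impI)
  fix m :: "real measure" and V :: "real \<Rightarrow> real" and \<kappa> :: real
  assume *: "0 < \<kappa> \<and> smooth_real V \<and> kappa_convex \<kappa> V \<and> m = exp_measure V \<and> prob_space m"
  then have V: "0 < \<kappa>" "smooth_real V" "kappa_convex \<kappa> V" "prob_space (exp_measure V)" and m: "m = exp_measure V"
    by auto
  from V obtain \<xi> where "strongly_convex_potential V (deriv V) \<kappa> \<xi>"
    by (rule strongly_convex_potential_of_smooth)
  from strongly_convex_potential.transport_entropy_bound[OF this assms]
  show "ereal (1 / 2) * enn2ereal (W2_sq \<mu> \<nu>) \<le> ereal (1 / \<kappa>) * (Ent m \<mu> + Ent m \<nu>) + ereal (Phi m \<mu> \<nu>)"
    unfolding m .
next
  show "Phi_gauss \<mu> \<nu> =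
      - alpha gamma1 \<nu> * bar \<mu> - alpha gamma1 \<mu> * bar \<nu> + alpha gamma1 \<mu> * alpha gamma1 \<nu>"
    by (rule Phi_gauss_eq)
next
  have "ereal (1 / 2) * enn2ereal (W2_sq \<mu> \<nu>) \<le> Ent gamma1 \<mu> + Ent gamma1 \<nu> + ereal (Phi_gauss \<mu> \<nu>)"
    using gauss.transport_entropy_bound[OF assms]
    by (simp only: exp_measure_gauss_potential Phi_gauss_def div_by_1 one_ereal_def[symmetric] mult_1)
  moreover have "ereal (1 / 2) * enn2ereal (W2_sq \<mu> \<nu>) \<le> Ent gamma1 \<mu> + Ent gamma1 \<nu> + ereal (- bar \<mu> * bar \<nu>)"
    using gauss_entropy_bar_bound[OF assms] by (simp only: one_ereal_def[symmetric] mult_1)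
  ultimately show "ereal (1 / 2) * enn2ereal (W2_sq \<mu> \<nu>)
      \<le> Ent gamma1 \<mu> + Ent gamma1 \<nu> + ereal (min (Phi_gauss \<mu> \<nu>) (- bar \<mu> * bar \<nu>))"
    by (simp only: min_def split: if_split) simp
qed

end
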